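(* Let $f\in\mathbb{R}[x]=\mathbb{R}[x_1,\dots,x_n]$ have degree $d$, let $c_j\in\mathbb{R}[x]$ ($j\in\mathcal{E}\cup\mathcal{I}$, with $\mathcal{E},\mathcal{I}$ finite disjoint index sets), let $K=\{x\in\mathbb{R}^n:c_j(x)=0\ (j\in\mathcal{E}),\ c_j(x)\ge0\ (j\in\mathcal{I})\}$ be nonempty, and let $f_{\min}=\inf_{x\in K}f(x)$. Suppose $K$ is closed at infinity and $f\in\mathbb{R}+\mathrm{int}(\mathscr{P}_d(K))$ (so that $f_{\min}>-\infty$). Suppose the LICQC, SCC and SOSC hold at every (global) minimizer of the problem in $\tilde x=(x_0,x)\in\mathbb{R}^{n+1}$ $$\begin{array}{rl}\min&\tilde f(\tilde x)-f_{\min}\cdot x_0^d\\ \text{s.t.}&\tilde c_j(\tilde x)=0\ (j\in\mathcal{E}),\ x_0^2+\|x\|^2-1=0,\\ &\tilde c_j(\tilde x)\ge0\ (j\in\mathcal{I}),\ x_0\ge0.\end{array}$$ Let $f_k$ be the optimal value of the $k$th order homogenized SOS relaxation $$\max\ \gamma\quad\text{s.t.}\quad\tilde f-\gamma x_0^d\in\mathrm{Ideal}[\tilde c_{eq}]_{2k}+\mathrm{QM}[\tilde c_{in}]_{2k},$$ and let $f_k'$ be the optimal value of the $k$th order moment relaxation $$\begin{array}{rl}\min&\langle\tilde f,w\rangle\\ \text{s.t.}&\langle x_0^d,w\rangle=1,\ \mathscr{V}_{1-\|\tilde x\|^2}^{(2k)}[w]=0,\ \mathscr{V}_{\tilde c_j}^{(2k)}[w]=0\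 (j\in\mathcal{E}),\\ &L_{x_0}^{(k)}[w]\succeq0,\ L_{\tilde c_j}^{(k)}[w]\succeq0\ (j\in\mathcal{I}),\ M_k[w]\succeq0,\ w\in\mathbb{R}^{\mathbb{N}^{n+1}_{2k}}.\end{array}$$ Then $f_k=f_k'=f_{\min}$ for all $k$ sufficiently large. Furthermore, when $k$ is sufficiently large, every minimizer of this moment relaxation has a flat truncation.
   Context: Notation. $\mathbb{R}[x]_d$ is the space of polynomials of degree at most $d$. $\mathscr{P}_d(K)=\{p\in\mathbb{R}[x]_d:p\ge0\text{ on }K\}$, with interior taken in $\mathbb{R}[x]_d$; $f\in\mathbb{R}+\mathrm{int}(\mathscr{P}_d(K))$ means $f-c\in\mathrm{int}(\mathscr{P}_d(K))$ for some constant $c\in\mathbb{R}$. $\mathbb{N}^{n+1}_{s}=\{\alpha\in\mathbb{N}^{n+1}:|\alpha|\le s\}$; for $w\in\mathbb{R}^{\mathbb{N}^{n+1}_{2k}}$ and $p=\sum p_\alpha\tilde x^\alpha$ with $\deg p\le2k$, $\langle p,w\rangle=\sum_\alpha p_\alpha w_\alpha$. Homogenization. For $p\in\mathbb{R}[x]$, $\tilde p(\tilde x)=x_0^{\deg p}p(x/x_0)$ with $\tilde x=(x_0,x_1,\dots,x_n)$. Set $\widetilde K=\{\tilde x\in\mathbb{R}^{n+1}:\tilde c_j(\tilde x)=0\ (j\in\mathcal{E}),\ \tilde c_j(\tilde x)\ge0\ (j\in\mathcal{I}),\ \|\tilde x\|^2-1=0,\ x_0\ge0\}$. $K$ is closed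 at infinity if $\widetilde K=\mathrm{cl}(\widetilde K\cap\{x_0>0\})$. Tuples: $\tilde c_{eq}=\{\tilde c_j\}_{j\in\mathcal{E}}\cup\{\|\tilde x\|^2-1\}$, $\tilde c_{in}=\{\tilde c_j\}_{j\in\mathcal{I}}\cup\{x_0\}$. Ideals and quadratic modules (in $\mathbb{R}[\tilde x]$). $\Sigma[\tilde x]$ is the set of sums of squares, $\Sigma[\tilde x]_k=\Sigma[\tilde x]\cap\mathbb{R}[\tilde x]_k$. $\mathrm{Ideal}[h]_k=\sum_ih_i\,\mathbb{R}[\tilde x]_{k-\deg h_i}$ and $\mathrm{QM}[g]_k=\Sigma[\tilde x]_k+\sum_ig_i\,\Sigma[\tilde x]_{k-\deg g_i}$. Localizing objects. For $w\in\mathbb{R}^{\mathbb{N}^{n+1}_{2k}}$ and a polynomial $q$ with $\deg q\le 2k$: $L_q^{(k)}[w]$ is the symmetric matrix with $\mathrm{vec}(p)^TL_q^{(k)}[w]\mathrm{vec}(p)=\langle qp^2,w\rangle$ for all $p\in\mathbb{R}[\tilde x]$ with $2\deg p\le2k-\deg q$ ($\mathrm{vec}(p)$ is the coefficient vector); $M_k[w]=L_1^{(k)}[w]$; $\mathscr{V}_q^{(2k)}[w]$ is the vector with $\langle qp,w\rangle=(\mathscr{V}_q^{(2k)}[w])^T\mathrm{vec}(p)$ for all $p$ with $\deg p\le2k-\deg q$. Flat truncation. Let $\tilde d_K=\max\{1,\max_j\lceil\deg(c_j)/2\rceil\}$ and $\tilde d_0=\max\{\lceil d/2\rceil,\tilde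 d_K\}$; relaxation orders are $k\ge\tilde d_0$. $w\in\mathbb{R}^{\mathbb{N}^{n+1}_{2k}}$ has a flat truncation if there is an integer $t\in[\tilde d_0,k]$ with $\mathrm{rank}\,M_{t-\tilde d_K}[w|_{2t}]=\mathrm{rank}\,M_t[w|_{2t}]$, where $w|_{2t}$ is the restriction of $w$ to indices in $\mathbb{N}^{n+1}_{2t}$. Optimality conditions. For a problem $\min F(u)$ s.t. $g_j(u)=0$ ($j\in E$), $g_j(u)\ge0$ ($j\in I$), and a minimizer $u^*$, let $J(u^* )=\{j\in E\cup I:g_j(u^* )=0\}$. LICQC: the gradients $\nabla g_j(u^* )$, $j\in J(u^* )$, are linearly independent; then there are (unique) multipliers $\lambda_j$ with $\nabla F(u^* )=\sum_{j\in E\cup I}\lambda_j\nabla g_j(u^* )$, and $\lambda_j\ge0$, $\lambda_jg_j(u^* )=0$ for $j\in I$. SCC: $\lambda_j+g_j(u^* )>0$ for all $j\in I$. SOSC: with $\mathscr{L}=F-\sum_j\lambda_jg_j$, $v^T\nabla^2\mathscr{L}(u^* )v>0$ for every nonzero $v$ with $v^T\nabla g_j(u^* )=0$ for all $j\in J(u^* )$. Here all listed constraints, including the sphere constraint and $x_0\ge0$, count as constraints. *)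

theory Defs
  imports "HOL-Analysis.Analysis" "HOL-Analysis.Finite_Function_Topology"
begin

section \<open>Real polynomials in finitely many variables\<close>

text \<open>
  A polynomial in variables indexed by a finite type \<^typ>\<open>'v\<close> is a finitely supported map from
  exponents \<^typ>\<open>'v \<Rightarrow>\<^sub>0 nat\<close> to coefficients; the ring operations are those of
  \<^theory>\<open>HOL-Library.Poly_Mapping\<close>.  The variables \<open>x_1, ..., x_n\<close> are indexed by a finite type
  \<open>'n\<close> and the homogenized variables \<open>x_0, x_1, ..., x_n\<close> by \<open>'n option\<close>, where \<^const>\<open>None\<close>
  is the index of \<open>x_0\<close>.
\<close>

type_synonym 'v exponent = "'v \<Rightarrow>\<^sub>0 nat"
type_synonym 'v mpoly = "('v \<Rightarrow>\<^sub>0 nat) \<Rightarrow>\<^sub>0 real"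

definition edeg :: "'v::finite exponent \<Rightarrow> nat" where
  "edeg \<alpha> = (\<Sum>i\<in>UNIV. Poly_Mapping.lookup \<alpha> i)"

text \<open>Total degree, with the convention that the zero polynomial has degree 0.\<close>

definition tdeg :: "'v::finite mpoly \<Rightarrow> nat" where
  "tdeg p = Max (insert 0 (edeg ` Poly_Mapping.keys p))"

definition monomial :: "'v exponent \<Rightarrow> 'v mpoly" where
  "monomial \<alpha> = Poly_Mapping.single \<alpha> 1"

definition Var :: "'v \<Rightarrow> 'v mpoly" where
  "Var i = monomial (Poly_Mapping.single i 1)"

definition Const :: "real \<Rightarrow> 'v mpoly" where
  "Const a = Poly_Mapping.single 0 a"

definition eval :: "'v::finite mpoly \<Rightarrow> real ^ 'v \<Rightarrow> real" where
  "eval p x = (\<Sum>\<alpha>\<in>Poly_Mapping.keys p.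
     Poly_Mapping.lookup p \<alpha> * (\<Prod>i\<in>UNIV. (x $ i) ^ Poly_Mapping.lookup \<alpha> i))"

definition polys_le :: "nat \<Rightarrow> 'v::finite mpoly set" where
  "polys_le d = {p. tdeg p \<le> d}"

definition nonneg_polys :: "nat \<Rightarrow> (real ^ 'v) set \<Rightarrow> 'v::finite mpoly set" where
  "nonneg_polys d K = {p \<in> polys_le d. \<forall>x\<in>K. 0 \<le> eval p x}"

text \<open>
  The topology on \<^typ>\<open>'v mpoly\<close> is that of the \<open>\<ell>\<^sub>1\<close>-norm of the coefficients, so that
  \<^term>\<open>top_of_set (polys_le d)\<close> is the Euclidean topology of the finite-dimensional space of
  polynomials of degree at most \<^term>\<open>d\<close>.
\<close>

definition int_nonneg_polys :: "nat \<Rightarrow> (real ^ 'v) set \<Rightarrow> 'v::finite mpoly set" where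
  "int_nonneg_polys d K = (top_of_set (polys_le d)) interior_of (nonneg_polys d K)"


section \<open>Homogenization\<close>

definition hom_exponent :: "nat \<Rightarrow> 'n::finite exponent \<Rightarrow> 'n option exponent" where
  "hom_exponent d \<alpha> = Poly_Mapping.single None (d - edeg \<alpha>)
     + (\<Sum>i\<in>UNIV. Poly_Mapping.single (Some i) (Poly_Mapping.lookup \<alpha> i))"

definition homogenize :: "'n::finite mpoly \<Rightarrow> 'n option mpoly" where
  "homogenize p = (\<Sum>\<alpha>\<in>Poly_Mapping.keys p.
     Poly_Mapping.single (hom_exponent (tdeg p) \<alpha>) (Poly_Mapping.lookup p \<alpha>))"

definition norm_sq_poly :: "'v::finite mpoly" where
  "norm_sq_poly = (\<Sum>i\<in>UNIV. Var i ^ 2)"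


section \<open>Feasible sets\<close>

definition feasible_set ::
    "('j \<Rightarrow> real ^ 'v \<Rightarrow> real) \<Rightarrow> 'j set \<Rightarrow> 'j set \<Rightarrow> (real ^ 'v) set" where
  "feasible_set g E I = {u. (\<forall>j\<in>E. g j u = 0) \<and> (\<forall>j\<in>I. 0 \<le> g j u)}"

text \<open>
  Constraints are kept as indexed families (not sets of polynomials), so that repeated
  constraints are counted with repetition in the constraint qualification below.
\<close>

datatype 'j hindex = Orig 'j | Sphere | X0

primrec hom_con :: "('j \<Rightarrow> 'n::finite mpoly) \<Rightarrow> 'j hindex \<Rightarrow> 'n option mpoly" where
  "hom_con c (Orig j) = homogenize (c j)"
| "hom_con c Sphere = norm_sq_poly - 1"
| "hom_con c X0 = Var None"

definition hom_eq :: "'j set \<Rightarrow> 'j hindex set" where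
  "hom_eq E = insert Sphere (Orig ` E)"

definition hom_in :: "'j set \<Rightarrow> 'j hindex set" where
  "hom_in I = insert X0 (Orig ` I)"

definition hom_set :: "('j \<Rightarrow> 'n::finite mpoly) \<Rightarrow> 'j set \<Rightarrow> 'j set \<Rightarrow> (real ^ 'n option) set" where
  "hom_set c E I = feasible_set (\<lambda>j. eval (hom_con c j)) (hom_eq E) (hom_in I)"

definition closed_at_infinity :: "('j \<Rightarrow> 'n::finite mpoly) \<Rightarrow> 'j set \<Rightarrow> 'j set \<Rightarrow> bool" where
  "closed_at_infinity c E I \<longleftrightarrow>
     hom_set c E I = closure (hom_set c E I \<inter> {u. 0 < u $ None})"


section \<open>Optimality conditions\<close>

text \<open>Throughout, \<open>F\<close> is the objective, \<open>g\<close> the family of constraint functions, \<open>E\<close> and \<open>I\<close>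
  index the equality and inequality constraints.\<close>

definition grad :: "(real ^ 'v \<Rightarrow> real) \<Rightarrow> real ^ 'v \<Rightarrow> real ^ 'v::finite" where
  "grad F u = (THE D. GDERIV F u :> D)"

definition hessian :: "(real ^ 'v \<Rightarrow> real) \<Rightarrow> real ^ 'v \<Rightarrow> real ^ 'v ^ 'v::finite" where
  "hessian F u = jacobian (grad F) (at u)"

definition active ::
    "('j \<Rightarrow> real ^ 'v \<Rightarrow> real) \<Rightarrow> 'j set \<Rightarrow> 'j set \<Rightarrow> real ^ 'v \<Rightarrow> 'j set" where
  "active g E I u = {j \<in> E \<union> I. g j u = 0}"

definition LICQC ::
    "('j \<Rightarrow> real ^ 'v::finite \<Rightarrow> real) \<Rightarrow> 'j set \<Rightarrow> 'j set \<Rightarrow> real ^ 'v \<Rightarrow> bool" where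
  "LICQC g E I u \<longleftrightarrow> inj_on (\<lambda>j. grad (g j) u) (active g E I u)
     \<and> independent ((\<lambda>j. grad (g j) u) ` active g E I u)"

definition multipliers ::
    "(real ^ 'v::finite \<Rightarrow> real) \<Rightarrow> ('j \<Rightarrow> real ^ 'v \<Rightarrow> real) \<Rightarrow> 'j set \<Rightarrow> 'j set \<Rightarrow> real ^ 'v
      \<Rightarrow> ('j \<Rightarrow> real) \<Rightarrow> bool" where
  "multipliers F g E I u lam \<longleftrightarrow>
     grad F u = (\<Sum>j\<in>E \<union> I. lam j *\<^sub>R grad (g j) u)
     \<and> (\<forall>j\<in>I. 0 \<le> lam j \<and> lam j * g j u = 0)"

text \<open>
  At a minimizer satisfying \<^const>\<open>LICQC\<close> the multipliers exist and their values on \<open>E \<union> I\<close> are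
  unique, so the quantifier over multipliers in the next two definitions refers to that one vector.
\<close>

definition SCC ::
    "(real ^ 'v::finite \<Rightarrow> real) \<Rightarrow> ('j \<Rightarrow> real ^ 'v \<Rightarrow> real) \<Rightarrow> 'j set \<Rightarrow> 'j set \<Rightarrow> real ^ 'v
      \<Rightarrow> bool" where
  "SCC F g E I u \<longleftrightarrow> (\<forall>lam. multipliers F g E I u lam \<longrightarrow> (\<forall>j\<in>I. 0 < lam j + g j u))"

definition SOSC ::
    "(real ^ 'v::finite \<Rightarrow> real) \<Rightarrow> ('j \<Rightarrow> real ^ 'v \<Rightarrow> real) \<Rightarrow> 'j set \<Rightarrow> 'j set \<Rightarrow> real ^ 'v
      \<Rightarrow> bool" where
  "SOSC F g E I u \<longleftrightarrow> (\<forall>lam. multipliers F g E I u lam \<longrightarrow>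
     (\<forall>v. v \<noteq> 0 \<and> (\<forall>j\<in>active g E I u. v \<bullet> grad (g j) u = 0) \<longrightarrow>
        0 < v \<bullet> (hessian (\<lambda>y. F y - (\<Sum>j\<in>E \<union> I. lam j * g j y)) u *v v)))"


section \<open>Truncated ideals and quadratic modules\<close>

definition SOS :: "'v mpoly set" where
  "SOS = {p. \<exists>(m::nat) q. p = (\<Sum>i<m. q i ^ 2)}"

text \<open>
  The degree bounds \<open>deg p \<le> k - deg h\<close> are written additively; the multiplier 0 is always
  allowed, also if \<open>deg h > k\<close>.
\<close>

definition trunc_ideal :: "('j \<Rightarrow> 'v::finite mpoly) \<Rightarrow> 'j set \<Rightarrow> nat \<Rightarrow> 'v mpoly set" where
  "trunc_ideal h J k = {\<Sum>j\<in>J. h j * p j | p. \<forall>j\<in>J. p j = 0 \<or> tdeg (h j) + tdeg (p j) \<le> k}"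

definition trunc_qmodule :: "('j \<Rightarrow> 'v::finite mpoly) \<Rightarrow> 'j set \<Rightarrow> nat \<Rightarrow> 'v mpoly set" where
  "trunc_qmodule g J k = {s\<^sub>0 + (\<Sum>j\<in>J. g j * s j) | s\<^sub>0 s.
     s\<^sub>0 \<in> SOS \<and> tdeg s\<^sub>0 \<le> k
     \<and> (\<forall>j\<in>J. s j \<in> SOS \<and> (s j = 0 \<or> tdeg (g j) + tdeg (s j) \<le> k))}"


section \<open>Truncated multi-sequences and localizing objects\<close>

text \<open>A truncated multi-sequence of degree \<open>s\<close> is an element of \<open>exponents_le s \<rightarrow>\<^sub>E UNIV\<close>.\<close>

definition exponents_le :: "nat \<Rightarrow> 'v::finite exponent set" where
  "exponents_le s = {\<alpha>. edeg \<alpha> \<le> s}"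

definition pairing :: "'v mpoly \<Rightarrow> ('v exponent \<Rightarrow> real) \<Rightarrow> real" where
  "pairing p w = (\<Sum>\<alpha>\<in>Poly_Mapping.keys p. Poly_Mapping.lookup p \<alpha> * w \<alpha>)"

text \<open>Matrices with rows and columns indexed by a finite set \<open>A\<close> are functions \<open>'a \<Rightarrow> 'a \<Rightarrow> real\<close>,
  of which only the values on \<open>A \<times> A\<close> matter.\<close>

definition psd_on :: "'a set \<Rightarrow> ('a \<Rightarrow> 'a \<Rightarrow> real) \<Rightarrow> bool" where
  "psd_on A M \<longleftrightarrow> (\<forall>a\<in>A. \<forall>b\<in>A. M a b = M b a)
     \<and> (\<forall>v. 0 \<le> (\<Sum>a\<in>A. \<Sum>b\<in>A. v a * M a b * v b))"

text \<open>Dimension of the column space.\<close>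

definition rank_on :: "'a set \<Rightarrow> ('a \<Rightarrow> 'a \<Rightarrow> real) \<Rightarrow> nat" where
  "rank_on A M = dim ((\<lambda>b. \<Sum>a\<in>A. Poly_Mapping.single a (M a b)) ` A)"

text \<open>
  \<open>loc_index q k\<close> is the index set of the localizing matrix \<open>L_q^(k)[w]\<close>, i.e. the exponents of the
  polynomials \<open>p\<close> with \<open>2 deg p \<le> 2k - deg q\<close>, and \<open>loc_matrix q w\<close> gives its entries; see the
  lemmas \<open>loc_matrix_sym\<close> and \<open>loc_matrix_quadratic\<close> below for the characterizing properties.
\<close>

definition loc_index :: "'v::finite mpoly \<Rightarrow> nat \<Rightarrow> 'v exponent set" where
  "loc_index q k = {\<alpha>. 2 * edeg \<alpha> + tdeg q \<le> 2 * k}"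

definition loc_matrix ::
    "'v mpoly \<Rightarrow> ('v exponent \<Rightarrow> real) \<Rightarrow> 'v exponent \<Rightarrow> 'v exponent \<Rightarrow> real" where
  "loc_matrix q w \<alpha> \<beta> = pairing (q * monomial \<alpha> * monomial \<beta>) w"

definition loc_psd :: "nat \<Rightarrow> 'v::finite mpoly \<Rightarrow> ('v exponent \<Rightarrow> real) \<Rightarrow> bool" where
  "loc_psd k q w \<longleftrightarrow> psd_on (loc_index q k) (loc_matrix q w)"

text \<open>\<open>loc_vec_zero k q w\<close> says that the localizing vector of \<open>q\<close>, with entries
  \<open>\<langle>q x\<^sup>\<alpha>, w\<rangle>\<close> for \<open>|\<alpha>| \<le> 2k - deg q\<close>, vanishes.\<close>

definition loc_vec_zero :: "nat \<Rightarrow> 'v::finite mpoly \<Rightarrow> ('v exponent \<Rightarrow> real) \<Rightarrow> bool" where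
  "loc_vec_zero k q w \<longleftrightarrow> (\<forall>\<alpha>. edeg \<alpha> + tdeg q \<le> 2 * k \<longrightarrow> pairing (q * monomial \<alpha>) w = 0)"

definition moment_rank :: "nat \<Rightarrow> ('v::finite exponent \<Rightarrow> real) \<Rightarrow> nat" where
  "moment_rank s w = rank_on (loc_index 1 s) (loc_matrix 1 w)"


section \<open>Homogenized relaxations\<close>

definition sos_feasible ::
    "'n::finite mpoly \<Rightarrow> ('j \<Rightarrow> 'n mpoly) \<Rightarrow> 'j set \<Rightarrow> 'j set \<Rightarrow> nat \<Rightarrow> real set" where
  "sos_feasible f c E I k = {\<gamma>. \<exists>p \<in> trunc_ideal (hom_con c) (hom_eq E) (2 * k).
     \<exists>q \<in> trunc_qmodule (hom_con c) (hom_in I) (2 * k).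
       homogenize f - Const \<gamma> * Var None ^ tdeg f = p + q}"

definition sos_value ::
    "'n::finite mpoly \<Rightarrow> ('j \<Rightarrow> 'n mpoly) \<Rightarrow> 'j set \<Rightarrow> 'j set \<Rightarrow> nat \<Rightarrow> ereal" where
  "sos_value f c E I k = (SUP \<gamma>\<in>sos_feasible f c E I k. ereal \<gamma>)"

definition moment_feasible ::
    "'n::finite mpoly \<Rightarrow> ('j \<Rightarrow> 'n mpoly) \<Rightarrow> 'j set \<Rightarrow> 'j set \<Rightarrow> nat
      \<Rightarrow> ('n option exponent \<Rightarrow> real) set" where
  "moment_feasible f c E I k = {w \<in> exponents_le (2 * k) \<rightarrow>\<^sub>E UNIV.
     pairing (Var None ^ tdeg f) w = 1
     \<and> loc_vec_zero k (1 - norm_sq_poly) w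
     \<and> (\<forall>j\<in>E. loc_vec_zero k (homogenize (c j)) w)
     \<and> loc_psd k (Var None) w
     \<and> (\<forall>j\<in>I. loc_psd k (homogenize (c j)) w)
     \<and> loc_psd k 1 w}"

definition moment_value ::
    "'n::finite mpoly \<Rightarrow> ('j \<Rightarrow> 'n mpoly) \<Rightarrow> 'j set \<Rightarrow> 'j set \<Rightarrow> nat \<Rightarrow> ereal" where
  "moment_value f c E I k = (INF w\<in>moment_feasible f c E I k. ereal (pairing (homogenize f) w))"

definition moment_minimizer ::
    "'n::finite mpoly \<Rightarrow> ('j \<Rightarrow> 'n mpoly) \<Rightarrow> 'j set \<Rightarrow> 'j set \<Rightarrow> nat
      \<Rightarrow> ('n option exponent \<Rightarrow> real) \<Rightarrow> bool" where
  "moment_minimizer f c E I k w \<longleftrightarrow>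
     is_arg_min (pairing (homogenize f)) (\<lambda>w. w \<in> moment_feasible f c E I k) w"

definition order_K :: "('j \<Rightarrow> 'n::finite mpoly) \<Rightarrow> 'j set \<Rightarrow> 'j set \<Rightarrow> nat" where
  "order_K c E I = Max (insert 1 ((\<lambda>j. nat \<lceil>real (tdeg (c j)) / 2\<rceil>) ` (E \<union> I)))"

definition order_0 :: "nat \<Rightarrow> ('j \<Rightarrow> 'n::finite mpoly) \<Rightarrow> 'j set \<Rightarrow> 'j set \<Rightarrow> nat" where
  "order_0 d c E I = max (nat \<lceil>real d / 2\<rceil>) (order_K c E I)"

definition flat_truncation ::
    "nat \<Rightarrow> ('j \<Rightarrow> 'n::finite mpoly) \<Rightarrow> 'j set \<Rightarrow> 'j set \<Rightarrow> nat
      \<Rightarrow> ('n option exponent \<Rightarrow> real) \<Rightarrow> bool" where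
  "flat_truncation d c E I k w \<longleftrightarrow> (\<exists>t\<in>{order_0 d c E I..k}.
     moment_rank (t - order_K c E I) (restrict w (exponents_le (2 * t)))
       = moment_rank t (restrict w (exponents_le (2 * t))))"


section \<open>Agreement with the defining properties\<close>

lemma finite_exponents_le: "finite (exponents_le s :: 'v::finite exponent set)"
proof -
  have "(Poly_Mapping.lookup ` (exponents_le s :: 'v exponent set)) \<subseteq> Pi\<^sub>E UNIV (\<lambda>_. {..s})"
  proof -
    have "Poly_Mapping.lookup \<alpha> i \<le> edeg \<alpha>" for \<alpha> :: "'v exponent" and i
      unfolding edeg_def by (rule member_le_sum) auto
    then have "Poly_Mapping.lookup \<alpha> i \<le> s" if "edeg \<alpha> \<le> s" for \<alpha> :: "'v exponent" and i
      using that by (rule order_trans)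
    then show ?thesis
      by (auto simp: exponents_le_def PiE_def)
  qed
  then have "finite (Poly_Mapping.lookup ` (exponents_le s :: 'v exponent set))"
    by (rule finite_subset) (rule finite_PiE, simp_all)
  then show ?thesis
    by (rule finite_imageD) (simp add: inj_on_def lookup_inject)
qed

lemma eval_alt:
  assumes "finite A" "Poly_Mapping.keys p \<subseteq> A"
  shows "eval p x = (\<Sum>\<alpha>\<in>A.
     Poly_Mapping.lookup p \<alpha> * (\<Prod>i\<in>UNIV. (x $ i) ^ Poly_Mapping.lookup \<alpha> i))"
  unfolding eval_def using assms
  by (intro sum.mono_neutral_left) (auto simp: in_keys_iff)

lemma eval_add: "eval (p + q) x = eval p x + eval q x"
proof -
  let ?A = "Poly_Mapping.keys p \<union> Poly_Mapping.keys q"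
  have "Poly_Mapping.keys (p + q) \<subseteq> ?A" by (rule Poly_Mapping.keys_add)
  then show ?thesis
    by (subst (1 2 3) eval_alt[of ?A])
      (auto simp: lookup_add distrib_right sum.distrib)
qed

lemma eval_sum: "eval (\<Sum>a\<in>A. p a) x = (\<Sum>a\<in>A. eval (p a) x)"
  by (induction A rule: infinite_finite_induct) (auto simp: eval_add, auto simp: eval_def)

lemma eval_single:
  "eval (Poly_Mapping.single \<alpha> a) x = a * (\<Prod>i\<in>UNIV. (x $ i) ^ Poly_Mapping.lookup \<alpha> i)"
  by (cases "a = 0") (auto simp: eval_def)

lemma prod_option:
  "(\<Prod>i\<in>(UNIV :: 'n::finite option set). h i) = h None * (\<Prod>i\<in>UNIV. h (Some i) :: real)"
  by (simp add: UNIV_option_conv prod.reindex)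

lemma lookup_hom_exponent:
  "Poly_Mapping.lookup (hom_exponent d \<alpha>) None = d - edeg \<alpha>"
  "Poly_Mapping.lookup (hom_exponent d \<alpha>) (Some i) = Poly_Mapping.lookup \<alpha> i"
  by (simp_all add: hom_exponent_def lookup_add lookup_sum lookup_single when_def)

lemma eval_homogenize:
  fixes p :: "'n::finite mpoly" and u :: "real ^ 'n option"
  assumes "u $ None \<noteq> 0"
  shows "eval (homogenize p) u = (u $ None) ^ tdeg p * eval p (\<chi> i. u $ Some i / u $ None)"
proof -
  have *: "Poly_Mapping.lookup p \<alpha> *
      (u $ None ^ (tdeg p - edeg \<alpha>) * (\<Prod>i\<in>UNIV. u $ Some i ^ Poly_Mapping.lookup \<alpha> i)) =
    u $ None ^ tdeg p * (Poly_Mapping.lookup p \<alpha> *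
      (\<Prod>i\<in>UNIV. (u $ Some i / u $ None) ^ Poly_Mapping.lookup \<alpha> i))"
    if "\<alpha> \<in> Poly_Mapping.keys p" for \<alpha>
  proof -
    have le: "edeg \<alpha> \<le> tdeg p" using that by (simp add: tdeg_def)
    have "(\<Prod>i\<in>UNIV. (u $ Some i / u $ None) ^ Poly_Mapping.lookup \<alpha> i)
        = (\<Prod>i\<in>UNIV. u $ Some i ^ Poly_Mapping.lookup \<alpha> i) / u $ None ^ edeg \<alpha>"
      by (simp add: power_divide prod_dividef edeg_def power_sum)
    with le assms show ?thesis by (simp add: power_diff)
  qed
  show ?thesis
    unfolding homogenize_def eval_sum eval_single prod_option lookup_hom_exponent
    unfolding eval_def sum_distrib_left by (intro sum.cong refl) (simp only: vec_lambda_beta *)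
qed

lemma pairing_alt:
  assumes "finite A" "Poly_Mapping.keys p \<subseteq> A"
  shows "pairing p w = (\<Sum>\<alpha>\<in>A. Poly_Mapping.lookup p \<alpha> * w \<alpha>)"
  unfolding pairing_def using assms
  by (intro sum.mono_neutral_left) (auto simp: in_keys_iff)

lemma pairing_add: "pairing (p + q) w = pairing p w + pairing q w"
proof -
  let ?A = "Poly_Mapping.keys p \<union> Poly_Mapping.keys q"
  have "Poly_Mapping.keys (p + q) \<subseteq> ?A" by (rule Poly_Mapping.keys_add)
  then show ?thesis
    by (subst (1 2 3) pairing_alt[of ?A])
      (auto simp: lookup_add distrib_right sum.distrib)
qed

lemma pairing_sum: "pairing (\<Sum>a\<in>A. p a) w = (\<Sum>a\<in>A. pairing (p a) w)"
  by (induction A rule: infinite_finite_induct) (auto simp: pairing_add, auto simp: pairing_def)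

lemma pairing_Const_mult: "pairing (Const a * p) w = a * pairing p w"
proof -
  have l: "Poly_Mapping.lookup (Const a * p) \<alpha> = a * Poly_Mapping.lookup p \<alpha>" for \<alpha>
    by (simp add: Const_def mult_map_scale_conv_mult[symmetric] Poly_Mapping.map.rep_eq when_def)
  have "Poly_Mapping.keys (Const a * p) \<subseteq> Poly_Mapping.keys p"
    by (auto simp: in_keys_iff l)
  then show ?thesis
    by (subst pairing_alt[of "Poly_Mapping.keys p"])
      (auto simp: l pairing_def sum_distrib_left mult.assoc)
qed

lemma mpoly_expand:
  assumes "finite A" "Poly_Mapping.keys p \<subseteq> A"
  shows "p = (\<Sum>\<alpha>\<in>A. Const (Poly_Mapping.lookup p \<alpha>) * monomial \<alpha>)"
  using assms
  by (intro poly_mapping_eqI)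
    (auto simp: Const_def monomial_def mult_single lookup_sum lookup_single when_def in_keys_iff)

lemma loc_matrix_sym: "loc_matrix q w \<alpha> \<beta> = loc_matrix q w \<beta> \<alpha>"
  by (simp add: loc_matrix_def mult.assoc mult.commute[of "monomial \<alpha>"])

lemma loc_matrix_quadratic:
  fixes p q :: "'v::finite mpoly"
  assumes "2 * tdeg p + tdeg q \<le> 2 * k"
  shows "(\<Sum>\<alpha>\<in>loc_index q k. \<Sum>\<beta>\<in>loc_index q k.
      Poly_Mapping.lookup p \<alpha> * loc_matrix q w \<alpha> \<beta> * Poly_Mapping.lookup p \<beta>)
    = pairing (q * p ^ 2) w"
proof -
  let ?A = "loc_index q k"
  let ?t = "\<lambda>\<alpha>. Const (Poly_Mapping.lookup p \<alpha>) * monomial \<alpha>"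
  have fin: "finite ?A"
    by (rule finite_subset[OF _ finite_exponents_le[of k]])
      (auto simp: loc_index_def exponents_le_def)
  have "edeg \<alpha> \<le> tdeg p" if "\<alpha> \<in> Poly_Mapping.keys p" for \<alpha>
    using that by (simp add: tdeg_def)
  then have "Poly_Mapping.keys p \<subseteq> ?A"
    using assms by (fastforce simp: loc_index_def)
  then have p: "p = (\<Sum>\<alpha>\<in>?A. ?t \<alpha>)" by (rule mpoly_expand[OF fin])
  have "q * p ^ 2 = (\<Sum>\<alpha>\<in>?A. \<Sum>\<beta>\<in>?A. q * (?t \<alpha> * ?t \<beta>))"
  proof -
    have "p ^ 2 = (\<Sum>\<alpha>\<in>?A. ?t \<alpha>) * (\<Sum>\<alpha>\<in>?A. ?t \<alpha>)"
    proof -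
      have "a ^ 2 = b * b" if "a = b" for a b :: "'v mpoly"
        using that by (simp add: power2_eq_square)
      then show ?thesis using p .
    qed
    also have "\<dots> = (\<Sum>\<alpha>\<in>?A. \<Sum>\<beta>\<in>?A. ?t \<alpha> * ?t \<beta>)"
      by (rule sum_product)
    finally have "p ^ 2 = (\<Sum>\<alpha>\<in>?A. \<Sum>\<beta>\<in>?A. ?t \<alpha> * ?t \<beta>)" .
    then show ?thesis by (simp only: sum_distrib_left)
  qed
  also have "\<dots> = (\<Sum>\<alpha>\<in>?A. \<Sum>\<beta>\<in>?A. Const (Poly_Mapping.lookup p \<alpha>) *
      (Const (Poly_Mapping.lookup p \<beta>) * (q * monomial \<alpha> * monomial \<beta>)))"
    by (intro sum.cong refl) (simp only: ac_simps)
  finally have "pairing (q * p ^ 2) w = (\<Sum>\<alpha>\<in>?A. \<Sum>\<beta>\<in>?A. Poly_Mapping.lookup p \<alpha> *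
      (Poly_Mapping.lookup p \<beta> * loc_matrix q w \<alpha> \<beta>))"
    by (simp only: pairing_sum pairing_Const_mult loc_matrix_def)
  then show ?thesis
    by (simp add: mult_ac)
qed

end

theory Submission
  imports Defs "HOL-Computational_Algebra.Polynomial"
begin

text \<open>
  The polynomial \<open>P = f~ - fmin x_0^d\<close> is nonnegative on the compact set \<open>K~\<close>, and its zeros there are the
  minimizers. The conditions LICQC, SCC and SOSC provide a polynomial \<open>H\<close> with \<open>P - H\<close> in the quadratic module
  that vanishes to second order at the minimizers with positive definite Hessians; in particular the
  minimizers are finitely many. With generators \<open>m\<close> of their vanishing ideal that have independent
  differentials there, \<open>H = m^T A m\<close> where \<open>A\<close> is positive definite at the minimizers. Since
  \<open>m^T (|m|^2 Id - m m^T) m = 0\<close> and \<open>P = b^T m\<close>, adding \<open>N (b b^T + |m|^2 Id - m m^T)\<close> to \<open>A\<close> gives a representation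
  of \<open>H + N P^2\<close> by a matrix that is positive definite on all of \<open>K~\<close>, so a matrix Positivstellensatz puts
  \<open>P + N P^2 - e |m|^2\<close> into the quadratic module. Multiplying by \<open>(1 - P/B)^(2n)\<close> removes \<open>N P^2\<close>, so that
  \<open>P - e (|m (1 - P t)|^2 + P^2)\<close> lies in the quadratic module. This gives the values of the relaxations by weak
  duality. It also shows that minimizers of the moment relaxations of high order annihilate bounded-degree
  multiples of the \<open>m_i\<close>, hence of all products \<open>\<Prod>u. (x_i - u_i)\<close> over the minimizers \<open>u\<close>, and the resulting
  recurrences for the moments make the ranks of the moment matrices stationary.

  For the Positivstellensatz, \<open>1 + x_i\<close> and \<open>1 - x_i\<close> are sums of squares modulo the sphere ideal, so
  nonnegative combinations of Bernstein polynomials on the cube are available.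
\<close>

text \<open>Certificates for polynomials that are strictly positive on K~ do not apply to
  \<open>P\<close>, which has zeros there. Strictness is regained for the matrix in H = m^T A m,
  since independent differentials of \<open>m\<close> make the Hessian of H determine
  \<open>A\<close> at the zeros; but the optimality conditions control \<open>A\<close> only there.
  The correction with factor N compensates for this elsewhere, at the price of the unwanted term N
  P^2. That term can be removed because (1 - P/B)^(2n) equals 1 where P = 0: P minus (1 - P/B)^(2n)
  (P + N P^2) is P^2 times a polynomial that is strictly positive on K~ for large n. Membership of
  \<open>P\<close> alone would settle the values; the margin e is kept because pairing it with a
  minimizing sequence forces the squares in it to have moment zero. All certificates have a fixed
  degree, whence the thresholds for k. The interior hypothesis (SCC if d = 0) keeps the zeros of
  \<open>P\<close> away from x_0 = 0, so that the point mass at one of them, divided by x_0^d, is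
  feasible for the moment relaxation with value fmin.\<close>

section \<open>Evaluation as a ring homomorphism\<close>

lemma Const_0 [simp]: "Const 0 = 0"
  by (simp add: Const_def)

lemma Const_1 [simp]: "Const 1 = 1"
  by (simp add: Const_def)

lemma Const_add: "Const (a + b) = Const a + Const b"
  by (simp add: Const_def single_add)

lemma Const_mult: "Const (a * b) = Const a * Const b"
  by (simp add: Const_def mult_single)

lemma Const_uminus: "Const (- a) = - Const a"
  by (simp add: Const_def single_uminus)

lemma Const_diff: "Const (a - b) = Const a - Const b"
  using Const_add[of a "- b"] by (simp add: Const_uminus)

lemma Const_power: "Const (a ^ n) = Const a ^ n"
  by (induction n) (simp_all add: Const_mult)

lemma Const_sum: "Const (sum f A) = (\<Sum>a\<in>A. Const (f a))"
  by (induction A rule: infinite_finite_induct) (simp_all add: Const_add)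

lemma of_nat_Const: "of_nat n = Const (real n)"
  by (induction n) (simp_all add: Const_add add.commute)

lemma Const_mult_inverse: "a \<noteq> 0 \<Longrightarrow> Const a * (Const (inverse a) * p) = p"
  by (simp add: Const_mult[symmetric] mult.assoc[symmetric])

lemma eval_0 [simp]: "eval 0 x = 0"
  by (simp add: eval_def)

lemma eval_Const [simp]: "eval (Const a) x = a"
  by (simp add: Const_def eval_single)

lemma eval_1 [simp]: "eval 1 x = 1"
  using eval_Const[of 1 x] by simp

lemma eval_uminus [simp]: "eval (- p) x = - eval p x"
  using eval_add[of p "- p" x] by simp

lemma eval_diff [simp]: "eval (p - q) x = eval p x - eval q x"
  using eval_add[of p "- q" x] by simp

lemma monomial_add: "monomial (\<alpha> + \<beta>) = monomial \<alpha> * monomial \<beta>"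
  by (simp add: monomial_def mult_single)

lemma monomial_0 [simp]: "monomial 0 = 1"
  by (simp add: monomial_def)

lemma eval_monomial: "eval (monomial \<alpha>) x = (\<Prod>i\<in>UNIV. (x $ i) ^ Poly_Mapping.lookup \<alpha> i)"
  by (simp add: monomial_def eval_single)

lemma lookup_Const_mult: "Poly_Mapping.lookup (Const a * p) \<alpha> = a * Poly_Mapping.lookup p \<alpha>"
  by (simp add: Const_def mult_map_scale_conv_mult[symmetric] Poly_Mapping.map.rep_eq when_def)

lemma eval_Const_mult: "eval (Const a * p) x = a * eval p x"
proof -
  have "Poly_Mapping.keys (Const a * p) \<subseteq> Poly_Mapping.keys p"
    by (auto simp: in_keys_iff lookup_Const_mult)
  then show ?thesis
    by (subst eval_alt[of "Poly_Mapping.keys p"])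
      (auto simp: lookup_Const_mult eval_def sum_distrib_left mult.assoc)
qed

lemma mpoly_as_sum:
  "p = (\<Sum>\<alpha>\<in>Poly_Mapping.keys p. Const (Poly_Mapping.lookup p \<alpha>) * monomial \<alpha>)"
  by (rule mpoly_expand) auto

lemma eval_mult [simp]: "eval (p * q) x = eval p x * eval q x"
proof -
  have "p * q = (\<Sum>\<alpha>\<in>Poly_Mapping.keys p. \<Sum>\<beta>\<in>Poly_Mapping.keys q.
      Const (Poly_Mapping.lookup p \<alpha> * Poly_Mapping.lookup q \<beta>) * monomial (\<alpha> + \<beta>))"
    using arg_cong2[OF mpoly_as_sum[of p] mpoly_as_sum[of q], of "(*)"]
    by (simp add: sum_product Const_mult monomial_add mult_ac)
  then have "eval (p * q) x = (\<Sum>\<alpha>\<in>Poly_Mapping.keys p. \<Sum>\<beta>\<in>Poly_Mapping.keys q.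
      Poly_Mapping.lookup p \<alpha> * Poly_Mapping.lookup q \<beta> * eval (monomial (\<alpha> + \<beta>)) x)"
    by (simp only: eval_sum eval_Const_mult)
  then show ?thesis
    by (simp add: eval_monomial lookup_add power_add prod.distrib eval_def[of p] eval_def[of q]
        sum_product mult_ac)
qed

lemmas eval_simps [simp] = eval_add eval_sum

lemma eval_power [simp]: "eval (p ^ n) x = eval p x ^ n"
  by (induction n) simp_all

lemma eval_prod [simp]: "eval (prod f A) x = (\<Prod>a\<in>A. eval (f a) x)"
  by (induction A rule: infinite_finite_induct) simp_all

lemma eval_Var [simp]: "eval (Var i) x = x $ i"
proof -
  have "(\<Prod>j\<in>UNIV. (x $ j) ^ Poly_Mapping.lookup (Poly_Mapping.single i 1) j)
      = (\<Prod>j\<in>UNIV. if j = i then x $ i else 1)"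
    by (intro prod.cong) (auto simp: lookup_single when_def)
  then show ?thesis
    by (simp add: Var_def eval_monomial)
qed

lemma eval_norm_sq_poly [simp]: "eval norm_sq_poly x = (norm x)\<^sup>2"
  by (simp add: norm_sq_poly_def norm_vec_def L2_set_def sum_nonneg)

lemma monomial_eq_prod_Var:
  fixes \<alpha> :: "'v::finite exponent"
  shows "monomial \<alpha> = (\<Prod>i\<in>UNIV. Var i ^ Poly_Mapping.lookup \<alpha> i)"
proof -
  have 1: "Var i ^ n = monomial (Poly_Mapping.single i n)" for i :: 'v and n
    by (induction n) (simp_all add: Var_def monomial_add[symmetric] single_add[symmetric])
  have 2: "(\<Prod>i\<in>A. monomial (h i)) = monomial (\<Sum>i\<in>A. h i)" for h :: "'v \<Rightarrow> 'v exponent" and A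
    by (induction A rule: infinite_finite_induct) (simp_all add: monomial_add)
  have "(\<Sum>i\<in>UNIV. Poly_Mapping.single i (Poly_Mapping.lookup \<alpha> i)) = \<alpha>"
    by (rule poly_mapping_eqI) (simp add: lookup_sum lookup_single when_def sum.delta)
  then show ?thesis by (simp add: 1 2)
qed

text \<open>Constants and variables generate the algebra. This is the induction behind continuity,
  differentiability, boundedness modulo the sphere ideal and the Lipschitz estimate.\<close>

lemma mpoly_induct [case_names Const Var add mult]:
  fixes p :: "'v::finite mpoly"
  assumes const: "\<And>a. P (Const a)" and var: "\<And>i. P (Var i)"
    and add: "\<And>p q. P p \<Longrightarrow> P q \<Longrightarrow> P (p + q)" and mult: "\<And>p q. P p \<Longrightarrow> P q \<Longrightarrow> P (p * q)"
  shows "P p"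
proof -
  have pow: "P (Var i ^ n)" for i n
    by (induction n) (use const[of 1] in \<open>auto intro: var mult\<close>)
  have prod: "P (\<Prod>i\<in>A. Var i ^ h i)" for A :: "'v set" and h
    by (induction A rule: infinite_finite_induct) (use const[of 1] in \<open>auto intro: pow mult\<close>)
  have sum: "P (\<Sum>a\<in>A. h a)" if "\<And>a. P (h a)" for A :: "'v exponent set" and h
    by (induction A rule: infinite_finite_induct) (use const[of 0] that in \<open>auto intro: add\<close>)
  show ?thesis
    by (subst mpoly_as_sum) (auto intro!: sum mult const simp: monomial_eq_prod_Var prod)
qed

lemma continuous_on_eval [continuous_intros]:
  assumes "continuous_on A h"
  shows "continuous_on A (\<lambda>x. eval p (h x))"
  by (induction p rule: mpoly_induct) (auto intro!: continuous_intros assms)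

lemma eval_bounded_on_compact:
  assumes "compact B" shows "\<exists>b. \<forall>x\<in>B. \<bar>eval p x\<bar> \<le> b"
proof -
  have "compact (eval p ` B)"
    by (rule compact_continuous_image[OF _ assms]) (intro continuous_intros)
  then show ?thesis by (auto dest!: compact_imp_bounded simp: bounded_iff)
qed

lemma isCont_eval [continuous_intros]: "isCont (eval p) x"
  using continuous_on_eval[of UNIV id p] by (simp add: continuous_on_eq_continuous_at id_def)

section \<open>Degrees\<close>

lemma edeg_add: "edeg (\<alpha> + \<beta>) = edeg \<alpha> + edeg \<beta>"
  by (simp add: edeg_def lookup_add sum.distrib)

lemma edeg_0 [simp]: "edeg 0 = 0"
  by (simp add: edeg_def)

lemma edeg_single [simp]: "edeg (Poly_Mapping.single i n) = n"
  by (simp add: edeg_def lookup_single when_def)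

lemma edeg_le_tdeg: "\<alpha> \<in> Poly_Mapping.keys p \<Longrightarrow> edeg \<alpha> \<le> tdeg p"
  by (simp add: tdeg_def)

lemma tdeg_le_iff: "tdeg p \<le> n \<longleftrightarrow> (\<forall>\<alpha>\<in>Poly_Mapping.keys p. edeg \<alpha> \<le> n)"
  by (simp add: tdeg_def)

lemma tdeg_add_le: "tdeg p \<le> n \<Longrightarrow> tdeg q \<le> n \<Longrightarrow> tdeg (p + q) \<le> n"
  using Poly_Mapping.keys_add[of p q] by (auto simp: tdeg_le_iff)

lemma tdeg_Const_mult_le: "tdeg p \<le> n \<Longrightarrow> tdeg (Const a * p) \<le> n"
  by (auto simp: tdeg_le_iff in_keys_iff lookup_Const_mult)

lemma tdeg_monomial [simp]: "tdeg (monomial \<alpha>) = edeg \<alpha>"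
  by (simp add: tdeg_def monomial_def)

section \<open>Restriction to lines\<close>

text \<open>The polynomial in t obtained from p(u + t v). Taking its coefficients as directional
  derivatives reduces the product rules to \<open>coeff_mult\<close>, without any limits.\<close>

definition line :: "'v::finite mpoly \<Rightarrow> real ^ 'v \<Rightarrow> real ^ 'v \<Rightarrow> real poly" where
  "line p u v = (\<Sum>\<alpha>\<in>Poly_Mapping.keys p. smult (Poly_Mapping.lookup p \<alpha>)
     (\<Prod>i\<in>UNIV. [:u $ i, v $ i:] ^ Poly_Mapping.lookup \<alpha> i))"

lemma poly_line: "poly (line p u v) t = eval p (u + t *\<^sub>R v)"
  by (simp add: line_def eval_def poly_sum poly_prod)

lemma line_eqI: "(\<And>t. eval p (u + t *\<^sub>R v) = poly r t) \<Longrightarrow> line p u v = r"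
  by (metis poly_line poly_eq_poly_eq_iff ext)

definition jet1 where "jet1 p u v = coeff (line p u v) 1"
text \<open>A Taylor coefficient, that is, half of the second directional derivative; hence the
  factor 2 in \<open>jet2_hessian\<close>.\<close>

definition jet2 where "jet2 p u v = coeff (line p u v) 2"

lemma line_add: "line (p + q) u v = line p u v + line q u v"
  by (rule line_eqI) (simp add: poly_line)
lemma line_diff: "line (p - q) u v = line p u v - line q u v"
  by (rule line_eqI) (simp add: poly_line)
lemma line_mult: "line (p * q) u v = line p u v * line q u v"
  by (rule line_eqI) (simp add: poly_line)
lemma line_Const: "line (Const a) u v = [:a:]"
  by (rule line_eqI) simp
lemma line_Var: "line (Var i) u v = [:u $ i, v $ i:]"
  by (rule line_eqI) simp

lemma coeff_0_line: "coeff (line p u v) 0 = eval p u"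
  using poly_line[of p u v 0] by (simp add: poly_0_coeff_0)

lemma jet_Const [simp]: "jet1 (Const a) u v = 0" "jet2 (Const a) u v = 0"
  by (simp_all add: jet1_def jet2_def line_Const numeral_2_eq_2)

lemma jet_0 [simp]: "jet1 0 u v = 0" "jet2 0 u v = 0"
  using jet_Const[of 0 u v] by simp_all

lemma jet_1 [simp]: "jet1 1 u v = 0" "jet2 1 u v = 0"
  using jet_Const[of 1 u v] by simp_all

lemma jet_Var [simp]: "jet1 (Var i) u v = v $ i" "jet2 (Var i) u v = 0"
  by (simp_all add: jet1_def jet2_def line_Var numeral_2_eq_2)

lemma jet_add [simp]:
  "jet1 (p + q) u v = jet1 p u v + jet1 q u v" "jet2 (p + q) u v = jet2 p u v + jet2 q u v"
  by (simp_all add: jet1_def jet2_def line_add)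

lemma jet_diff [simp]:
  "jet1 (p - q) u v = jet1 p u v - jet1 q u v" "jet2 (p - q) u v = jet2 p u v - jet2 q u v"
  by (simp_all add: jet1_def jet2_def line_diff)

lemma jet_mult [simp]:
  "jet1 (p * q) u v = eval p u * jet1 q u v + jet1 p u v * eval q u"
  "jet2 (p * q) u v = eval p u * jet2 q u v + jet1 p u v * jet1 q u v + jet2 p u v * eval q u"
  unfolding jet1_def jet2_def coeff_0_line[of _ u v, symmetric]
  by (simp_all add: line_mult coeff_mult numeral_2_eq_2)

lemma jet_sum [simp]:
  "jet1 (sum f A) u v = (\<Sum>a\<in>A. jet1 (f a) u v)"
  "jet2 (sum f A) u v = (\<Sum>a\<in>A. jet2 (f a) u v)"
  by (induction A rule: infinite_finite_induct) simp_all

section \<open>Sums of squares and quadratic modules\<close>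

lemma SOS_0 [simp]: "0 \<in> SOS"
  unfolding SOS_def by (rule CollectI, rule exI[of _ 0]) simp

lemma SOS_add_square:
  assumes "p \<in> SOS" shows "p + r ^ 2 \<in> SOS"
proof -
  obtain m :: nat and q where "p = (\<Sum>i<m. q i ^ 2)"
    using assms by (auto simp: SOS_def)
  then have "p + r ^ 2 = (\<Sum>i<Suc m. (q(m := r)) i ^ 2)" by simp
  then show ?thesis unfolding SOS_def by blast
qed

lemma SOS_square [simp]: "r ^ 2 \<in> SOS"
  using SOS_add_square[OF SOS_0] by simp

lemma SOS_add: 
  assumes "p \<in> SOS" "r \<in> SOS" shows "p + r \<in> SOS"
proof -
  obtain m :: nat and q where "r = (\<Sum>i<m. q i ^ 2)"
    using assms by (auto simp: SOS_def)
  moreover have "p + (\<Sum>i<m. q i ^ 2) \<in> SOS"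
    by (induction m) (simp_all add: assms SOS_add_square add.assoc[symmetric])
  ultimately show ?thesis by simp
qed

lemma SOS_sum: "(\<And>a. a \<in> A \<Longrightarrow> f a \<in> SOS) \<Longrightarrow> sum f A \<in> SOS"
  by (induction A rule: infinite_finite_induct) (auto simp: SOS_add)

lemma SOS_mult:
  assumes "p \<in> SOS" "r \<in> SOS" shows "p * r \<in> SOS"
proof -
  obtain m :: nat and q where p: "p = (\<Sum>i<m. q i ^ 2)"
    using assms by (auto simp: SOS_def)
  obtain n :: nat and q' where r: "r = (\<Sum>i<n. q' i ^ 2)"
    using assms by (auto simp: SOS_def)
  have "p * r = (\<Sum>i<m. \<Sum>j<n. (q i * q' j) ^ 2)"
    unfolding p r by (simp add: sum_product power_mult_distrib)
  then show ?thesis by (simp add: SOS_sum)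
qed

lemma SOS_Const: "0 \<le> a \<Longrightarrow> Const a \<in> SOS"
  using SOS_square[of "Const (sqrt a)"] by (simp add: Const_power[symmetric])

lemma SOS_1 [simp]: "1 \<in> SOS"
  using SOS_square[of 1] by simp

lemma SOS_nonneg: "p \<in> SOS \<Longrightarrow> 0 \<le> eval p x"
  by (auto simp: SOS_def intro!: sum_nonneg)

text \<open>Ideal plus quadratic module without degree bounds, so that it is a convex cone that can
  be handled algebraically. Degrees are recovered only at the end, by
  \<open>qmod_truncation\<close>.\<close>

definition qmod :: "('k \<Rightarrow> 'v::finite mpoly) \<Rightarrow> 'k set \<Rightarrow> 'k set \<Rightarrow> 'v mpoly set" where
  "qmod q J L = {(\<Sum>j\<in>J. q j * p j) + (s\<^sub>0 + (\<Sum>j\<in>L. q j * s j)) | p s\<^sub>0 s.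
     s\<^sub>0 \<in> SOS \<and> (\<forall>j\<in>L. s j \<in> SOS)}"

lemma qmodI:
  "s\<^sub>0 \<in> SOS \<Longrightarrow> (\<And>j. j \<in> L \<Longrightarrow> s j \<in> SOS) \<Longrightarrow>
    m = (\<Sum>j\<in>J. q j * p j) + (s\<^sub>0 + (\<Sum>j\<in>L. q j * s j)) \<Longrightarrow> m \<in> qmod q J L"
  unfolding qmod_def by blast

lemma qmodE:
  assumes "m \<in> qmod q J L"
  obtains p s\<^sub>0 s where "s\<^sub>0 \<in> SOS" "\<And>j. j \<in> L \<Longrightarrow> s j \<in> SOS"
    "m = (\<Sum>j\<in>J. q j * p j) + (s\<^sub>0 + (\<Sum>j\<in>L. q j * s j))"
  using assms unfolding qmod_def by blast

lemma qmod_SOS: "s \<in> SOS \<Longrightarrow> s \<in> qmod q J L"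
  by (rule qmodI[where s\<^sub>0 = s and s = "\<lambda>_. 0" and p = "\<lambda>_. 0"]) auto

lemma qmod_add:
  assumes "a \<in> qmod q J L" "b \<in> qmod q J L" shows "a + b \<in> qmod q J L"
proof -
  obtain p s0 s where a: "s0 \<in> SOS" "\<And>j. j \<in> L \<Longrightarrow> s j \<in> SOS"
    "a = (\<Sum>j\<in>J. q j * p j) + (s0 + (\<Sum>j\<in>L. q j * s j))" using assms(1) by (rule qmodE) blast
  obtain p' s0' s' where b: "s0' \<in> SOS" "\<And>j. j \<in> L \<Longrightarrow> s' j \<in> SOS"
    "b = (\<Sum>j\<in>J. q j * p' j) + (s0' + (\<Sum>j\<in>L. q j * s' j))" using assms(2) by (rule qmodE) blast
  show ?thesis
    by (rule qmodI[where s\<^sub>0 = "s0 + s0'" and s = "\<lambda>j. s j + s' j" and p = "\<lambda>j. p j + p' j"])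
      (auto simp: a b SOS_add distrib_left sum.distrib algebra_simps)
qed

lemma qmod_0 [simp]: "0 \<in> qmod q J L"
  by (simp add: qmod_SOS)

lemma qmod_sum: "(\<And>a. a \<in> A \<Longrightarrow> f a \<in> qmod q J L) \<Longrightarrow> sum f A \<in> qmod q J L"
  by (induction A rule: infinite_finite_induct) (auto simp: qmod_add)

text \<open>A quadratic module need not be closed under products. The left factor is a sum of
  squares modulo the ideal, so no product of two inequality constraints arises.\<close>

lemma qmod_mult:
  assumes "t \<in> qmod q J {}" "b \<in> qmod q J L" shows "t * b \<in> qmod q J L"
proof -
  obtain p s0 s where a: "s0 \<in> SOS"
    "t = (\<Sum>j\<in>J. q j * p j) + (s0 + (\<Sum>j\<in>{}. q j * s j))" using assms(1) by (rule qmodE) blast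
  obtain p' s0' s' where b: "s0' \<in> SOS" "\<And>j. j \<in> L \<Longrightarrow> s' j \<in> SOS"
    "b = (\<Sum>j\<in>J. q j * p' j) + (s0' + (\<Sum>j\<in>L. q j * s' j))" using assms(2) by (rule qmodE) blast
  show ?thesis
  proof (rule qmodI[where s\<^sub>0 = "s0 * s0'" and s = "\<lambda>j. s0 * s' j" and p = "\<lambda>j. p j * b + s0 * p' j"])
    have "t * b = (\<Sum>j\<in>J. q j * p j) * b + s0 * b" by (simp add: a distrib_right)
    also have "s0 * b = (\<Sum>j\<in>J. q j * (s0 * p' j)) + (s0 * s0' + (\<Sum>j\<in>L. q j * (s0 * s' j)))"
      unfolding b by (simp add: distrib_left sum_distrib_left mult_ac)
    finally show "t * b = (\<Sum>j\<in>J. q j * (p j * b + s0 * p' j))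
        + (s0 * s0' + (\<Sum>j\<in>L. q j * (s0 * s' j)))"
      by (simp add: sum_distrib_left sum_distrib_right distrib_left sum.distrib mult_ac add_ac)
  qed (auto simp: a b SOS_mult)
qed

lemma qmod_ideal: 
  assumes "finite J" "j \<in> J" shows "q j * p \<in> qmod q J L"
  using assms by (intro qmodI[where s\<^sub>0 = 0 and s = "\<lambda>_. 0" and p = "\<lambda>i. if i = j then p else 0"])
    (auto simp: if_distrib[of "\<lambda>r. _ * r"] sum.delta cong: if_cong)

lemma qmod_ineq:
  assumes "finite L" "j \<in> L" "s \<in> SOS" shows "q j * s \<in> qmod q J L"
  using assms by (intro qmodI[where s\<^sub>0 = 0 and p = "\<lambda>_. 0" and s = "\<lambda>i. if i = j then s else 0"])
    (auto simp: if_distrib[of "\<lambda>r. _ * r"] sum.delta cong: if_cong)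

lemma qmod_subset: "t \<in> qmod q J {} \<Longrightarrow> t \<in> qmod q J L"
  using qmod_mult[of t q J 1 L] by (simp add: qmod_SOS)

lemma Const_2 [simp]: "Const 2 = 2"
  using Const_add[of 1 1] by simp

section \<open>Boundedness and Lipschitz estimates modulo the sphere ideal\<close>

definition dist_sq :: "real ^ 'v::finite \<Rightarrow> 'v mpoly" where
  "dist_sq a = (\<Sum>i\<in>UNIV. (Var i - Const (a $ i)) ^ 2)"

text \<open>\<open>T\<close> consists of the sums of squares modulo the equality ideal and is closed
  under products; \<open>M\<close> adds the inequality constraints. The sphere equation
  \<open>z\<close> provides the Archimedean property.\<close>

locale spherical_system =
  fixes q :: "'k \<Rightarrow> 'v::finite mpoly" and EQ IN :: "'k set" and z :: 'k
  assumes finite_EQ [simp]: "finite EQ" and finite_IN [simp]: "finite IN"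
    and z: "z \<in> EQ" "q z = norm_sq_poly - 1"
begin

abbreviation "T \<equiv> qmod q EQ {}"
abbreviation "M \<equiv> qmod q EQ IN"
abbreviation "S \<equiv> feasible_set (\<lambda>j. eval (q j)) EQ IN"

lemma T_mult: "a \<in> T \<Longrightarrow> b \<in> T \<Longrightarrow> a * b \<in> T"
  by (rule qmod_mult)

lemma T_power: "a \<in> T \<Longrightarrow> a ^ n \<in> T"
  by (induction n) (auto simp: T_mult qmod_SOS)

lemma T_prod: "(\<And>i. i \<in> A \<Longrightarrow> f i \<in> T) \<Longrightarrow> prod f A \<in> T"
  by (induction A rule: infinite_finite_induct) (auto simp: T_mult qmod_SOS)

lemma T_of_nat: "of_nat n \<in> T"
  by (induction n) (auto simp: qmod_add qmod_SOS)

lemma T_Const: "0 \<le> a \<Longrightarrow> Const a \<in> T"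
  by (simp add: qmod_SOS SOS_Const)

lemma T_Const_mult: "0 \<le> a \<Longrightarrow> b \<in> T \<Longrightarrow> Const a * b \<in> T"
  by (simp add: T_Const T_mult)

lemma T_square: "a ^ 2 \<in> T"
  by (simp add: qmod_SOS)

lemma T_Var_sq: "1 - Var i ^ 2 \<in> T"
proof -
  have "1 - Var i ^ 2 = (\<Sum>j\<in>UNIV - {i}. Var j ^ 2) + q z * (- 1)"
    unfolding z norm_sq_poly_def by (subst sum.remove[of UNIV i]) auto
  then show ?thesis
    using qmod_ideal[OF finite_EQ z(1), of q "- 1"]
    by (auto intro!: qmod_add qmod_sum T_square simp del: mult_minus_right mult_minus1_right mult_1_right)
qed

text \<open>From 2 (1 + x) = (1 + x)^2 + (1 - x^2) and its mirror image. The factor 1/2 makes the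
  two elements sum to one, as required of Bernstein variables.\<close>

lemma T_Var: "Const (1 / 2) * (1 + Var i) \<in> T" "Const (1 / 2) * (1 - Var i) \<in> T"
proof -
  have h: "Const (1 / 2) * p = Const (1 / 4) * (p + p)" for p :: "'v mpoly"
    
  proof -
    have "Const (1 / 2) = Const (1 / 4) + (Const (1 / 4) :: 'v mpoly)"
      by (simp add: Const_add[symmetric] del: mult_2)
    then show ?thesis by (simp only: distrib_left distrib_right)
  qed
  have "Const (1 / 2) * (1 + Var i) = Const (1 / 4) * ((1 + Var i) ^ 2 + (1 - Var i ^ 2))"
    unfolding h by (simp add: power2_eq_square algebra_simps)
  moreover have "Const (1 / 2) * (1 - Var i) = Const (1 / 4) * ((1 - Var i) ^ 2 + (1 - Var i ^ 2))"
    unfolding h by (simp add: power2_eq_square algebra_simps)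
  ultimately show "Const (1 / 2) * (1 + Var i) \<in> T" "Const (1 / 2) * (1 - Var i) \<in> T"
    by (auto intro!: T_Const_mult qmod_add T_square T_Var_sq)
qed

text \<open>The Archimedean property of \<open>T\<close>. Bounds on squares pass to sums by the
  parallelogram identity and to products by bounding one factor at a time.\<close>

lemma T_bounded: "\<exists>C\<ge>0. Const C - p ^ 2 \<in> T"
proof (induction p rule: mpoly_induct)
  case (Const a)
  then show ?case by (intro exI[of _ "a ^ 2"]) (simp add: Const_power)
next
  case (Var i)
  then show ?case using T_Var_sq by (intro exI[of _ 1]) auto
next
  case (add p r)
  then obtain C D where *: "0 \<le> C" "Const C - p ^ 2 \<in> T" "0 \<le> D" "Const D - r ^ 2 \<in> T" by blast
  have "Const (2 * C + 2 * D) - (p + r) ^ 2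
      = Const 2 * (Const C - p ^ 2) + Const 2 * (Const D - r ^ 2) + (p - r) ^ 2"
    unfolding Const_add Const_mult Const_2
      by (simp add: power2_eq_square algebra_simps)
  moreover have "\<dots> \<in> T"
    by (intro qmod_add T_Const_mult T_square *) auto
  ultimately show ?case using * by (intro exI[of _ "2 * C + 2 * D"]) simp
next
  case (mult p r)
  then obtain C D where *: "0 \<le> C" "Const C - p ^ 2 \<in> T" "0 \<le> D" "Const D - r ^ 2 \<in> T" by blast
  have "Const (C * D) - (p * r) ^ 2 = Const C * (Const D - r ^ 2) + r ^ 2 * (Const C - p ^ 2)"
    unfolding Const_mult
      by (simp add: power2_eq_square algebra_simps)
  moreover have "\<dots> \<in> T"
    by (intro qmod_add T_Const_mult T_mult T_square *)
  ultimately show ?case using * by (intro exI[of _ "C * D"]) simp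
qed

lemma T_dist_sq: "dist_sq a \<in> T"
  unfolding dist_sq_def by (intro qmod_sum T_square)

text \<open>The estimate (p(x) - p(a))^2 \<le> C |x - a|^2 in the order given by \<open>T\<close>.
  That \<open>C\<close> is uniform in \<open>a\<close> allows summation over arbitrarily fine
  grids.\<close>

lemma T_Lipschitz:
  fixes B :: "(real ^ 'v) set"
  assumes B: "compact B"
  shows "\<exists>C\<ge>0. \<forall>a\<in>B. Const C * dist_sq a - (p - Const (eval p a)) ^ 2 \<in> T"
proof (induction p rule: mpoly_induct)
  case (Const a)
  then show ?case by (intro exI[of _ 0]) simp
next
  case (Var i)
  have "Const 1 * dist_sq a - (Var i - Const (a $ i)) ^ 2
      = (\<Sum>j\<in>UNIV - {i}. (Var j - Const (a $ j)) ^ 2)" for a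
    unfolding dist_sq_def by (subst sum.remove[of UNIV i]) auto
  moreover have "\<dots> a \<in> T" for a by (intro qmod_sum T_square)
  ultimately show ?case by (intro exI[of _ 1]) auto
next
  case (add p r)
  then obtain C D where *: "0 \<le> C" "0 \<le> D"
    "\<And>a. a \<in> B \<Longrightarrow> Const C * dist_sq a - (p - Const (eval p a)) ^ 2 \<in> T"
    "\<And>a. a \<in> B \<Longrightarrow> Const D * dist_sq a - (r - Const (eval r a)) ^ 2 \<in> T" by blast
  have "Const (2 * C + 2 * D) * dist_sq a - (p + r - Const (eval (p + r) a)) ^ 2 \<in> T"
    if a: "a \<in> B" for a
  proof -
    define p' r' where "p' = p - Const (eval p a)" and "r' = r - Const (eval r a)"
    have e: "p + r - Const (eval (p + r) a) = p' + r'"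
      by (simp add: p'_def r'_def Const_add)
    have "Const (2 * C + 2 * D) * dist_sq a - (p' + r') ^ 2
      = Const 2 * (Const C * dist_sq a - p' ^ 2) + Const 2 * (Const D * dist_sq a - r' ^ 2)
        + (p' - r') ^ 2"
      unfolding Const_add Const_mult Const_2
      by (simp add: power2_eq_square algebra_simps)
    moreover have "\<dots> \<in> T"
      using *(3,4)[OF a] unfolding p'_def[symmetric] r'_def[symmetric]
      by (intro qmod_add T_Const_mult T_square) auto
    ultimately show ?thesis unfolding e by simp
  qed
  then show ?case using * by (intro exI[of _ "2 * C + 2 * D"]) auto
next
  case (mult p r)
  then obtain C D where *: "0 \<le> C" "0 \<le> D"
    "\<And>a. a \<in> B \<Longrightarrow> Const C * dist_sq a - (p - Const (eval p a)) ^ 2 \<in> T"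
    "\<And>a. a \<in> B \<Longrightarrow> Const D * dist_sq a - (r - Const (eval r a)) ^ 2 \<in> T" by blast
  obtain b where b: "0 \<le> b" "Const b - p ^ 2 \<in> T" using T_bounded by blast
  obtain e where e: "\<And>a. a \<in> B \<Longrightarrow> \<bar>eval r a\<bar> \<le> e" using eval_bounded_on_compact[OF B] by blast
  have e2: "(eval r a) ^ 2 \<le> e ^ 2" if "a \<in> B" for a
    using power_mono[OF e[OF that], of 2] by simp
  \<comment> \<open>The difference of products splits as p (r - r(a)) + r(a) (p - p(a));
    \<open>b\<close> bounds p^2 in \<open>T\<close>, and \<open>e\<close> bounds the number r(a) on
    \<open>B\<close>.\<close>
  let ?E = "2 * (b * D) + 2 * (e ^ 2 * C)"
  have "Const ?E * dist_sq a - (p * r - Const (eval (p * r) a)) ^ 2 \<in> T"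
    if a: "a \<in> B" for a
  proof -
    define p' r' where "p' = p - Const (eval p a)" and "r' = r - Const (eval r a)"
    let ?\<rho> = "eval r a"
    have eq: "p * r - Const (eval (p * r) a) = p * r' + Const ?\<rho> * p'"
      by (simp add: p'_def r'_def Const_mult algebra_simps)
    have "Const ?E * dist_sq a - (p * r' + Const ?\<rho> * p') ^ 2
      = Const 2 * (Const b * (Const D * dist_sq a - r' ^ 2) + r' ^ 2 * (Const b - p ^ 2))
        + Const 2 * (Const (?\<rho> ^ 2) * (Const C * dist_sq a - p' ^ 2)
            + Const (e ^ 2 - ?\<rho> ^ 2) * (Const C * dist_sq a))
        + (p * r' - Const ?\<rho> * p') ^ 2"
      unfolding Const_add Const_diff Const_mult Const_2 Const_power
      by (simp add: power2_eq_square algebra_simps)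
    moreover have "\<dots> \<in> T"
      using *(3,4)[OF a] unfolding p'_def[symmetric] r'_def[symmetric]
      by (intro qmod_add T_Const_mult T_mult T_square b T_dist_sq) (use e2[OF a] * in auto)
    ultimately show ?thesis unfolding eq by simp
  qed
  then show ?case using * b by (intro exI[of _ ?E]) auto
qed

end

section \<open>Positive definite quadratic forms\<close>

abbreviation qform :: "('i::finite \<Rightarrow> 'i \<Rightarrow> 'a::comm_ring_1) \<Rightarrow> ('i \<Rightarrow> 'a) \<Rightarrow> 'a" where
  "qform a v \<equiv> (\<Sum>i\<in>UNIV. \<Sum>j\<in>UNIV. a i j * v i * v j)"

text \<open>Lagrange's reduction by one variable. Over a ring, \<open>r\<close> replaces the
  quotients c a j / c a a, so that the identity serves for real numbers and for constant polynomials
  alike.\<close>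

lemma complete_square:
  fixes c :: "'i \<Rightarrow> 'i \<Rightarrow> 'a::comm_ring_1"
  assumes B: "finite B" "a \<notin> B"
    and sym: "\<And>i j. c i j = c j i" and r: "\<And>j. c a j = c a a * r j"
  shows "(\<Sum>i\<in>insert a B. \<Sum>j\<in>insert a B. c i j * m i * m j)
    = c a a * (m a + (\<Sum>j\<in>B. r j * m j)) ^ 2
      + (\<Sum>i\<in>B. \<Sum>j\<in>B. (c i j - c a a * r i * r j) * m i * m j)"
proof -
  let ?R = "\<Sum>j\<in>B. r j * m j"
  have 1: "(\<Sum>j\<in>B. c a j * m a * m j) = c a a * m a * ?R"
    by (simp add: sum_distrib_left mult_ac) (intro sum.cong refl, subst r, simp add: mult_ac)
  have 2: "(\<Sum>i\<in>B. c i a * m i * m a) = c a a * m a * ?R"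
    by (simp add: sum_distrib_left mult_ac) (intro sum.cong refl, subst sym, subst r, simp add: mult_ac)
  have 3: "(\<Sum>i\<in>B. \<Sum>j\<in>B. c a a * r i * r j * m i * m j) = c a a * (?R * ?R)"
    unfolding sum_product unfolding sum_distrib_left by (intro sum.cong refl) (simp add: mult_ac)
  have "(\<Sum>i\<in>insert a B. \<Sum>j\<in>insert a B. c i j * m i * m j)
    = c a a * m a * m a + (\<Sum>j\<in>B. c a j * m a * m j) + (\<Sum>i\<in>B. c i a * m i * m a)
      + (\<Sum>i\<in>B. \<Sum>j\<in>B. c i j * m i * m j)"
    using B by (simp add: sum.distrib)
  moreover have "(\<Sum>i\<in>B. \<Sum>j\<in>B. (c i j - c a a * r i * r j) * m i * m j)
      = (\<Sum>i\<in>B. \<Sum>j\<in>B. c i j * m i * m j) - c a a * (?R * ?R)"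
    unfolding 3[symmetric] by (simp add: left_diff_distrib sum_subtractf)
  ultimately show ?thesis
    unfolding 1 2 by (simp add: power2_eq_square algebra_simps)
qed

text \<open>Elimination of variables: the Schur complement of a positive pivot is again positive
  definite, so the form is a positive combination of squares of linear forms, into which polynomials
  can be substituted.\<close>

lemma pos_def_imp_SOS:
  fixes c :: "'i \<Rightarrow> 'i \<Rightarrow> real" and m :: "'i \<Rightarrow> 'v::finite mpoly"
  assumes "finite B" and "\<And>i j. c i j = c j i"
    and "\<And>v. \<exists>i\<in>B. v i \<noteq> 0 \<Longrightarrow> 0 < (\<Sum>i\<in>B. \<Sum>j\<in>B. c i j * v i * v j)"
  shows "(\<Sum>i\<in>B. \<Sum>j\<in>B. Const (c i j) * m i * m j) \<in> SOS"
  using assms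
proof (induction B arbitrary: c rule: finite_induct)
  case empty
  then show ?case by simp
next
  case (insert a B)
  note sym = insert.prems(1)
  have "0 < (\<Sum>i\<in>insert a B. \<Sum>j\<in>insert a B. c i j * of_bool (i = a) * of_bool (j = a))"
    by (rule insert.prems(2)) auto
  also have "\<dots> = c a a"
    using insert.hyps by (simp add: sum.delta of_bool_def if_distrib[of "\<lambda>x. _ * x"] cong: if_cong)
  finally have pos: "0 < c a a" .
  define r where "r j = c a j / c a a" for j
  have r: "c a j = c a a * r j" for j using pos by (simp add: r_def)
  define c' where "c' i j = c i j - c a a * r i * r j" for i j
  have IH: "(\<Sum>i\<in>B. \<Sum>j\<in>B. Const (c' i j) * m i * m j) \<in> SOS"
  proof (rule insert.IH)
    show "c' i j = c' j i" for i j
      using sym[of i j] by (simp add: c'_def mult_ac)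
    fix v :: "'i \<Rightarrow> real" assume v: "\<exists>i\<in>B. v i \<noteq> 0"
    \<comment> \<open>This value at \<open>a\<close> makes the completed square vanish and leaves
      the Schur complement at \<open>v\<close>.\<close>
    define v' where "v' = v(a := - (\<Sum>j\<in>B. r j * v j))"
    have eqv: "v' i = v i" if "i \<in> B" for i
      using that insert.hyps by (auto simp: v'_def)
    have "0 < (\<Sum>i\<in>insert a B. \<Sum>j\<in>insert a B. c i j * v' i * v' j)"
      using v eqv by (intro insert.prems(2)) auto
    also have "\<dots> = c a a * (v' a + (\<Sum>j\<in>B. r j * v' j)) ^ 2
      + (\<Sum>i\<in>B. \<Sum>j\<in>B. c' i j * v' i * v' j)"
      unfolding c'_def
      by (rule complete_square[where c = c and a = a and r = r, OF insert.hyps sym r])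
    also have "(\<Sum>j\<in>B. r j * v' j) = (\<Sum>j\<in>B. r j * v j)"
      using eqv by (intro sum.cong) auto
    also have "(\<Sum>i\<in>B. \<Sum>j\<in>B. c' i j * v' i * v' j) = (\<Sum>i\<in>B. \<Sum>j\<in>B. c' i j * v i * v j)"
      using eqv by (intro sum.cong refl) auto
    finally show "0 < (\<Sum>i\<in>B. \<Sum>j\<in>B. c' i j * v i * v j)"
      by (simp add: v'_def)
  qed
  have "(\<Sum>i\<in>insert a B. \<Sum>j\<in>insert a B. Const (c i j) * m i * m j)
      = Const (c a a) * (m a + (\<Sum>j\<in>B. Const (r j) * m j)) ^ 2
        + (\<Sum>i\<in>B. \<Sum>j\<in>B. Const (c' i j) * m i * m j)"
    unfolding c'_def Const_diff Const_mult
  proof (rule complete_square[where c = "\<lambda>i j. Const (c i j)" and r = "\<lambda>j. Const (r j)",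
        OF insert.hyps])
    show "Const (c i j) = Const (c j i)" for i j by (subst sym) (rule refl)
    show "Const (c a j) = Const (c a a) * Const (r j)" for j by (subst r) (rule Const_mult)
  qed
  then show ?case
    using IH pos by (auto intro!: SOS_add SOS_mult[OF SOS_Const])
qed

lemma qform_add: "qform (\<lambda>i j. a i j + b i j) v = qform a v + qform b v"
  by (simp add: distrib_right sum.distrib)

lemma qform_diag: "qform (\<lambda>i j. if i = j then w else 0) v = w * (\<Sum>i\<in>UNIV. v i ^ 2)"
proof -
  have "(\<Sum>j\<in>UNIV. (if i = j then w else 0) * v i * v j) = w * v i ^ 2" for i
    by (subst sum.remove[of _ i]) (auto simp: power2_eq_square mult.assoc intro!: sum.neutral)
  then show ?thesis by (simp only: sum_distrib_left)
qed

lemma qform_sym: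
  assumes "h + h = 1" shows "qform (\<lambda>i j. h * (a i j + a j i)) v = qform a v"
proof -
  have "qform (\<lambda>i j. h * (a i j + a j i)) v = h * (qform a v + qform (\<lambda>i j. a j i) v)"
    by (simp add: distrib_left distrib_right sum.distrib sum_distrib_left mult.assoc)
  also have "qform (\<lambda>i j. a j i) v = qform a v" by (subst sum.swap) (simp add: mult_ac)
  also have "h * (qform a v + qform a v) = (h + h) * qform a v" by (simp only: distrib_left distrib_right)
  finally show ?thesis by (simp add: assms)
qed

text \<open>Only half of \<eta> is subtracted, so that a strictly positive form remains. It is
  symmetrized first, since the elimination works with symmetric coefficients.\<close>

lemma pos_def_minus_diag_SOS:
  fixes c :: "'i::finite \<Rightarrow> 'i \<Rightarrow> real" and m :: "'i \<Rightarrow> 'v::finite mpoly"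
  assumes "0 < \<eta>" "\<And>v. \<eta> * (\<Sum>i\<in>UNIV. v i ^ 2) \<le> qform c v"
  shows "qform (\<lambda>i j. Const (c i j)) m - Const (\<eta> / 2) * (\<Sum>i\<in>UNIV. m i ^ 2) \<in> SOS"
proof -
  define c' where "c' i j = 1 / 2 * (c i j + c j i) + (if i = j then - (\<eta> / 2) else 0)" for i j
  have c': "qform c' v = qform c v - \<eta> / 2 * (\<Sum>i\<in>UNIV. v i ^ 2)" for v
    unfolding c'_def qform_add qform_diag by (subst qform_sym) simp_all
  have "Const (1 / 2) + Const (1 / 2) = (1 :: 'v mpoly)" unfolding Const_add[symmetric] by simp
  note half = this
  have if_Const: "Const (if i = j then - (\<eta> / 2) else 0) = (if i = j then - Const (\<eta> / 2) else 0)" for i j :: 'i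
    by (simp add: Const_uminus)
  have "qform (\<lambda>i j. Const (c' i j)) m \<in> SOS"
  proof (rule pos_def_imp_SOS)
    fix v :: "'i \<Rightarrow> real" assume "\<exists>i\<in>UNIV. v i \<noteq> 0"
    then have "0 < (\<Sum>i\<in>UNIV. v i ^ 2)" by (auto intro!: sum_pos2)
    then have "\<eta> / 2 * (\<Sum>i\<in>UNIV. v i ^ 2) < \<eta> * (\<Sum>i\<in>UNIV. v i ^ 2)" using assms(1) by simp
    then show "0 < qform c' v" unfolding c' using assms(2)[of v] by linarith
  qed (auto simp: c'_def add.commute)
  also have "qform (\<lambda>i j. Const (c' i j)) m
      = qform (\<lambda>i j. Const (c i j)) m - Const (\<eta> / 2) * (\<Sum>i\<in>UNIV. m i ^ 2)"
    unfolding c'_def Const_add[of "1 / 2 * _"] Const_mult[of "1 / 2"] if_Const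
    unfolding Const_add qform_add qform_diag qform_sym[OF half] by simp
  finally show ?thesis .
qed

section \<open>Bernstein weights\<close>

text \<open>The Bernstein operator with \<open>s\<close> in place of 1 - t, over a ring because
  \<open>t\<close> will be the polynomial (1 + x_i)/2.\<close>

definition bernstein_sum :: "'a::comm_ring_1 \<Rightarrow> 'a \<Rightarrow> nat \<Rightarrow> (nat \<Rightarrow> 'a) \<Rightarrow> 'a" where
  "bernstein_sum t s N \<phi> = (\<Sum>k\<le>N. of_nat (N choose k) * t ^ k * s ^ (N - k) * \<phi> k)"

lemma bernstein_sum_0 [simp]: "bernstein_sum t s 0 \<phi> = \<phi> 0"
  by (simp add: bernstein_sum_def)

lemma bernstein_sum_Suc:
  "bernstein_sum t s (Suc N) \<phi> = s * bernstein_sum t s N \<phi> + t * bernstein_sum t s N (\<lambda>k. \<phi> (Suc k))"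
proof -
  let ?g = "\<lambda>k. of_nat (N choose k) * t ^ k * s ^ (Suc N - k) * \<phi> k"
  have "s * bernstein_sum t s N \<phi> = (\<Sum>k\<le>N. ?g k)"
    unfolding bernstein_sum_def sum_distrib_left
    by (intro sum.cong refl) (simp add: Suc_diff_le mult_ac)
  also have "\<dots> = (\<Sum>k\<le>Suc N. ?g k)"
    by (simp add: binomial_eq_0)
  also have "\<dots> = s ^ Suc N * \<phi> 0
      + (\<Sum>k\<le>N. of_nat (N choose Suc k) * t ^ Suc k * s ^ (N - k) * \<phi> (Suc k))"
    by (subst sum.atMost_Suc_shift) simp
  finally have 1: "s * bernstein_sum t s N \<phi> = \<dots>" .
  have 2: "t * bernstein_sum t s N (\<lambda>k. \<phi> (Suc k))
      = (\<Sum>k\<le>N. of_nat (N choose k) * t ^ Suc k * s ^ (N - k) * \<phi> (Suc k))"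
    unfolding bernstein_sum_def sum_distrib_left by (intro sum.cong refl) (simp add: mult_ac)
  have "bernstein_sum t s (Suc N) \<phi> = s ^ Suc N * \<phi> 0
      + (\<Sum>k\<le>N. of_nat (Suc N choose Suc k) * t ^ Suc k * s ^ (N - k) * \<phi> (Suc k))"
    unfolding bernstein_sum_def by (subst sum.atMost_Suc_shift) simp
  then show ?thesis
    unfolding 1 2 by (simp add: distrib_right sum.distrib add_ac del: power_Suc)
qed

lemma bernstein_sum_1: "t + s = 1 \<Longrightarrow> bernstein_sum t s N (\<lambda>_. 1) = 1"
  by (induction N) (simp_all add: bernstein_sum_Suc add.commute)

text \<open>The variance of the binomial distribution. The shift \<open>c\<close> is what makes the
  induction close: each recursion step moves it by -t or by s.\<close>

lemma bernstein_sum_variance: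
  assumes "t + s = 1"
  shows "bernstein_sum t s N (\<lambda>k. (c + of_nat k - of_nat N * t) ^ 2) = c ^ 2 + of_nat N * t * s"
proof (induction N arbitrary: c)
  case (Suc N)
  have s: "s = 1 - t" using assms by (simp add: algebra_simps)
  have 1: "c + of_nat k - of_nat (Suc N) * t = (c - t) + of_nat k - of_nat N * t" for k
    by (simp add: algebra_simps)
  have 2: "c + of_nat (Suc k) - of_nat (Suc N) * t = (c + s) + of_nat k - of_nat N * t" for k
    by (simp add: algebra_simps s)
  have 3: "bernstein_sum t s N (\<lambda>k. (c + of_nat k - of_nat (Suc N) * t) ^ 2)
      = (c - t) ^ 2 + of_nat N * t * s"
    unfolding 1 by (rule Suc)
  have 4: "bernstein_sum t s N (\<lambda>k. (c + of_nat (Suc k) - of_nat (Suc N) * t) ^ 2)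
      = (c + s) ^ 2 + of_nat N * t * s"
    unfolding 2 by (rule Suc)
  show ?case
    unfolding bernstein_sum_Suc 3 4 by (simp add: s power2_eq_square algebra_simps)
qed simp

abbreviation "tp i \<equiv> Const (1 / 2) * (1 + Var i) :: 'v::finite mpoly"
abbreviation "tm i \<equiv> Const (1 / 2) * (1 - Var i) :: 'v::finite mpoly"

lemma tpm: "tp i + tm i = (1 :: 'v::finite mpoly)"
proof -
  have "tp i + tm i = Const (1/2) + Const (1/2)" by (simp add: algebra_simps)
  also have "\<dots> = 1" unfolding Const_add[symmetric] by simp
  finally show ?thesis .
qed

text \<open>The tensor product Bernstein basis on the cube: \<open>node\<close> carries k/N from
  [0,1] to [-1,1], and the weights are products of elements of \<open>T\<close>.\<close>

definition grid :: "nat \<Rightarrow> ('v::finite \<Rightarrow> nat) set" where "grid N = (\<Pi>\<^sub>E i\<in>UNIV. {..N})"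
definition node :: "nat \<Rightarrow> nat \<Rightarrow> real" where "node N k = 2 * real k / real N - 1"
definition weight :: "nat \<Rightarrow> ('v::finite \<Rightarrow> nat) \<Rightarrow> 'v mpoly" where
  "weight N \<kappa> = (\<Prod>i\<in>UNIV. of_nat (N choose \<kappa> i) * tp i ^ \<kappa> i * tm i ^ (N - \<kappa> i))"

lemma sum_weight_prod:
  "(\<Sum>\<kappa>\<in>grid N. weight N \<kappa> * (\<Prod>i\<in>UNIV. \<phi> i (\<kappa> i)))
    = (\<Prod>i\<in>UNIV. bernstein_sum (tp i) (tm i) N (\<phi> i))"
  unfolding bernstein_sum_def grid_def weight_def
  by (subst prod_sum_PiE) (auto simp: prod.distrib)

lemma sum_weight: "sum (weight N) (grid N) = 1"
  using sum_weight_prod[of N "\<lambda>_ _. 1"] by (simp add: bernstein_sum_1[OF tpm])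

text \<open>With x_i = 2t - 1 the difference x_i - node is -(2/N)(k - N t), so the variance N t s is
  multiplied by 4/N^2, and 4 t s = 1 - x_i^2. The factors for the other variables sum to
  one.\<close>

lemma sum_weight_dist:
  assumes "0 < N"
  shows "(\<Sum>\<kappa>\<in>(grid N :: ('v::finite \<Rightarrow> nat) set). weight N \<kappa> * dist_sq (\<chi> i. node N (\<kappa> i)))
    = Const (1 / real N) * (\<Sum>i\<in>UNIV. 1 - Var i ^ 2)"
proof -
  have e: "Var i - Const (node N k) = Const (- 2 / real N) * (0 + of_nat k - of_nat N * tp i)" for i :: 'v and k
  proof -
    have "Const (- 2 / real N) * (of_nat N * tp i)
        = Const (- 2 / real N * real N * (1 / 2)) * (1 + Var i)"
      unfolding of_nat_Const Const_mult by (simp add: mult_ac)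
    also have "\<dots> = - (1 + Var i)" using assms by (simp add: Const_uminus)
    finally have "Const (- 2 / real N) * (of_nat N * tp i) = - (1 + Var i)" .
    moreover have "Const (- 2 / real N) * of_nat k = (Const (- 2 * real k / real N) :: 'v mpoly)"
      unfolding of_nat_Const Const_mult[symmetric] by simp
    moreover have "(Const (node N k) :: 'v mpoly) = Const (2 * real k / real N) - 1"
      unfolding node_def Const_diff by simp
    moreover have "(Const (- 2 * real k / real N) :: 'v mpoly) = - Const (2 * real k / real N)"
      unfolding Const_uminus[symmetric] by simp
    ultimately show ?thesis
      unfolding add_0_left right_diff_distrib by (simp only:) simp
  qed
  have tt: "Const (4 / real N ^ 2) * (of_nat N * tp i * tm i) = Const (1 / real N) * (1 - Var i ^ 2)" for i :: 'v
  proof -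
    have "Const (4 / real N ^ 2) * (of_nat N * tp i * tm i)
        = Const (4 / real N ^ 2 * real N * (1 / 2) * (1 / 2)) * ((1 + Var i) * (1 - Var i))"
      unfolding of_nat_Const Const_mult by (simp only: mult_ac)
    also have "4 / real N ^ 2 * real N * (1 / 2) * (1 / 2) = 1 / real N"
      using assms by (simp add: power2_eq_square)
    also have "(1 + Var i) * (1 - Var i) = 1 - Var i ^ 2"
      by (simp add: power2_eq_square algebra_simps)
    finally show ?thesis .
  qed
  have "(\<Sum>\<kappa>\<in>(grid N :: ('v \<Rightarrow> nat) set). weight N \<kappa> * (Var i - Const (node N (\<kappa> i))) ^ 2)
      = Const (1 / real N) * (1 - Var i ^ 2)" for i :: 'v
  proof -
    let ?\<phi> = "\<lambda>j k. if j = i then (Var i - Const (node N k)) ^ 2 else 1"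
    have "(\<Sum>\<kappa>\<in>(grid N :: ('v \<Rightarrow> nat) set). weight N \<kappa> * (Var i - Const (node N (\<kappa> i))) ^ 2)
        = (\<Sum>\<kappa>\<in>grid N. weight N \<kappa> * (\<Prod>j\<in>UNIV. ?\<phi> j (\<kappa> j)))"
    proof -
      have "(\<Prod>j\<in>UNIV. ?\<phi> j (\<kappa> j)) = (Var i - Const (node N (\<kappa> i))) ^ 2" for \<kappa> :: "'v \<Rightarrow> nat"
        by (subst prod.remove[of UNIV i]) auto
      then show ?thesis by simp
    qed
    also have "\<dots> = (\<Prod>j\<in>UNIV. bernstein_sum (tp j) (tm j) N (?\<phi> j))"
      by (rule sum_weight_prod)
    also have "\<dots> = bernstein_sum (tp i) (tm i) N (?\<phi> i)"
      by (subst prod.remove[of UNIV i]) (auto simp: bernstein_sum_1[OF tpm])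
    also have "\<dots> = Const (4 / real N ^ 2)
        * bernstein_sum (tp i) (tm i) N (\<lambda>k. (0 + of_nat k - of_nat N * tp i) ^ 2)"
    proof -
      have "Const (- 2 / real N) ^ 2 = (Const (4 / real N ^ 2) :: 'v mpoly)"
        unfolding Const_power[symmetric] by (simp add: power_divide)
      then show ?thesis
        unfolding e power_mult_distrib bernstein_sum_def sum_distrib_left
        by (intro sum.cong refl) (simp add: mult_ac)
    qed
    also have "\<dots> = Const (1 / real N) * (1 - Var i ^ 2)"
      unfolding bernstein_sum_variance[OF tpm] using tt by simp
    finally show ?thesis .
  qed
  then show ?thesis
    unfolding dist_sq_def by (simp add: sum_distrib_left) (subst sum.swap, simp)
qed

definition unit_box :: "(real ^ 'v::finite) set" where "unit_box = {x. \<forall>i. \<bar>x $ i\<bar> \<le> 1}"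

lemma compact_box: "compact (unit_box :: (real ^ 'v::finite) set)"
proof -
  have "unit_box = (cbox (\<chi> i. -1) (\<chi> i. 1) :: (real ^ 'v) set)"
    by (auto simp: unit_box_def mem_box_cart abs_le_iff minus_le_iff)
  then show ?thesis by (metis compact_cbox)
qed

lemma node_box: "0 < N \<Longrightarrow> \<kappa> \<in> grid N \<Longrightarrow> (\<chi> i. node N (\<kappa> i)) \<in> unit_box"
  by (auto simp: unit_box_def grid_def node_def abs_le_iff divide_simps PiE_iff)

context spherical_system
begin

lemma weight_T: "weight N \<kappa> \<in> T"
  unfolding weight_def by (intro T_prod T_mult T_power T_Var T_of_nat)

text \<open>Averaging the constant matrices \<open>A(a)\<close> over the grid with Bernstein weights changes \<open>A\<close> only by
  an error that is controlled, in the order given by \<open>T\<close>, through the Lipschitz estimate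
  and the variance of the weights.\<close>

lemma T_pos_def_on_box:
  fixes A :: "'i::finite \<Rightarrow> 'i \<Rightarrow> 'v mpoly" and m :: "'i \<Rightarrow> 'v mpoly"
  assumes "0 < \<eta>"
    and pd: "\<And>a v :: 'i \<Rightarrow> real. a \<in> unit_box \<Longrightarrow>
      \<eta> * (\<Sum>i\<in>UNIV. v i ^ 2) \<le> qform (\<lambda>i j. eval (A i j) a) v"
  shows "\<exists>e>0. qform A m - Const e * (\<Sum>i\<in>UNIV. m i ^ 2) \<in> T"
proof -
  let ?m2 = "\<Sum>i\<in>UNIV. m i ^ 2"
  let ?Q = "qform A m"
  define n where "n = real CARD('i)"
  have n: "0 < n" by (simp add: n_def)
  have m2: "?m2 \<in> T" by (intro qmod_sum T_square)
  have "\<forall>i j. \<exists>C\<ge>0. \<forall>a\<in>unit_box. Const C * dist_sq a - (A i j - Const (eval (A i j) a)) ^ 2 \<in> T"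
    using T_Lipschitz[OF compact_box] by blast
  then obtain C' where C': "\<And>i j. 0 \<le> C' i j"
    "\<And>i j a. a \<in> unit_box \<Longrightarrow> Const (C' i j) * dist_sq a - (A i j - Const (eval (A i j) a)) ^ 2 \<in> T"
    by metis
  define C where "C = (\<Sum>i\<in>UNIV. \<Sum>j\<in>UNIV. C' i j)"
  have "C' i j \<le> C" for i j
  proof -
    have "C' i j \<le> (\<Sum>j\<in>UNIV. C' i j)"
      by (rule member_le_sum) (auto simp: C')
    also have "\<dots> \<le> C"
      unfolding C_def by (rule member_le_sum[of _ _ "\<lambda>i. \<Sum>j\<in>UNIV. C' i j"]) (auto simp: C' sum_nonneg)
    finally show ?thesis .
  qed
  then have C: "Const C * dist_sq a - (A i j - Const (eval (A i j) a)) ^ 2 \<in> T" if "a \<in> unit_box" for i j a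
    using qmod_add[OF C'(2)[OF that, of i j] T_Const_mult[OF _ T_dist_sq, of "C - C' i j" a]]
    by (simp add: Const_diff left_diff_distrib)
  have C0: "0 \<le> C" unfolding C_def by (intro sum_nonneg C')
  \<comment> \<open>With this value the loss n \<delta> / 2 below is \<eta> / 8.\<close>
  define \<delta> where "\<delta> = \<eta> / (4 * n)"
  have \<delta>: "0 < \<delta>" using assms n by (simp add: \<delta>_def)
  have step: "?Q - Const (\<eta> / 2) * ?m2 + Const (n * \<delta> / 2) * ?m2
      + Const (n * C / (2 * \<delta>)) * (dist_sq a * ?m2) \<in> T" (is "?U a \<in> T") if a: "a \<in> unit_box" for a
  proof -
    define \<Delta> where "\<Delta> i j = A i j - Const (eval (A i j) a)" for i j
    \<comment> \<open>Young's inequality in \<open>T\<close>: the mixed term costs (\<delta>/2)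
      m_i^2 and (1/(2\<delta>)) \<Delta>^2 m_j^2, and \<Delta>^2 is bounded by C times the squared
      distance to \<open>a\<close>.\<close>
    have pair: "\<Delta> i j * m i * m j + Const (\<delta> / 2) * m i ^ 2
        + Const (C / (2 * \<delta>)) * (dist_sq a * m j ^ 2) \<in> T" for i j
    proof -
      have "\<Delta> i j * m i * m j + Const (\<delta> / 2) * m i ^ 2 + Const (C / (2 * \<delta>)) * (dist_sq a * m j ^ 2)
        = Const (\<delta> / 2) * (m i + Const (1 / \<delta>) * \<Delta> i j * m j) ^ 2
          + Const (1 / (2 * \<delta>)) * (m j ^ 2 * (Const C * dist_sq a - \<Delta> i j ^ 2))"
      proof -
        have 1: "Const (\<delta> / 2) * (m i + Const (1 / \<delta>) * \<Delta> i j * m j) ^ 2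
            = Const (\<delta> / 2) * m i ^ 2 + Const (\<delta> / 2 * (1 / \<delta>) + \<delta> / 2 * (1 / \<delta>)) * (\<Delta> i j * m i * m j)
              + Const (\<delta> / 2 * (1 / \<delta>) * (1 / \<delta>)) * (\<Delta> i j ^ 2 * m j ^ 2)"
          unfolding Const_add Const_mult by (simp add: power2_eq_square algebra_simps)
        have 2: "\<delta> / 2 * (1 / \<delta>) + \<delta> / 2 * (1 / \<delta>) = 1" "\<delta> / 2 * (1 / \<delta>) * (1 / \<delta>) = 1 / (2 * \<delta>)"
          using \<delta> by (simp_all add: field_simps)
        have 3: "Const (C / (2 * \<delta>)) = Const (1 / (2 * \<delta>)) * Const C"
          by (simp add: Const_mult[symmetric])
        show ?thesis unfolding 1 2 3 by (simp add: power2_eq_square algebra_simps)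
      qed
      moreover have "\<dots> \<in> T"
        using C[OF a, of i j] \<delta> unfolding \<Delta>_def[symmetric]
        by (intro qmod_add T_Const_mult T_mult T_square) auto
      ultimately show ?thesis by simp
    qed
    have sum1: "(\<Sum>i\<in>UNIV. \<Sum>j\<in>UNIV. \<Delta> i j * m i * m j + Const (\<delta> / 2) * m i ^ 2
        + Const (C / (2 * \<delta>)) * (dist_sq a * m j ^ 2))
      = qform \<Delta> m + Const (n * \<delta> / 2) * ?m2
        + Const (n * C / (2 * \<delta>)) * (dist_sq a * ?m2)"
    proof -
      have "(\<Sum>i\<in>UNIV. \<Sum>j\<in>(UNIV::'i set). Const (\<delta> / 2) * m i ^ 2) = Const (n * \<delta> / 2) * ?m2"
        by (simp add: of_nat_Const n_def[symmetric] sum_distrib_left mult.assoc[symmetric] Const_mult[symmetric])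
      moreover have "(\<Sum>i\<in>(UNIV::'i set). \<Sum>j\<in>UNIV. Const (C / (2 * \<delta>)) * (dist_sq a * m j ^ 2))
          = Const (n * C / (2 * \<delta>)) * (dist_sq a * ?m2)"
        by (simp add: of_nat_Const n_def[symmetric] sum_distrib_left mult.assoc[symmetric] Const_mult[symmetric])
      ultimately show ?thesis by (simp add: sum.distrib)
    qed
    have "qform \<Delta> m + Const (n * \<delta> / 2) * ?m2
        + Const (n * C / (2 * \<delta>)) * (dist_sq a * ?m2) \<in> T"
      unfolding sum1[symmetric] by (intro qmod_sum pair)
    moreover have "qform (\<lambda>i j. Const (eval (A i j) a)) m - Const (\<eta> / 2) * ?m2 \<in> T"
      by (intro qmod_SOS pos_def_minus_diag_SOS assms(1) pd a)
    ultimately have *: "(qform (\<lambda>i j. Const (eval (A i j) a)) m - Const (\<eta> / 2) * ?m2)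
      + (qform \<Delta> m + Const (n * \<delta> / 2) * ?m2
        + Const (n * C / (2 * \<delta>)) * (dist_sq a * ?m2)) \<in> T" by (rule qmod_add[rotated])
    have "?Q = qform (\<lambda>i j. Const (eval (A i j) a)) m
        + qform \<Delta> m"
      by (simp add: \<Delta>_def sum.distrib[symmetric] algebra_simps)
    with * show ?thesis by (simp add: algebra_simps)
  qed
  define b where "b = n * C / (2 * \<delta>)"
  have b: "0 \<le> b" using n C0 \<delta> by (simp add: b_def)
  define V where "V = real CARD('v)"
  \<comment> \<open>The averaged squared distance is at most V/N, so this N makes its cost at most
    \<eta>/8. Together with the \<eta>/8 lost to \<delta>, half of the available \<eta>/2
    remains.\<close>
  obtain N :: nat where N: "b * V * 8 / \<eta> < real N" "0 < N"
    using reals_Archimedean2[of "max (b * V * 8 / \<eta>) 0"] by auto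
  have bN: "b * V / real N \<le> \<eta> / 8"
    using N assms by (simp add: field_simps)
  have lin: "(\<Sum>\<kappa>\<in>X. w \<kappa> * (G + B * (D \<kappa> * r))) = sum w X * G + B * ((\<Sum>\<kappa>\<in>X. w \<kappa> * D \<kappa>) * r)"
    for w D :: "('v \<Rightarrow> nat) \<Rightarrow> 'v mpoly" and G B r and X
    by (simp add: distrib_left sum.distrib sum_distrib_right sum_distrib_left mult_ac)
  let ?G = "?Q - Const (\<eta> / 2) * ?m2 + Const (n * \<delta> / 2) * ?m2"
  have "(\<Sum>\<kappa>\<in>grid N. weight N \<kappa> * ?U (\<chi> i. node N (\<kappa> i))) \<in> T"
    using N(2) by (intro qmod_sum T_mult weight_T step node_box)
  also have "(\<Sum>\<kappa>\<in>grid N. weight N \<kappa> * ?U (\<chi> i. node N (\<kappa> i)))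
      = sum (weight N) (grid N) * ?G
       + Const b * ((\<Sum>\<kappa>\<in>grid N. weight N \<kappa> * dist_sq (\<chi> i. node N (\<kappa> i))) * ?m2)"
    unfolding b_def[symmetric] by (rule lin)
  also have "\<dots> = ?G + Const b * (Const (1 / real N) * (\<Sum>i\<in>UNIV. 1 - Var i ^ 2) * ?m2)"
    unfolding sum_weight sum_weight_dist[OF N(2)] by simp
  also have "\<dots> = ?G + Const (b * V / real N) * ?m2
      - Const (b / real N) * ((\<Sum>i\<in>UNIV. Var i ^ 2) * ?m2)"
  proof -
    have 1: "(\<Sum>i\<in>(UNIV::'v set). 1 - Var i ^ 2) = Const V - (\<Sum>i\<in>UNIV. Var i ^ 2)"
      by (simp add: sum_subtractf of_nat_Const V_def)
    have 2: "Const (b * V / real N) = Const b * Const (1 / real N) * Const V"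
      "Const (b / real N) = Const b * Const (1 / real N)"
      by (simp_all add: Const_mult[symmetric])
    show ?thesis unfolding 1 2 by (simp add: algebra_simps)
  qed
  finally have *: "?G + Const (b * V / real N) * ?m2
      - Const (b / real N) * ((\<Sum>i\<in>UNIV. Var i ^ 2) * ?m2) \<in> T" .
  have "Const (b / real N) * ((\<Sum>i\<in>UNIV. Var i ^ 2) * ?m2) \<in> T"
    using b by (intro T_Const_mult T_mult m2 qmod_sum T_square) auto
  from qmod_add[OF * this] have *: "?G + Const (b * V / real N) * ?m2 \<in> T" by simp
  have "n * \<delta> / 2 = \<eta> / 8" using n by (simp add: \<delta>_def)
  then have "0 \<le> \<eta> / 2 - \<eta> / 4 - n * \<delta> / 2 - b * V / real N" using bN by linarith
  from qmod_add[OF * T_Const_mult[OF this m2]]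
  have "?Q - Const (\<eta> / 4) * ?m2 \<in> T"
    unfolding Const_diff by (simp add: algebra_simps)
  then show ?thesis using assms(1) by (intro exI[of _ "\<eta> / 4"]) simp
qed

end

section \<open>Positivstellensatz for positive definite matrix polynomials\<close>

text \<open>On the compact set where Q \<le> 0 the penalty R has a positive minimum, so a large
  multiple of it outweighs the minimum of Q.\<close>

lemma compact_penalty:
  fixes Q R :: "'a::topological_space \<Rightarrow> real"
  assumes X: "compact X" and Q: "continuous_on X Q" and R: "continuous_on X R"
    and nonneg: "\<And>x. x \<in> X \<Longrightarrow> 0 \<le> R x" and pos: "\<And>x. x \<in> X \<Longrightarrow> R x = 0 \<Longrightarrow> 0 < Q x"
  shows "\<exists>K\<^sub>0\<ge>0. \<forall>K\<ge>K\<^sub>0. \<forall>x\<in>X. 0 < Q x + K * R x"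
proof -
  define X0 where "X0 = {x\<in>X. Q x \<le> 0}"
  have "X0 = X \<inter> {x\<in>X. Q x \<le> 0}" by (auto simp: X0_def)
  moreover have "closedin (top_of_set X) {x\<in>X. Q x \<le> 0}"
    using continuous_closedin_preimage[OF Q, of "{..0}"] by (simp add: vimage_def Int_def)
  ultimately have X0: "compact X0"
    using X by (metis X0_def closedin_compact)
  show ?thesis
  proof (cases "X0 = {}")
    case True
    have "0 < Q x + K * R x" if "0 \<le> K" "x \<in> X" for K x
    proof -
      have "0 < Q x" using True that by (force simp: X0_def)
      moreover have "0 \<le> K * R x" using that nonneg by simp
      ultimately show ?thesis by simp
    qed
    then show ?thesis by (intro exI[of _ 0]) auto
  next
    case False
    have sub: "X0 \<subseteq> X" by (auto simp: X0_def)
    obtain x0 where x0: "x0 \<in> X0" "\<And>x. x \<in> X0 \<Longrightarrow> R x0 \<le> R x"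
      using continuous_attains_inf[OF X0 False continuous_on_subset[OF R sub]] by blast
    have "X \<noteq> {}" using False sub by auto
    then obtain y where y: "y \<in> X" "\<And>x. x \<in> X \<Longrightarrow> Q y \<le> Q x"
      using continuous_attains_inf[OF X _ Q] by blast
    have r: "0 < R x0"
      using pos[of x0] nonneg[of x0] x0(1) by (force simp: X0_def)
    define K0 where "K0 = (\<bar>Q y\<bar> + 1) / R x0"
    have K0: "0 \<le> K0" using r by (simp add: K0_def)
    have "0 < Q x + K * R x" if K: "K0 \<le> K" and x: "x \<in> X" for K x
    proof (cases "x \<in> X0")
      case True
      have "\<bar>Q y\<bar> + 1 = K0 * R x0" using r by (simp add: K0_def)
      also have "\<dots> \<le> K * R x" using K K0 r x0(2)[OF True] by (intro mult_mono) auto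
      finally show ?thesis using y(2)[OF x] by linarith
    next
      case False
      then have "0 < Q x" using x by (auto simp: X0_def)
      moreover have "0 \<le> K * R x" using K K0 nonneg[OF x] by simp
      ultimately show ?thesis by simp
    qed
    then show ?thesis using K0 by blast
  qed
qed

lemma compact_pos_lower_bound:
  fixes Q :: "'a::topological_space \<Rightarrow> real"
  assumes "compact X" "continuous_on X Q" "\<And>x. x \<in> X \<Longrightarrow> 0 < Q x"
  shows "\<exists>\<eta>>0. \<forall>x\<in>X. \<eta> \<le> Q x"
proof (cases "X = {}")
  case False
  then obtain y where "y \<in> X" "\<And>x. x \<in> X \<Longrightarrow> Q y \<le> Q x"
    using continuous_attains_inf[OF assms(1) _ assms(2)] by blast
  then show ?thesis using assms(3) by blast
qed (auto intro: exI[of _ 1])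

text \<open>Bernoulli gives 1 + n t \<le> (1 + t)^n, and (1 - t)(1 + t) \<le> 1.\<close>

lemma power_one_minus_le:
  fixes t :: real
  assumes "0 \<le> t" "t \<le> 1" shows "(1 - t) ^ n * (1 + real n * t) \<le> 1"
proof -
  have "(1 - t) ^ n * (1 + real n * t) \<le> (1 - t) ^ n * (1 + t) ^ n"
    using assms Bernoulli_inequality[of t n] by (intro mult_left_mono) auto
  also have "\<dots> = (1 - t ^ 2) ^ n"
    by (simp add: power_mult_distrib[symmetric] power2_eq_square algebra_simps)
  also have "\<dots> \<le> 1"
    using assms by (intro power_le_one) (auto simp: power_le_one)
  finally show ?thesis .
qed

text \<open>The factor (1 - t)^n damps positive t to at most 1/n and amplifies negative t. Hence
  subtracting a constraint times such a factor, a square for even n, acts like a penalty for its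
  violation.\<close>

lemma penalty_polynomial_bound:
  fixes t :: real
  assumes "- 1 \<le> t" "t \<le> 1" "0 < n"
  shows "real n * (min 0 t) ^ 2 - 1 / real n \<le> - (t * (1 - t) ^ n)"
proof (cases "0 \<le> t")
  case True
  have "(1 - t) ^ n * (real n * t) \<le> (1 - t) ^ n * (1 + real n * t)"
    using assms True by (intro mult_left_mono) auto
  also have "\<dots> \<le> 1" using power_one_minus_le[OF True assms(2)] .
  finally have "t * (1 - t) ^ n \<le> 1 / real n"
    using assms by (simp add: field_simps)
  then show ?thesis using True by simp
next
  case False
  have "real n * t ^ 2 \<le> - t * (1 + real n * (- t))"
    using False by (simp add: power2_eq_square algebra_simps)
  also have "\<dots> \<le> - t * (1 + (- t)) ^ n"
    using False Bernoulli_inequality[of "- t" n] assms by (intro mult_left_mono) auto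
  finally have "real n * t ^ 2 \<le> - (t * (1 - t) ^ n)" by simp
  moreover have "0 \<le> 1 / real n" by simp
  moreover have "min 0 t = t" using False by simp
  ultimately show ?thesis by (metis diff_mono diff_zero order_trans order_refl)
qed

lemma norm_vec_sq: "(\<Sum>i\<in>UNIV. (v $ i) ^ 2) = (norm (v :: real ^ 'i::finite)) ^ 2"
  by (simp add: norm_vec_def L2_set_def sum_nonneg)

lemma quadratic_form_scale:
  fixes a :: "'i::finite \<Rightarrow> 'i \<Rightarrow> real" and v :: "'i \<Rightarrow> real"
  assumes "\<And>w :: real ^ 'i. norm w = 1 \<Longrightarrow> \<eta> \<le> qform a (($) w)"
  shows "\<eta> * (\<Sum>i\<in>UNIV. v i ^ 2) \<le> qform a v"
proof -
  define u :: "real ^ 'i" where "u = (\<chi> i. v i)"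
  show ?thesis
  proof (cases "u = 0")
    case True
    then have "v i = 0" for i by (simp add: u_def vec_eq_iff)
    then show ?thesis by simp
  next
    case False
    define r where "r = norm u"
    have r: "0 < r" using False by (simp add: r_def)
    define w where "w = (1 / r) *\<^sub>R u"
    have w: "norm w = 1" using False by (simp add: w_def r_def)
    have v: "v i = r * w $ i" for i using r by (simp add: w_def u_def)
    have r2: "(\<Sum>i\<in>UNIV. v i ^ 2) = r ^ 2"
      using norm_vec_sq[of u] by (simp add: u_def r_def)
    have "qform a v
        = r ^ 2 * qform a (($) w)"
      unfolding sum_distrib_left by (intro sum.cong refl) (simp add: v power2_eq_square)
    then show ?thesis
      unfolding r2 using assms[OF w] by (simp add: mult.commute[of _ "r ^ 2"] mult_left_mono)
  qed
qed

context spherical_system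
begin

lemma norm_feasible: "x \<in> S \<Longrightarrow> norm x = 1"
proof -
  assume "x \<in> S"
  then have "eval (q z) x = 0" using z(1) by (auto simp: feasible_set_def)
  then have "(norm x)\<^sup>2 = 1\<^sup>2" by (simp add: z(2))
  then show ?thesis using power2_eq_iff_nonneg[of "norm x" 1] by simp
qed

text \<open>The square of min(0, t) is continuously differentiable, so the same penalty serves the
  compactness arguments and the derivation of Lagrange multipliers.\<close>

definition violation :: "real ^ 'v \<Rightarrow> real" where
  "violation x = (\<Sum>j\<in>EQ. (eval (q j) x) ^ 2) + (\<Sum>j\<in>IN. (min 0 (eval (q j) x)) ^ 2)"

lemma violation_nonneg: "0 \<le> violation x"
  unfolding violation_def by (intro add_nonneg_nonneg sum_nonneg) auto

lemma violation_eq_0_iff: "violation x = 0 \<longleftrightarrow> x \<in> S"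
proof
  assume "violation x = 0"
  then have "(\<Sum>j\<in>EQ. (eval (q j) x) ^ 2) = 0" "(\<Sum>j\<in>IN. (min 0 (eval (q j) x)) ^ 2) = 0"
    unfolding violation_def by (smt (verit) sum_nonneg zero_le_power2)+
  then show "x \<in> S"
    by (auto simp: feasible_set_def sum_nonneg_eq_0_iff min_def split: if_splits)
qed (simp add: violation_def feasible_set_def)

lemma continuous_on_violation [continuous_intros]:
  "continuous_on A h \<Longrightarrow> continuous_on A (\<lambda>x. violation (h x))"
  unfolding violation_def by (intro continuous_intros)

lemma compact_S: "compact S"
proof -
  have "S = (\<Inter>j\<in>EQ. {x. eval (q j) x = 0}) \<inter> (\<Inter>j\<in>IN. {x. 0 \<le> eval (q j) x})"
    by (auto simp: feasible_set_def)
  moreover have "closed \<dots>"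
    by (intro closed_Int closed_INT ballI closed_Collect_eq closed_Collect_le continuous_intros)
  ultimately have "closed S" by simp
  moreover have "bounded S" by (rule boundedI[of _ 1]) (simp add: norm_feasible)
  ultimately show ?thesis by (simp add: compact_eq_bounded_closed)
qed

lemma qmod_EQ_square: "- (Const K * (\<Sum>j\<in>EQ. q j ^ 2)) * p \<in> M"
proof -
  have "- (Const K * (\<Sum>j\<in>EQ. q j ^ 2)) * p = (\<Sum>j\<in>EQ. q j * (- Const K * q j * p))"
    by (simp add: sum_distrib_left sum_distrib_right sum_negf power2_eq_square mult_ac)
  then show ?thesis by (auto intro!: qmod_sum qmod_ideal simp del: mult_minus_left mult_minus_right)
qed

text \<open>Adding K times the violation extends positivity from \<open>S\<close> to the whole box.
  The violation is not polynomial; it is replaced by \<open>W\<close>, whose negative lies in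
  \<open>M\<close>, and \<open>T_pos_def_on_box\<close> applies to A + W Id.\<close>

theorem M_pos_def:
  fixes A :: "'i::finite \<Rightarrow> 'i \<Rightarrow> 'v mpoly" and m :: "'i \<Rightarrow> 'v mpoly"
  assumes pd: "\<And>a (v :: real ^ 'i). a \<in> S \<Longrightarrow> v \<noteq> 0 \<Longrightarrow>
      0 < qform (\<lambda>i j. eval (A i j) a) (($) v)"
  shows "\<exists>e>0. qform A m - Const e * (\<Sum>i\<in>UNIV. m i ^ 2) \<in> M"
proof -
  let ?m2 = "\<Sum>i\<in>UNIV. m i ^ 2"
  define X where "X = (unit_box :: (real ^ 'v) set) \<times> (sphere 0 1 :: (real ^ 'i) set)"
  define Q where "Q xv = (\<Sum>i\<in>UNIV. \<Sum>j\<in>UNIV. eval (A i j) (fst xv) * snd xv $ i * snd xv $ j)" for xv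
  have X: "compact X" by (auto simp: X_def intro!: compact_Times compact_box)
  have cQ: "continuous_on X Q"
    unfolding Q_def by (intro continuous_intros)
  have cR: "continuous_on X (\<lambda>xv. violation (fst xv))" by (intro continuous_intros)
  have "0 < Q xv" if "xv \<in> X" "violation (fst xv) = 0" for xv
    unfolding Q_def using that by (intro pd) (auto simp: X_def violation_eq_0_iff)
  then obtain K where K: "0 \<le> K" "\<And>xv. xv \<in> X \<Longrightarrow> 0 < Q xv + K * violation (fst xv)"
    using compact_penalty[OF X cQ cR] violation_nonneg by blast
  have "\<exists>\<eta>>0. \<forall>xv\<in>X. \<eta> \<le> Q xv + K * violation (fst xv)"
    by (rule compact_pos_lower_bound[OF X]) (auto intro!: continuous_intros cQ cR K)
  then obtain \<eta> where \<eta>: "0 < \<eta>" "\<And>xv. xv \<in> X \<Longrightarrow> \<eta> \<le> Q xv + K * violation (fst xv)" by blast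
  have "\<forall>j. \<exists>b. \<forall>x\<in>unit_box. \<bar>eval (q j) x\<bar> \<le> b"
    by (intro allI eval_bounded_on_compact compact_box)
  then obtain b where b: "\<And>j x. x \<in> unit_box \<Longrightarrow> \<bar>eval (q j) x\<bar> \<le> b j" by metis
  define B where "B = 1 + (\<Sum>j\<in>IN. \<bar>b j\<bar>)"
  have B: "0 < B" unfolding B_def by (smt (verit) sum_nonneg abs_ge_zero)
  have bB: "\<bar>eval (q j) x\<bar> \<le> B" if "x \<in> unit_box" "j \<in> IN" for j x
  proof -
    have "\<bar>b j\<bar> \<le> (\<Sum>j\<in>IN. \<bar>b j\<bar>)" by (rule member_le_sum) (auto simp: that)
    then show ?thesis using b[OF that(1), of j] by (simp add: B_def)
  qed
  define L where "L = real (card IN)"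
  obtain k0 :: nat where k0: "max (max (K * B) (L * B * 2 / \<eta>)) 1 < real k0"
    using reals_Archimedean2 by blast
  \<comment> \<open>An even exponent makes the multipliers (1 - q_j/B)^n squares, as membership in
    \<open>M\<close> requires. The size of \<open>n\<close> bounds the accumulated error L B / n by
    \<eta>/2.\<close>
  define n where "n = 2 * k0"
  have n: "0 < n" "K * B \<le> real n" "L * B * 2 / \<eta> \<le> real n"
    using k0 by (auto simp: n_def)
  define s where "s j = ((1 - Const (1 / B) * q j) ^ k0) ^ 2" for j
  define W where "W = Const K * (\<Sum>j\<in>EQ. q j ^ 2) - (\<Sum>j\<in>IN. q j * s j)"
  have Wx: "K * violation x - \<eta> / 2 \<le> eval W x" if x: "x \<in> unit_box" for x
  proof -
    have *: "K * (min 0 (eval (q j) x)) ^ 2 - B / real n \<le> - (eval (q j) x * eval (s j) x)" if j: "j \<in> IN" for j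
    proof -
      define t where "t = eval (q j) x / B"
      have t: "- 1 \<le> t" "t \<le> 1" using bB[OF x j] B by (auto simp: t_def divide_simps)
      have qt: "eval (q j) x = B * t" using B by (simp add: t_def)
      have st: "eval (s j) x = (1 - t) ^ n" by (simp add: s_def t_def n_def power_mult[symmetric] mult.commute)
      have "K * (min 0 (B * t)) ^ 2 = K * B * (B * (min 0 t) ^ 2)"
      proof -
        have "min 0 (B * t) = B * min 0 t" using B by (auto simp: min_def mult_le_0_iff zero_le_mult_iff)
        then show ?thesis by (simp add: power2_eq_square)
      qed
      also have "\<dots> \<le> real n * (B * (min 0 t) ^ 2)"
        using n(2) B by (intro mult_right_mono) auto
      finally have "K * (min 0 (B * t)) ^ 2 - B / real n \<le> B * (real n * (min 0 t) ^ 2 - 1 / real n)"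
        by (simp add: algebra_simps)
      also have "\<dots> \<le> B * - (t * (1 - t) ^ n)"
        using penalty_polynomial_bound[OF t n(1)] B by (intro mult_left_mono) auto
      finally show ?thesis unfolding qt st by (simp add: mult_ac)
    qed
    have "L * (B / real n) \<le> \<eta> / 2"
      using n \<eta>(1) by (simp add: field_simps)
    moreover have "(\<Sum>j\<in>IN. K * (min 0 (eval (q j) x)) ^ 2 - B / real n)
        \<le> (\<Sum>j\<in>IN. - (eval (q j) x * eval (s j) x))"
      by (rule sum_mono) (rule *)
    moreover have "(\<Sum>j\<in>IN. K * (min 0 (eval (q j) x)) ^ 2 - B / real n)
        = K * (\<Sum>j\<in>IN. (min 0 (eval (q j) x)) ^ 2) - L * (B / real n)"
      by (simp add: sum_subtractf sum_distrib_left L_def)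
    ultimately have "K * (\<Sum>j\<in>IN. (min 0 (eval (q j) x)) ^ 2) - \<eta> / 2
        \<le> - (\<Sum>j\<in>IN. eval (q j) x * eval (s j) x)"
      unfolding sum_negf by linarith
    then show ?thesis
      by (simp add: W_def violation_def distrib_left)
  qed
  define A' where "A' i j = A i j + (if i = j then W else 0)" for i j
  have A': "qform A' u
      = qform A u + W * (\<Sum>i\<in>UNIV. u i ^ 2)" for u
    unfolding A'_def qform_add qform_diag ..
  have "\<exists>e>0. qform A' m - Const e * ?m2 \<in> T"
  proof (rule T_pos_def_on_box)
    show "0 < \<eta> / 2" using \<eta> by simp
    fix a :: "real ^ 'v" and v :: "'i \<Rightarrow> real" assume a: "a \<in> unit_box"
    show "\<eta> / 2 * (\<Sum>i\<in>UNIV. (v i)\<^sup>2) \<le> qform (\<lambda>i j. eval (A' i j) a) v"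
    proof (rule quadratic_form_scale)
      fix w :: "real ^ 'i" assume w: "norm w = 1"
      have "qform (\<lambda>i j. eval (A' i j) a) (($) w)
          = Q (a, w) + eval W a * (\<Sum>i\<in>UNIV. (w $ i) ^ 2)"
      proof -
        have "eval (A' i j) a = eval (A i j) a + (if i = j then eval W a else 0)" for i j
          by (simp add: A'_def)
        then show ?thesis unfolding Q_def fst_conv snd_conv by (simp only: qform_add qform_diag)
      qed
      also have "\<dots> = Q (a, w) + eval W a" by (simp add: norm_vec_sq w)
      finally show "\<eta> / 2 \<le> qform (\<lambda>i j. eval (A' i j) a) (($) w)"
        using \<eta>(2)[of "(a, w)"] Wx[OF a] a w by (simp add: X_def)
    qed
  qed
  then obtain e where e: "0 < e" "qform A' m - Const e * ?m2 \<in> T" by blast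
  have "(\<Sum>j\<in>IN. q j * (s j * ?m2)) \<in> M"
    by (intro qmod_sum qmod_ineq finite_IN SOS_mult SOS_sum) (auto simp: s_def)
  then have "(qform A' m - Const e * ?m2)
      + ((\<Sum>j\<in>IN. q j * (s j * ?m2)) + - (Const K * (\<Sum>j\<in>EQ. q j ^ 2)) * ?m2) \<in> M"
    by (intro qmod_add qmod_subset[OF e(2)] qmod_EQ_square)
  also have "(\<Sum>j\<in>IN. q j * (s j * ?m2)) = (\<Sum>j\<in>IN. q j * s j) * ?m2"
    by (simp only: sum_distrib_right mult.assoc)
  finally show ?thesis
    using e(1) unfolding A' W_def by (intro exI[of _ e]) (simp add: algebra_simps)
qed

end

section \<open>Membership of a polynomial with nondegenerate zeros\<close>

text \<open>\<open>\<kappa>\<close> is the quotient of 1 - (1 - c F)^n by F. Its value at the zeros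
  of F, where pointwise division is impossible, is the derivative n c.\<close>

lemma geometric_factor:
  fixes F :: "'v::finite mpoly"
  shows "\<exists>\<kappa>. (1 - Const c * F) ^ n = 1 - F * \<kappa> \<and> (\<forall>x. eval F x = 0 \<longrightarrow> eval \<kappa> x = real n * c)"
proof (induction n)
  case 0
  then show ?case by (intro exI[of _ 0]) simp
next
  case (Suc n)
  then obtain \<kappa> where \<kappa>: "(1 - Const c * F) ^ n = 1 - F * \<kappa>"
    "\<And>x. eval F x = 0 \<Longrightarrow> eval \<kappa> x = real n * c" by blast
  show ?case
    unfolding power_Suc \<kappa>(1)
    by (rule exI[of _ "\<kappa> + Const c - Const c * F * \<kappa>"])
      (simp add: \<kappa>(2) algebra_simps)
qed

context spherical_system
begin

theorem membership_from_local_representation: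
  fixes F H :: "'v mpoly" and m b :: "'i::finite \<Rightarrow> 'v mpoly" and A :: "'i \<Rightarrow> 'i \<Rightarrow> 'v mpoly"
  assumes nonneg: "\<And>x. x \<in> S \<Longrightarrow> 0 \<le> eval F x"
    and Fb: "F = (\<Sum>i\<in>UNIV. m i * b i)" and FH: "F - H \<in> M"
    and H: "H = qform A m"
    and pd: "\<And>x (v :: real ^ 'i). x \<in> S \<Longrightarrow> eval F x = 0 \<Longrightarrow> v \<noteq> 0 \<Longrightarrow>
      0 < qform (\<lambda>i j. eval (A i j) x) (($) v)"
  shows "\<exists>e>0. \<exists>t. F - Const e * ((\<Sum>i\<in>UNIV. (m i * (1 - F * t)) ^ 2) + F ^ 2) \<in> M"
proof -
  let ?m2 = "\<Sum>i\<in>UNIV. m i ^ 2"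
  define X where "X = S \<times> (sphere 0 1 :: (real ^ 'i) set)"
  have X: "compact X" by (auto simp: X_def intro!: compact_Times compact_S)
  define Q where "Q xv = (\<Sum>i\<in>UNIV. \<Sum>j\<in>UNIV. eval (A i j) (fst xv) * snd xv $ i * snd xv $ j)" for xv
  \<comment> \<open>The quadratic form of b b^T + |m|^2 Id - m m^T, nonnegative by Cauchy-Schwarz.
    If F \<noteq> 0, it is positive for v \<noteq> 0: otherwise v would be parallel to m and
    orthogonal to b, whereas m \<bullet> b = F.\<close>
  define R where "R xv = (\<Sum>i\<in>UNIV. eval (b i) (fst xv) * snd xv $ i) ^ 2
      + (eval ?m2 (fst xv) * (\<Sum>i\<in>UNIV. (snd xv $ i) ^ 2)
        - (\<Sum>i\<in>UNIV. eval (m i) (fst xv) * snd xv $ i) ^ 2)" for xv :: "(real ^ 'v) \<times> (real ^ 'i)"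
  define mv where "mv x = (\<chi> i. eval (m i) x)" for x
  define bv where "bv x = (\<chi> i. eval (b i) x)" for x
  have R_alt: "R (x, v) = (bv x \<bullet> v) ^ 2 + ((mv x \<bullet> mv x) * (v \<bullet> v) - (mv x \<bullet> v) ^ 2)" for x v
    by (simp add: R_def mv_def bv_def inner_vec_def power2_eq_square)
  have CS: "0 \<le> (mv x \<bullet> mv x) * (v \<bullet> v) - (mv x \<bullet> v) ^ 2" for x v
    using Cauchy_Schwarz_ineq[of "mv x" v] by simp
  have Fv: "eval F x = mv x \<bullet> bv x" for x
    unfolding Fb by (simp add: mv_def bv_def inner_vec_def)
  have cQ: "continuous_on X Q" unfolding Q_def by (intro continuous_intros)
  have cR: "continuous_on X R" unfolding R_def by (intro continuous_intros)
  have "0 < Q xv" if xv: "xv \<in> X" and R0: "R xv = 0" for xv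
  proof -
    obtain x v where [simp]: "xv = (x, v)" by force
    have x: "x \<in> S" and v: "v \<noteq> 0" using xv by (auto simp: X_def)
    have bv0: "bv x \<bullet> v = 0" and cs0: "(mv x \<bullet> mv x) * (v \<bullet> v) = (mv x \<bullet> v) ^ 2"
    proof -
      have "(bv x \<bullet> v) ^ 2 + ((mv x \<bullet> mv x) * (v \<bullet> v) - (mv x \<bullet> v) ^ 2) = 0"
        using R0 by (simp only: \<open>xv = (x, v)\<close> R_alt)
      moreover have "0 \<le> (bv x \<bullet> v) ^ 2" by simp
      ultimately have "(bv x \<bullet> v) ^ 2 = 0" "(mv x \<bullet> mv x) * (v \<bullet> v) = (mv x \<bullet> v) ^ 2"
        using CS[of x v] by linarith+
      then show "bv x \<bullet> v = 0" "(mv x \<bullet> mv x) * (v \<bullet> v) = (mv x \<bullet> v) ^ 2" by simp_all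
    qed
    have "eval F x = 0"
    proof (rule ccontr)
      assume F0: "eval F x \<noteq> 0"
      define M2 where "M2 = mv x \<bullet> mv x"
      have M2: "M2 \<noteq> 0" using F0 by (auto simp: M2_def Fv)
      define w where "w = M2 *\<^sub>R v - (mv x \<bullet> v) *\<^sub>R mv x"
      have "w \<bullet> w = M2 * (M2 * (v \<bullet> v) - (mv x \<bullet> v) ^ 2)"
        unfolding w_def M2_def
        by (simp add: inner_diff_left inner_diff_right inner_commute power2_eq_square algebra_simps)
      then have "w = 0" using cs0 by (simp add: M2_def)
      then have w: "M2 *\<^sub>R v = (mv x \<bullet> v) *\<^sub>R mv x" by (simp add: w_def)
      have "(M2 *\<^sub>R v) \<bullet> bv x = 0" using bv0 by (simp add: inner_commute)
      then have "(mv x \<bullet> v) * eval F x = 0" unfolding w Fv by simp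
      then have "mv x \<bullet> v = 0" using F0 by simp
      then show False using w M2 v by simp
    qed
    then show ?thesis unfolding Q_def using pd[OF x _ v] by simp
  qed
  moreover have "0 \<le> R xv" for xv
    using R_alt[of "fst xv" "snd xv"] CS[of "fst xv" "snd xv"] by simp
  ultimately obtain N where N: "0 \<le> N" "\<And>xv. xv \<in> X \<Longrightarrow> 0 < Q xv + N * R xv"
    using compact_penalty[OF X cQ cR] by blast
  define A' where "A' i j = A i j + Const N * (b i * b j + ((if i = j then ?m2 else 0) - m i * m j))" for i j
  have "\<exists>e>0. qform A' m - Const e * ?m2 \<in> M"
  proof (rule M_pos_def)
    fix x :: "real ^ 'v" and v :: "real ^ 'i" assume x: "x \<in> S" and v: "v \<noteq> 0"
    have "\<exists>\<eta>>0. \<forall>xv\<in>X. \<eta> \<le> Q xv + N * R xv"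
      by (rule compact_pos_lower_bound[OF X]) (auto intro!: continuous_intros cQ cR N)
    then obtain \<eta> where \<eta>: "0 < \<eta>" "\<And>xv. xv \<in> X \<Longrightarrow> \<eta> \<le> Q xv + N * R xv" by blast
    have "\<eta> * (\<Sum>i\<in>UNIV. (v $ i) ^ 2) \<le> qform (\<lambda>i j. eval (A' i j) x) (($) v)"
    proof (rule quadratic_form_scale)
      fix w :: "real ^ 'i" assume w: "norm w = 1"
      have "eval (A' i j) x * w $ i * w $ j = eval (A i j) x * w $ i * w $ j
          + N * ((eval (b i) x * w $ i) * (eval (b j) x * w $ j)
          + (if i = j then eval ?m2 x * (w $ i) ^ 2 else 0)
          - (eval (m i) x * w $ i) * (eval (m j) x * w $ j))" for i j
        by (auto simp add: A'_def power2_eq_square algebra_simps)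
      then have "qform (\<lambda>i j. eval (A' i j) x) (($) w) = Q (x, w) + N * R (x, w)"
        unfolding Q_def R_def fst_conv snd_conv
        by (simp add: sum.distrib sum_subtractf sum_distrib_left[symmetric] sum_distrib_right[symmetric]
            power2_eq_square[of "sum _ _"])
      then show "\<eta> \<le> qform (\<lambda>i j. eval (A' i j) x) (($) w)"
        using \<eta>(2)[of "(x, w)"] x w by (simp add: X_def)
    qed
    moreover have "0 < \<eta> * (\<Sum>i\<in>UNIV. (v $ i) ^ 2)"
      unfolding norm_vec_sq using \<eta>(1) v by simp
    ultimately show "0 < qform (\<lambda>i j. eval (A' i j) x) (($) v)" by linarith
  qed
  then obtain e1 where e1: "0 < e1" "qform A' m - Const e1 * ?m2 \<in> M" by blast
  have "qform A' m = H + Const N * F ^ 2"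
  proof -
    have "A' i j * m i * m j = A i j * m i * m j
          + Const N * ((m i * b i) * (m j * b j)
          + (if i = j then ?m2 * m i ^ 2 else 0) - m i ^ 2 * m j ^ 2)" for i j
      by (auto simp add: A'_def power2_eq_square algebra_simps)
    then have "qform A' m
      = H + Const N * (F * F + ?m2 * ?m2 - ?m2 * ?m2)"
      unfolding H Fb by (simp add: sum.distrib sum_subtractf sum_distrib_left[symmetric] sum_distrib_right[symmetric])
    then show ?thesis by (simp add: power2_eq_square)
  qed
  with e1(2) have "(F - H) + (H + Const N * F ^ 2 - Const e1 * ?m2) \<in> M"
    by (intro qmod_add FH) simp
  then have G: "F + Const N * F ^ 2 - Const e1 * ?m2 \<in> M" by (simp add: add_diff_eq)
  obtain B0 where "\<forall>x\<in>S. \<bar>eval F x\<bar> \<le> B0" using eval_bounded_on_compact[OF compact_S] by blast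
  then have B0: "eval F x \<le> B0" if "x \<in> S" for x using that by fastforce
  define B where "B = max 1 B0"
  have B: "1 \<le> B" "\<And>x. x \<in> S \<Longrightarrow> eval F x \<le> B" using B0 by (auto simp: B_def le_max_iff_disj)
  \<comment> \<open>With n > N B the value 2n/B of \<open>\<kappa>\<close> at the zeros of F exceeds
    N, and at positive values y of F the product (1 + N y)(1 - y/B)^(2n) is less than one.\<close>
  obtain n :: nat where n: "N * B < real n" using reals_Archimedean2 by blast
  obtain t where t: "(1 - Const (1 / B) * F) ^ n = 1 - F * t" using geometric_factor by metis
  obtain \<kappa> where \<kappa>: "(1 - Const (1 / B) * F) ^ (2 * n) = 1 - F * \<kappa>"
    "\<And>x. eval F x = 0 \<Longrightarrow> eval \<kappa> x = real (2 * n) * (1 / B)" using geometric_factor by metis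
  let ?\<rho> = "1 - F * t"
  have \<rho>2: "?\<rho> ^ 2 = 1 - F * \<kappa>"
    unfolding t[symmetric] \<kappa>(1)[symmetric] by (simp add: power_mult[symmetric] mult.commute)
  \<comment> \<open>Determined by \<rho>^2 (F + N F^2) + \<tau> F^2 = F. Since it is positive on
    \<open>S\<close>, the matrix theorem applies to it as a matrix of size one.\<close>
  define \<tau> where "\<tau> = \<kappa> - Const N + Const N * F * \<kappa>"
  have "0 < eval \<tau> x" if x: "x \<in> S" for x
  proof (cases "eval F x = 0")
    case True
    have "N * B < real (2 * n)" using n N(1) B(1) by simp
    then have "N < real (2 * n) * (1 / B)" using B(1) by (simp add: field_simps)
    then show ?thesis using \<kappa>(2)[OF True] True by (simp add: \<tau>_def)
  next
    case False
    define y where "y = eval F x"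
    have y: "0 < y" "y \<le> B" using False nonneg[OF x] B(2)[OF x] by (auto simp: y_def)
    have "y * eval \<tau> x = 1 - (1 + N * y) * (1 - y * eval \<kappa> x)"
      by (simp add: \<tau>_def y_def algebra_simps)
    also have "1 - y * eval \<kappa> x = (1 - y / B) ^ (2 * n)"
      using arg_cong[OF \<kappa>(1), of "\<lambda>p. eval p x"] by (simp add: y_def)
    finally have e: "y * eval \<tau> x = 1 - (1 + N * y) * (1 - y / B) ^ (2 * n)" .
    have "(1 + N * y) * (1 - y / B) ^ (2 * n) < 1"
    proof (cases "y = B")
      case True
      have "0 < n" using n N(1) B(1) by (cases n) (auto simp: mult_less_0_iff)
      then show ?thesis using True B(1) by (simp add: power_0_left)
    next
      case False
      have pos: "0 < (1 - y / B) ^ (2 * n)"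
        using False y B(1) by (intro zero_less_power) (simp add: field_simps)
      have "N * B * y < real (2 * n) * y"
        using n N(1) B(1) y by (intro mult_strict_right_mono) auto
      then have "1 + N * y < 1 + real (2 * n) * (y / B)"
        using B(1) by (simp add: field_simps)
      then have "(1 + N * y) * (1 - y / B) ^ (2 * n)
          < (1 + real (2 * n) * (y / B)) * (1 - y / B) ^ (2 * n)"
        using pos by (rule mult_strict_right_mono)
      also have "\<dots> \<le> 1"
        using power_one_minus_le[of "y / B" "2 * n"] y B(1) by (simp add: mult.commute)
      finally show ?thesis .
    qed
    then have "0 < y * eval \<tau> x" unfolding e by simp
    then show ?thesis using y(1) by (simp add: zero_less_mult_iff)
  qed
  note \<tau>_pos = this
  have "\<exists>e>0. (\<Sum>i\<in>(UNIV :: unit set). \<Sum>j\<in>(UNIV :: unit set). \<tau> * F * F) - Const e * (\<Sum>i\<in>(UNIV :: unit set). F ^ 2) \<in> M"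
  proof (rule M_pos_def)
    fix x :: "real ^ 'v" and v :: "real ^ unit" assume "x \<in> S" "v \<noteq> 0"
    then have "0 < eval \<tau> x * (v $ ()) ^ 2"
      using \<tau>_pos by (auto simp: vec_eq_iff)
    then show "0 < (\<Sum>i\<in>UNIV. \<Sum>j\<in>UNIV. eval \<tau> x * v $ i * v $ j)"
      by (simp add: UNIV_unit power2_eq_square mult.assoc)
  qed
  then obtain e2 where e2: "0 < e2" "\<tau> * F * F - Const e2 * F ^ 2 \<in> M"
    by (auto simp: UNIV_unit)
  define e where "e = min e1 e2"
  have e: "0 < e" "0 \<le> e1 - e" "0 \<le> e2 - e" using e1 e2 by (auto simp: e_def)
  have "?\<rho> ^ 2 * (F + Const N * F ^ 2 - Const e1 * ?m2) + (\<tau> * F * F - Const e2 * F ^ 2)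
      + (Const (e1 - e) * (?\<rho> ^ 2 * ?m2) + Const (e2 - e) * F ^ 2) \<in> M"
    using e by (intro qmod_add qmod_mult[OF T_square G] e2 qmod_SOS SOS_add SOS_mult[OF SOS_Const]
        SOS_mult[OF SOS_square] SOS_sum) auto
  also have "?\<rho> ^ 2 * (F + Const N * F ^ 2 - Const e1 * ?m2) + (\<tau> * F * F - Const e2 * F ^ 2)
      + (Const (e1 - e) * (?\<rho> ^ 2 * ?m2) + Const (e2 - e) * F ^ 2)
    = F - Const e * (?\<rho> ^ 2 * ?m2 + F ^ 2)"
  proof -
    have "?\<rho> ^ 2 * (F + Const N * F ^ 2) + \<tau> * F * F = F"
      unfolding \<rho>2 \<tau>_def by (simp add: power2_eq_square algebra_simps)
    moreover have "a * (b - d * c) + (f - g) + ((d - h) * (a * c) + k) = (a * b + f) - g + k - h * (a * c)"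
      for a b c d f g h k :: "'v mpoly" by (simp add: algebra_simps)
    ultimately show ?thesis
      by (simp only: Const_diff) (simp add: algebra_simps)
  qed
  also have "?\<rho> ^ 2 * ?m2 = (\<Sum>i\<in>UNIV. (m i * ?\<rho>) ^ 2)"
    by (simp add: power_mult_distrib sum_distrib_right mult.commute)
  finally show ?thesis using e(1) by blast
qed

end

section \<open>Interpolation at finitely many points\<close>

text \<open>Each condition on \<open>a\<close> excludes a hyperplane, and finitely many hyperplanes
  do not cover the space. The nonzero coefficient allows the variable at \<open>i\<^sub>0\<close> to
  be expressed through the linear form and the other variables.\<close>

lemma separating_linear_form:
  fixes Z :: "(real ^ 'v::finite) set"
  assumes "finite Z"
  shows "\<exists>a :: real ^ 'v. a $ i\<^sub>0 \<noteq> 0 \<and> inj_on (\<lambda>u. a \<bullet> u) Z"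
proof -
  define D where "D = {w. \<exists>u\<in>Z. \<exists>u'\<in>Z. u \<noteq> u' \<and> w = u - u'}"
  have "D \<subseteq> (\<lambda>(u, u'). u - u') ` (Z \<times> Z)" by (auto simp: D_def)
  then have "finite D" by (rule finite_subset) (use assms in auto)
  have "negligible (\<Union>w\<in>insert (axis i\<^sub>0 1) D. {x. w \<bullet> x = 0})"
    using \<open>finite D\<close>
    by (intro negligible_Union finite_imageI) (auto intro!: negligible_hyperplane simp: D_def axis_eq_0_iff)
  then obtain a where "a \<notin> (\<Union>w\<in>insert (axis i\<^sub>0 1) D. {x. w \<bullet> x = 0})"
    using non_negligible_UNIV by (metis UNIV_eq_I)
  then have a: "axis i\<^sub>0 1 \<bullet> a \<noteq> 0" "\<And>w. w \<in> D \<Longrightarrow> w \<bullet> a \<noteq> 0" by auto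
  have "inj_on (\<lambda>u. a \<bullet> u) Z"
  proof (rule inj_onI, rule ccontr)
    fix u u' assume *: "u \<in> Z" "u' \<in> Z" "a \<bullet> u = a \<bullet> u'" "u \<noteq> u'"
    then have "u - u' \<in> D" by (auto simp: D_def)
    from a(2)[OF this] show False using *(3) by (simp add: inner_commute[of _ a] inner_diff_right)
  qed
  then show ?thesis using a(1) by (intro exI[of _ a]) (auto simp: inner_axis')
qed

text \<open>An identity of polynomials, not only of values at the nodes. For a new node z, write P_c
  for the product without c and P for the full product over X; then (l - h z) P_c - P = (h c - h z)
  P_c, which explains the quotients in \<open>k'\<close>.\<close>

lemma lagrange_partition_of_unity:
  fixes l :: "'v::finite mpoly" and h :: "'b \<Rightarrow> real"
  assumes "finite X" "X \<noteq> {}" "inj_on h X"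
  shows "\<exists>k. (\<Sum>c\<in>X. Const (k c) * (\<Prod>c'\<in>X - {c}. l - Const (h c'))) = 1"
  using assms
proof (induction X rule: finite_ne_induct)
  case (singleton x)
  then show ?case by (intro exI[of _ "\<lambda>_. 1"]) simp
next
  case (insert z X)
  then obtain k where k: "(\<Sum>c\<in>X. Const (k c) * (\<Prod>c'\<in>X - {c}. l - Const (h c'))) = 1"
    by (auto simp: inj_on_insert)
  define P where "P c = (\<Prod>c'\<in>X - {c}. l - Const (h c'))" for c
  define PX where "PX = (\<Prod>c'\<in>X. l - Const (h c'))"
  define k' where "k' c = (if c = z then - (\<Sum>c\<in>X. k c / (h c - h z)) else k c / (h c - h z))" for c
  have PXc: "PX = (l - Const (h c)) * P c" if "c \<in> X" for c
    unfolding PX_def P_def using that insert.hyps(1) by (rule prod.remove[rotated])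
  have neq: "h c \<noteq> h z" if "c \<in> X" for c
    using insert.prems insert.hyps that by (metis inj_on_eq_iff insertCI)
  have eq: "Const (k c / (h c - h z)) * ((l - Const (h z)) * P c - PX) = Const (k c) * P c"
    if c: "c \<in> X" for c
  proof -
    have "(l - Const (h z)) * P c - PX = Const (h c - h z) * P c"
      unfolding PXc[OF c] Const_diff by (simp add: algebra_simps)
    moreover have "Const (k c / (h c - h z)) * (Const (h c - h z) * P c) = Const (k c) * P c"
      using neq[OF c] by (simp add: mult.assoc[symmetric] Const_mult[symmetric])
    ultimately show ?thesis by simp
  qed
  have Pz: "(\<Prod>c'\<in>insert z X - {c}. l - Const (h c')) = (l - Const (h z)) * P c" if c: "c \<in> X" for c
  proof -
    have "insert z X - {c} = insert z (X - {c})" using c insert.hyps by auto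
    then show ?thesis using insert.hyps by (simp add: P_def)
  qed
  have "(\<Sum>c\<in>insert z X. Const (k' c) * (\<Prod>c'\<in>insert z X - {c}. l - Const (h c')))
    = Const (k' z) * PX + (\<Sum>c\<in>X. Const (k' c) * (\<Prod>c'\<in>insert z X - {c}. l - Const (h c')))"
    using insert.hyps by (simp add: PX_def)
  also have "(\<Sum>c\<in>X. Const (k' c) * (\<Prod>c'\<in>insert z X - {c}. l - Const (h c')))
      = (\<Sum>c\<in>X. Const (k c / (h c - h z)) * ((l - Const (h z)) * P c))"
    using insert.hyps by (intro sum.cong refl) (auto simp: Pz k'_def)
  also have "Const (k' z) * PX = - (\<Sum>c\<in>X. Const (k c / (h c - h z)) * PX)"
    by (simp add: k'_def Const_uminus Const_sum sum_distrib_right)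
  also have "\<dots> + (\<Sum>c\<in>X. Const (k c / (h c - h z)) * ((l - Const (h z)) * P c))
      = (\<Sum>c\<in>X. Const (k c / (h c - h z)) * ((l - Const (h z)) * P c - PX))"
    by (simp add: right_diff_distrib sum_subtractf)
  also have "\<dots> = (\<Sum>c\<in>X. Const (k c) * P c)" by (intro sum.cong refl eq)
  also have "\<dots> = 1" using k by (simp add: P_def)
  finally show ?case by blast
qed

lemma jet1_zero_direction [simp]: "jet1 p u 0 = 0"
  by (induction p rule: mpoly_induct) simp_all

definition ideal_gen :: "('i::finite \<Rightarrow> 'v::finite mpoly) \<Rightarrow> 'v mpoly set" where
  "ideal_gen m = {\<Sum>i\<in>UNIV. m i * b i | b. True}"

lemma ideal_gen_add: "p \<in> ideal_gen m \<Longrightarrow> r \<in> ideal_gen m \<Longrightarrow> p + r \<in> ideal_gen m"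
proof -
  assume "p \<in> ideal_gen m" "r \<in> ideal_gen m"
  then obtain b c where "p = (\<Sum>i\<in>UNIV. m i * b i)" "r = (\<Sum>i\<in>UNIV. m i * c i)"
    by (auto simp: ideal_gen_def)
  then have "p + r = (\<Sum>i\<in>UNIV. m i * (b i + c i))" by (simp add: distrib_left sum.distrib)
  then show ?thesis by (auto simp: ideal_gen_def)
qed

lemma ideal_gen_mult: "p \<in> ideal_gen m \<Longrightarrow> r * p \<in> ideal_gen m"
proof -
  assume "p \<in> ideal_gen m"
  then obtain b where "p = (\<Sum>i\<in>UNIV. m i * b i)" by (auto simp: ideal_gen_def)
  then have "r * p = (\<Sum>i\<in>UNIV. m i * (r * b i))" by (simp add: sum_distrib_left mult_ac)
  then show ?thesis by (auto simp: ideal_gen_def)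
qed

lemma ideal_gen_gen: "m i \<in> ideal_gen m"
proof -
  have "m i = (\<Sum>j\<in>UNIV. m j * (if j = i then 1 else 0))"
    by (simp add: if_distrib[of "\<lambda>r. _ * r"] sum.delta cong: if_cong)
  then show ?thesis by (auto simp: ideal_gen_def)
qed

lemma ideal_gen_0 [simp]: "0 \<in> ideal_gen m"
  using ideal_gen_mult[OF ideal_gen_gen, of 0] by simp

lemma ideal_gen_sum: "(\<And>a. a \<in> X \<Longrightarrow> f a \<in> ideal_gen m) \<Longrightarrow> sum f X \<in> ideal_gen m"
  by (induction X rule: infinite_finite_induct) (auto simp: ideal_gen_add)

text \<open>The generators are those of the shape lemma: after a generic linear form \<open>l\<close> separates the points,
  one generator is a univariate polynomial in \<open>l\<close> and the others express the remaining
  coordinates through \<open>l\<close>.  Thus there are exactly as many generators as variables, and their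
  differentials at the points are linearly independent.\<close>

theorem vanishing_ideal_generators:
  fixes Z :: "(real ^ 'v::finite) set"
  assumes "finite Z" "Z \<noteq> {}"
  obtains m :: "'v \<Rightarrow> 'v mpoly" and L :: "real ^ 'v \<Rightarrow> 'v mpoly" where
    "\<And>u i. u \<in> Z \<Longrightarrow> eval (m i) u = 0"
    "\<And>u y. u \<in> Z \<Longrightarrow> \<exists>v. \<forall>i. jet1 (m i) u v = y i"
    "\<And>p. (\<And>u. u \<in> Z \<Longrightarrow> eval p u = 0) \<Longrightarrow> p \<in> ideal_gen m"
    "\<And>u u'. u \<in> Z \<Longrightarrow> u' \<in> Z \<Longrightarrow> eval (L u) u' = (if u = u' then 1 else 0)"
proof -
  obtain i0 :: 'v where True by blast
  obtain a :: "real ^ 'v" where a: "a $ i0 \<noteq> 0" "inj_on (\<lambda>u. a \<bullet> u) Z"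
    using separating_linear_form[OF assms(1)] by blast
  define l where "l = (\<Sum>i\<in>UNIV. Const (a $ i) * Var i)"
  have l_eval: "eval l u = a \<bullet> u" and l_jet: "jet1 l u v = a \<bullet> v" for u v
    by (simp_all add: l_def inner_vec_def)
  define P where "P u = (\<Prod>u'\<in>Z - {u}. l - Const (a \<bullet> u'))" for u
  obtain k where k: "(\<Sum>u\<in>Z. Const (k u) * P u) = 1"
    using lagrange_partition_of_unity[OF assms a(2)] by (auto simp: P_def)
  define L where "L u = Const (k u) * P u" for u
  have sumL: "sum L Z = 1" using k by (simp add: L_def)
  define ms where "ms = (\<Prod>u\<in>Z. l - Const (a \<bullet> u))"
  have ms: "ms = (l - Const (a \<bullet> u)) * P u" if "u \<in> Z" for u
    unfolding ms_def P_def using that assms(1) by (rule prod.remove[rotated])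
  define m where "m i = (if i = i0 then ms else Var i - (\<Sum>u\<in>Z. Const (u $ i) * L u))" for i
  have L0: "eval (L u) u' = 0" if "u \<noteq> u'" "u' \<in> Z" for u u'
    using that assms(1) by (auto simp: L_def P_def l_eval)
  have L1: "eval (L u) u = 1" if "u \<in> Z" for u
  proof -
    have "1 = eval (sum L Z) u" by (simp add: sumL)
    also have "\<dots> = (\<Sum>u'\<in>Z. if u' = u then eval (L u) u else 0)"
      unfolding eval_sum by (intro sum.cong) (auto simp: L0 that)
    also have "\<dots> = eval (L u) u" using that assms(1) by simp
    finally show ?thesis by simp
  qed
  have sum_delta: "(\<Sum>u'\<in>Z. f u' * eval (L u') u) = f u" if "u \<in> Z" for f u
  proof -
    have "(\<Sum>u'\<in>Z. f u' * eval (L u') u) = (\<Sum>u'\<in>Z. if u' = u then f u else 0)"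
      by (intro sum.cong) (auto simp: L0 L1 that)
    then show ?thesis using that assms(1) by simp
  qed
  have m0: "eval (m i) u = 0" if "u \<in> Z" for u i
  proof (cases "i = i0")
    case True
    then show ?thesis using that ms[OF that] by (simp add: m_def l_eval)
  qed (use that in \<open>simp add: m_def sum_delta\<close>)
  have P_nz: "eval (P u) u \<noteq> 0" if "u \<in> Z" for u
    using L1[OF that] by (auto simp: L_def)
  have jetP: "\<exists>\<theta>. \<forall>v. jet1 (\<Prod>u'\<in>X. l - Const (a \<bullet> u')) u v = \<theta> * (a \<bullet> v)" for X u
  proof (induction X rule: infinite_finite_induct)
    case (insert x X)
    then obtain \<theta> where "\<forall>v. jet1 (\<Prod>u'\<in>X. l - Const (a \<bullet> u')) u v = \<theta> * (a \<bullet> v)" by blast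
    with insert.hyps show ?case
      by (intro exI[of _ "(a \<bullet> u - a \<bullet> x) * \<theta> + (\<Prod>u'\<in>X. a \<bullet> u - a \<bullet> u')"])
        (simp add: l_eval l_jet algebra_simps)
  qed (auto intro!: exI[of _ 0])
  have jet_sur: "\<exists>v. \<forall>i. jet1 (m i) u v = y i" if u: "u \<in> Z" for u y
  proof -
    have "\<forall>i. \<exists>\<theta>. \<forall>v. jet1 (\<Sum>u\<in>Z. Const (u $ i) * L u) u v = \<theta> * (a \<bullet> v)"
    proof
      fix i
      have "\<forall>u'. \<exists>\<theta>. \<forall>v. jet1 (Const (u' $ i) * L u') u v = \<theta> * (a \<bullet> v)"
      proof
        fix u'
        obtain \<theta> where "\<forall>v. jet1 (P u') u v = \<theta> * (a \<bullet> v)"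
          using jetP[of "Z - {u'}" u] by (auto simp: P_def)
        then show "\<exists>\<theta>. \<forall>v. jet1 (Const (u' $ i) * L u') u v = \<theta> * (a \<bullet> v)"
          by (intro exI[of _ "u' $ i * k u' * \<theta>"]) (simp add: L_def)
      qed
      then obtain \<theta> where "\<And>u' v. jet1 (Const (u' $ i) * L u') u v = \<theta> u' * (a \<bullet> v)" by metis
      then show "\<exists>\<theta>. \<forall>v. jet1 (\<Sum>u\<in>Z. Const (u $ i) * L u) u v = \<theta> * (a \<bullet> v)"
        by (intro exI[of _ "sum \<theta> Z"]) (simp add: sum_distrib_right)
    qed
    then obtain \<theta> where \<theta>: "\<And>i v. jet1 (\<Sum>u\<in>Z. Const (u $ i) * L u) u v = \<theta> i * (a \<bullet> v)" by metis
    \<comment> \<open>The generator \<open>ms\<close> forces a \<bullet> v = s, the other generators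
      then force the coordinates w, and the coordinate at \<open>i0\<close> is solved from a
      \<bullet> v = s.\<close>
    define s where "s = y i0 / eval (P u) u"
    define w where "w i = y i + \<theta> i * s" for i
    define v :: "real ^ 'v" where
      "v = (\<chi> i. if i = i0 then (s - (\<Sum>j\<in>UNIV - {i0}. a $ j * w j)) / a $ i0 else w i)"
    have av: "a \<bullet> v = s"
    proof -
      have "a \<bullet> v = a $ i0 * v $ i0 + (\<Sum>j\<in>UNIV - {i0}. a $ j * v $ j)"
        unfolding inner_vec_def by (subst sum.remove[of UNIV i0]) auto
      also have "(\<Sum>j\<in>UNIV - {i0}. a $ j * v $ j) = (\<Sum>j\<in>UNIV - {i0}. a $ j * w j)"
        by (intro sum.cong) (auto simp: v_def)
      finally show ?thesis using a(1) by (simp add: v_def)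
    qed
    have "jet1 (m i) u v = y i" for i
    proof (cases "i = i0")
      case True
      have "jet1 ms u v = s * eval (P u) u"
        unfolding ms[OF u] by (simp add: l_eval l_jet av)
      then show ?thesis using True P_nz[OF u] by (simp add: m_def s_def)
    next
      case False
      then show ?thesis by (simp add: m_def \<theta> av del: jet_sum) (simp add: v_def w_def)
    qed
    then show ?thesis by blast
  qed
  have ms_J: "ms \<in> ideal_gen m"
    using ideal_gen_gen[of m i0] by (simp add: m_def)
  have lL: "(l - Const (a \<bullet> u)) * L u \<in> ideal_gen m" if "u \<in> Z" for u
  proof -
    have "(l - Const (a \<bullet> u)) * L u = Const (k u) * ms"
      unfolding ms[OF that] L_def by (simp add: mult_ac)
    then show ?thesis by (simp add: ideal_gen_mult ms_J)
  qed
  have LL: "L u' * L u \<in> ideal_gen m" if "u \<in> Z" "u' \<in> Z" "u \<noteq> u'" for u u'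
  proof -
    have "P u' = (l - Const (a \<bullet> u)) * (\<Prod>w\<in>Z - {u'} - {u}. l - Const (a \<bullet> w))"
      unfolding P_def using that assms(1) by (intro prod.remove) auto
    then have "L u' * L u = (Const (k u') * (\<Prod>w\<in>Z - {u'} - {u}. l - Const (a \<bullet> w))) * ((l - Const (a \<bullet> u)) * L u)"
      by (simp add: L_def[of u'] mult_ac)
    then show ?thesis using lL[OF that(1)] by (simp add: ideal_gen_mult)
  qed
  have varL: "(Var i - Const (u $ i)) * L u \<in> ideal_gen m" if u: "u \<in> Z" and i: "i \<noteq> i0" for u i
  proof -
    have "Const (u $ i) = (\<Sum>u'\<in>Z. Const (u $ i) * L u')"
      by (simp add: sum_distrib_left[symmetric] sumL)
    then have "Var i - Const (u $ i) = m i + (\<Sum>u'\<in>Z. (Const (u' $ i) - Const (u $ i)) * L u')"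
      using i by (simp add: m_def left_diff_distrib sum_subtractf)
    then have "(Var i - Const (u $ i)) * L u
        = L u * m i + (\<Sum>u'\<in>Z. (Const (u' $ i) - Const (u $ i)) * (L u' * L u))"
      by (simp add: distrib_right distrib_left sum_distrib_right sum_distrib_left mult_ac)
    moreover have "(Const (u' $ i) - Const (u $ i)) * (L u' * L u) \<in> ideal_gen m" if "u' \<in> Z" for u'
      using LL[OF u that] by (cases "u = u'") (auto intro: ideal_gen_mult)
    ultimately show ?thesis
      by (simp add: ideal_gen_add ideal_gen_sum ideal_gen_mult ideal_gen_gen)
  qed
  have varL0: "(Var i0 - Const (u $ i0)) * L u \<in> ideal_gen m" if u: "u \<in> Z" for u
  proof -
    have "l - Const (a \<bullet> u) = (\<Sum>i\<in>UNIV. Const (a $ i) * (Var i - Const (u $ i)))"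
      by (simp add: l_def inner_vec_def Const_sum Const_mult right_diff_distrib sum_subtractf)
    also have "\<dots> = Const (a $ i0) * (Var i0 - Const (u $ i0))
        + (\<Sum>i\<in>UNIV - {i0}. Const (a $ i) * (Var i - Const (u $ i)))"
      by (rule sum.remove) auto
    finally have "Const (a $ i0) * (Var i0 - Const (u $ i0))
        = l - Const (a \<bullet> u) - (\<Sum>i\<in>UNIV - {i0}. Const (a $ i) * (Var i - Const (u $ i)))"
      by (simp add: algebra_simps)
    then have "Const (a $ i0) * (Var i0 - Const (u $ i0)) * L u
        = (l - Const (a \<bullet> u)) * L u
          + (\<Sum>i\<in>UNIV - {i0}. Const (- (a $ i)) * ((Var i - Const (u $ i)) * L u))"
      by (simp add: Const_uminus left_diff_distrib sum_distrib_right sum_negf mult.assoc)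
    also have "\<dots> \<in> ideal_gen m"
      by (intro ideal_gen_add ideal_gen_sum ideal_gen_mult lL varL u) auto
    finally have "Const (inverse (a $ i0)) * (Const (a $ i0) * (Var i0 - Const (u $ i0)) * L u) \<in> ideal_gen m"
      by (rule ideal_gen_mult)
    moreover have "Const (inverse (a $ i0)) * (Const (a $ i0) * p * L u) = p * L u" for p
      using a(1) Const_mult_inverse[of "inverse (a $ i0)" "p * L u"] by (simp add: mult.assoc)
    ultimately show ?thesis by simp
  qed
  \<comment> \<open>Modulo the ideal, multiplying by \<open>L u\<close> amounts to evaluating at
    \<open>u\<close>. With the partition of unity this shows that a polynomial vanishing on
    \<open>Z\<close> is in the ideal.\<close>
  have pL: "(p - Const (eval p u)) * L u \<in> ideal_gen m" if u: "u \<in> Z" for p u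
  proof (induction p rule: mpoly_induct)
    case (Var i)
    then show ?case using varL[OF u, of i] varL0[OF u] by (cases "i = i0") auto
  next
    case (add p r)
    have "(p + r - Const (eval (p + r) u)) * L u
        = (p - Const (eval p u)) * L u + (r - Const (eval r u)) * L u"
      by (simp add: Const_add algebra_simps)
    then show ?case using add by (simp add: ideal_gen_add)
  next
    case (mult p r)
    have "(p * r - Const (eval (p * r) u)) * L u
        = p * ((r - Const (eval r u)) * L u) + Const (eval r u) * ((p - Const (eval p u)) * L u)"
      by (simp add: Const_mult algebra_simps)
    then show ?case using mult by (simp add: ideal_gen_add ideal_gen_mult)
  qed simp
  have "p \<in> ideal_gen m" if p: "\<And>u. u \<in> Z \<Longrightarrow> eval p u = 0" for p
  proof -
    have "p = p * sum L Z" by (simp add: sumL)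
    also have "\<dots> = (\<Sum>u\<in>Z. (p - Const (eval p u)) * L u)"
      by (simp add: sum_distrib_left p)
    also have "\<dots> \<in> ideal_gen m" by (intro ideal_gen_sum pL)
    finally show ?thesis .
  qed
  then show ?thesis
    using that[of m L, OF m0 jet_sur _ ] L0 L1 by (metis (full_types))
qed

text \<open>H has cofactors b with respect to \<open>m\<close>. As the differential of H vanishes on
  \<open>Z\<close> and those of \<open>m\<close> are independent, the b vanish there too and have
  cofactors A of their own. At a zero of \<open>m\<close> the second-order term of m^T A m is A
  applied to the differential of \<open>m\<close>, so its positivity passes to A.\<close>

lemma second_order_representation:
  fixes m :: "'v::finite \<Rightarrow> 'v mpoly"
  assumes m0: "\<And>u i. u \<in> Z \<Longrightarrow> eval (m i) u = 0"
    and sur: "\<And>u y. u \<in> Z \<Longrightarrow> \<exists>v. \<forall>i. jet1 (m i) u v = y i"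
    and gen: "\<And>p. (\<And>u. u \<in> Z \<Longrightarrow> eval p u = 0) \<Longrightarrow> p \<in> ideal_gen m"
    and H0: "\<And>u. u \<in> Z \<Longrightarrow> eval H u = 0" and H1: "\<And>u v. u \<in> Z \<Longrightarrow> jet1 H u v = 0"
    and H2: "\<And>u v. u \<in> Z \<Longrightarrow> v \<noteq> 0 \<Longrightarrow> 0 < jet2 H u v"
  obtains A where "H = qform A m"
    "\<And>u (y :: real ^ 'v). u \<in> Z \<Longrightarrow> y \<noteq> 0 \<Longrightarrow>
      0 < qform (\<lambda>i j. eval (A i j) u) (($) y)"
proof -
  obtain b where b: "H = (\<Sum>i\<in>UNIV. m i * b i)"
    using gen[OF H0] by (auto simp: ideal_gen_def)
  have b0: "eval (b i) u = 0" if u: "u \<in> Z" for u i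
  proof -
    obtain v where v: "\<And>j. jet1 (m j) u v = (if j = i then 1 else 0)"
      using sur[OF u, of "\<lambda>j. if j = i then 1 else 0"] by blast
    have "jet1 H u v = (\<Sum>j\<in>UNIV. jet1 (m j) u v * eval (b j) u)"
      unfolding b by (simp add: m0[OF u])
    also have "\<dots> = (\<Sum>j\<in>UNIV. if j = i then eval (b i) u else 0)"
      by (intro sum.cong) (auto simp: v)
    finally show ?thesis using H1[OF u] by simp
  qed
  have "\<forall>i. \<exists>c. b i = (\<Sum>j\<in>UNIV. m j * c j)"
    using gen[OF b0] by (auto simp: ideal_gen_def)
  then obtain A where A: "\<And>i. b i = (\<Sum>j\<in>UNIV. m j * A i j)" by metis
  show ?thesis
  proof
    show "H = qform A m"
      unfolding b A by (simp add: sum_distrib_left mult_ac)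
    fix u and y :: "real ^ 'v" assume u: "u \<in> Z" and y: "y \<noteq> 0"
    obtain v where v: "\<And>i. jet1 (m i) u v = y $ i" using sur[OF u, of "\<lambda>i. y $ i"] by blast
    have "v \<noteq> 0"
    proof
      assume "v = 0"
      then have "y $ i = 0" for i using v[of i] by simp
      then show False using y by (simp add: vec_eq_iff)
    qed
    have "jet2 H u v = (\<Sum>i\<in>UNIV. y $ i * jet1 (b i) u v)"
      unfolding b by (simp add: m0[OF u] b0[OF u] v)
    also have "\<dots> = qform (\<lambda>i j. eval (A i j) u) (($) y)"
      unfolding A by (simp add: m0[OF u] v sum_distrib_left mult_ac)
    finally show "0 < qform (\<lambda>i j. eval (A i j) u) (($) y)"
      using H2[OF u \<open>v \<noteq> 0\<close>] by simp
  qed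
qed

section \<open>Gradients, Hessians and Lagrange multipliers\<close>

text \<open>The partial derivatives are obtained as polynomials, which yields continuity and
  differentiability of the gradient at once.\<close>

lemma eval_has_derivative:
  fixes p :: "'v::finite mpoly"
  shows "\<exists>P. \<forall>x. (eval p has_derivative (\<lambda>v. \<Sum>i\<in>UNIV. v $ i * eval (P i) x)) (at x)"
proof (induction p rule: mpoly_induct)
  case (Const a)
  have "(eval (Const a) :: real ^ 'v \<Rightarrow> real) = (\<lambda>_. a)" by (rule ext) simp
  then show ?case by (intro exI[of _ "\<lambda>_. 0"]) simp
next
  case (Var i)
  have "(eval (Var i) :: real ^ 'v \<Rightarrow> real) = (\<lambda>x. x $ i)" by (rule ext) simp
  moreover have "((\<lambda>x. x $ i) has_derivative (\<lambda>v. v $ i)) (at x)" for x :: "real ^ 'v"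
    by (intro bounded_linear.has_derivative[OF bounded_linear_vec_nth] has_derivative_ident)
  ultimately show ?case
    by (intro exI[of _ "\<lambda>j. if j = i then 1 else 0"])
      (simp add: if_distrib[of "\<lambda>p. eval p _"] if_distrib[of "\<lambda>r. _ * r"] cong: if_cong)
next
  case (add p r)
  then obtain P R where *: "\<And>x. (eval p has_derivative (\<lambda>v. \<Sum>i\<in>UNIV. v $ i * eval (P i) x)) (at x)"
    "\<And>x. (eval r has_derivative (\<lambda>v. \<Sum>i\<in>UNIV. v $ i * eval (R i) x)) (at x)" by blast
  have e: "eval (p + r) = (\<lambda>x. eval p x + eval r x)" by (rule ext) simp
  show ?case
    by (rule exI[of _ "\<lambda>i. P i + R i"])
      (auto simp: e distrib_left sum.distrib intro!: has_derivative_add *)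
next
  case (mult p r)
  then obtain P R where *: "\<And>x. (eval p has_derivative (\<lambda>v. \<Sum>i\<in>UNIV. v $ i * eval (P i) x)) (at x)"
    "\<And>x. (eval r has_derivative (\<lambda>v. \<Sum>i\<in>UNIV. v $ i * eval (R i) x)) (at x)" by blast
  have e: "eval (p * r) = (\<lambda>x. eval p x * eval r x)" by (rule ext) simp
  have "(\<lambda>v. \<Sum>i\<in>UNIV. v $ i * eval (p * R i + P i * r) x)
      = (\<lambda>v. eval p x * (\<Sum>i\<in>UNIV. v $ i * eval (R i) x) + (\<Sum>i\<in>UNIV. v $ i * eval (P i) x) * eval r x)" for x
    by (rule ext) (simp add: sum_distrib_left sum_distrib_right sum.distrib algebra_simps)
  then show ?case
    using has_derivative_mult[OF * ] by (intro exI[of _ "\<lambda>i. p * R i + P i * r"]) (simp add: e)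
qed

lemma grad_eqI:
  assumes "GDERIV f x :> D" shows "grad f x = D"
  unfolding grad_def
proof (rule the_equality)
  show "GDERIV f x :> D" by (rule assms)
  fix D' assume "GDERIV f x :> D'"
  then have "(\<lambda>h. h \<bullet> D') = (\<lambda>h. h \<bullet> D)"
    using assms unfolding gderiv_def by (rule has_derivative_unique)
  then have "(D' - D) \<bullet> D' = (D' - D) \<bullet> D" by metis
  then have "(D' - D) \<bullet> (D' - D) = 0" by (simp add: inner_diff_right[of "D' - D" D' D])
  then show "D' = D" by simp
qed

lemma grad_eval:
  obtains P where "\<And>x. grad (eval p) x = (\<chi> i. eval (P i) x)"
    "\<And>x. (eval p has_derivative (\<lambda>v. v \<bullet> grad (eval p) x)) (at x)"
proof -
  obtain P where P: "\<And>x. (eval p has_derivative (\<lambda>v. \<Sum>i\<in>UNIV. v $ i * eval (P i) x)) (at x)"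
    using eval_has_derivative by blast
  have "GDERIV (eval p) x :> (\<chi> i. eval (P i) x)" for x
    unfolding gderiv_def using P[of x] by (simp add: inner_vec_def)
  then have g: "grad (eval p) x = (\<chi> i. eval (P i) x)" for x by (rule grad_eqI)
  show ?thesis by (rule that[OF g]) (use P in \<open>simp add: g inner_vec_def\<close>)
qed

lemma eval_has_grad: "(eval p has_derivative (\<lambda>v. v \<bullet> grad (eval p) x)) (at x)"
  by (rule grad_eval[of p])

lemma continuous_on_grad_eval: "continuous_on A (grad (eval p))"
proof -
  obtain P where "\<And>x. grad (eval p) x = (\<chi> i. eval (P i) x)"
    by (rule grad_eval[of p]) blast
  then have "grad (eval p) = (\<lambda>x. \<chi> i. eval (P i) x)" by blast
  then show ?thesis by (auto intro!: continuous_on_vec_lambda continuous_intros)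
qed

lemma grad_eval_differentiable: "grad (eval p) differentiable (at x)"
proof -
  obtain P where P: "\<And>x. grad (eval p) x = (\<chi> i. eval (P i) x)"
    by (rule grad_eval[of p]) blast
  have "grad (eval p) = (\<lambda>x. \<Sum>i\<in>UNIV. eval (P i) x *\<^sub>R axis i 1)"
    by (rule ext) (simp add: P vec_eq_iff axis_def if_distrib[of "\<lambda>r. _ * r"] cong: if_cong)
  moreover have "eval (P i) differentiable (at x)" for i
    using eval_has_grad differentiable_def by blast
  ultimately show ?thesis by simp
qed

lemma line_derivative:
  "((\<lambda>t. eval p (u + t *\<^sub>R v)) has_real_derivative v \<bullet> grad (eval p) (u + t *\<^sub>R v)) (at t)"
proof -
  have "((\<lambda>t. u + t *\<^sub>R v) has_derivative (\<lambda>h. h *\<^sub>R v)) (at t)"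
    by (auto intro!: derivative_eq_intros)
  from has_derivative_compose[OF this eval_has_grad]
  show ?thesis by (simp add: has_field_derivative_def mult.commute[of _ "v \<bullet> _"] mult_commute_abs)
qed

lemma grad_line: "v \<bullet> grad (eval p) (u + t *\<^sub>R v) = poly (pderiv (line p u v)) t"
proof -
  have "(\<lambda>t. eval p (u + t *\<^sub>R v)) = poly (line p u v)" by (rule ext) (simp add: poly_line)
  then have "(poly (line p u v) has_real_derivative v \<bullet> grad (eval p) (u + t *\<^sub>R v)) (at t)"
    using line_derivative[of p u v t] by simp
  from DERIV_unique[OF this poly_DERIV] show ?thesis .
qed

lemma jet1_grad: "jet1 p u v = v \<bullet> grad (eval p) u"
  using grad_line[of v p u 0] by (simp add: jet1_def poly_0_coeff_0 coeff_pderiv)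

lemma jet2_hessian: "v \<bullet> (hessian (eval p) u *v v) = 2 * jet2 p u v"
proof -
  have D: "(grad (eval p) has_derivative (\<lambda>h. hessian (eval p) u *v h)) (at u)"
    using grad_eval_differentiable[of p u] unfolding jacobian_works hessian_def .
  have "((\<lambda>t. u + t *\<^sub>R v) has_derivative (\<lambda>h. h *\<^sub>R v)) (at 0)"
    by (auto intro!: derivative_eq_intros)
  from has_derivative_compose[OF this, of "grad (eval p)" "\<lambda>h. hessian (eval p) u *v h"] D
  have "((\<lambda>t. grad (eval p) (u + t *\<^sub>R v)) has_derivative (\<lambda>h. hessian (eval p) u *v (h *\<^sub>R v))) (at 0)"
    by simp
  from has_derivative_inner_right[OF this, of v]
  have "((\<lambda>t. v \<bullet> grad (eval p) (u + t *\<^sub>R v)) has_real_derivative v \<bullet> (hessian (eval p) u *v v)) (at 0)"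
    by (simp add: has_field_derivative_def matrix_vector_mult_scaleR mult_commute_abs)
  then have "(poly (pderiv (line p u v)) has_real_derivative v \<bullet> (hessian (eval p) u *v v)) (at 0)"
    by (simp add: grad_line)
  from DERIV_unique[OF this poly_DERIV] show ?thesis
    by (simp add: jet2_def poly_0_coeff_0 coeff_pderiv numeral_2_eq_2)
qed

lemma continuous_on_jet1: "continuous_on A (jet1 p u)"
  unfolding jet1_grad[abs_def] by (intro continuous_intros)

lemma continuous_on_jet2: "continuous_on A (jet2 p u)"
proof -
  have "jet2 p u = (\<lambda>v. v \<bullet> (hessian (eval p) u *v v) / 2)"
    by (rule ext) (simp add: jet2_hessian)
  moreover have "continuous_on A (\<lambda>v. hessian (eval p) u *v v)"
    by (rule linear_continuous_on) (rule matrix_vector_mul_bounded_linear)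
  ultimately show ?thesis by (simp add: continuous_intros)
qed

lemma jet_scale: "jet1 p u (s *\<^sub>R v) = s * jet1 p u v" "jet2 p u (s *\<^sub>R v) = s ^ 2 * jet2 p u v"
proof -
  show "jet1 p u (s *\<^sub>R v) = s * jet1 p u v" by (simp add: jet1_grad)
  have "2 * jet2 p u (s *\<^sub>R v) = s ^ 2 * (v \<bullet> (hessian (eval p) u *v v))"
    unfolding jet2_hessian[symmetric] by (simp add: matrix_vector_mult_scaleR power2_eq_square)
  then show "jet2 p u (s *\<^sub>R v) = s ^ 2 * jet2 p u v" by (simp add: jet2_hessian)
qed

lemma min_0_square_DERIV: "((\<lambda>t::real. (min 0 t) ^ 2) has_real_derivative 2 * min 0 t) (at t)"
proof -
  consider "t < 0" | "0 < t" | "t = 0" by linarith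
  then show ?thesis
  proof cases
    case 1
    have "((\<lambda>t::real. t ^ 2) has_real_derivative 2 * t) (at t)" by (auto intro!: derivative_eq_intros)
    then show ?thesis
      by (rule has_field_derivative_transform_within_open[where S = "{..<0}", THEN DERIV_cong])
        (use 1 in auto)
  next
    case 2
    have "((\<lambda>t::real. 0) has_real_derivative 0) (at t)" by (auto intro!: derivative_eq_intros)
    then show ?thesis
      by (rule has_field_derivative_transform_within_open[where S = "{0<..}", THEN DERIV_cong])
        (use 2 in auto)
  next
    case 3
    have "((\<lambda>h::real. (min 0 h) ^ 2 / h) \<longlongrightarrow> 0) (at 0)"
    proof (rule Lim_null_comparison)
      show "\<forall>\<^sub>F h in at 0. norm ((min 0 h) ^ 2 / h) \<le> \<bar>h\<bar>"
        by (rule always_eventually) (auto simp: min_def power2_eq_square)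
      show "((\<lambda>h::real. \<bar>h\<bar>) \<longlongrightarrow> 0) (at 0)" by (auto intro!: tendsto_eq_intros)
    qed
    then show ?thesis using 3 by (simp add: DERIV_def)
  qed
qed

text \<open>Functionals dual to the active gradients read the multipliers off a linear combination;
  by continuity they do so approximately at nearby points.\<close>

lemma dual_family:
  fixes G :: "'k \<Rightarrow> 'a::real_vector"
  assumes "inj_on G X" "independent (G ` X)"
  shows "\<exists>\<phi>. \<forall>j\<in>X. linear (\<phi> j :: 'a \<Rightarrow> real) \<and> (\<forall>i\<in>X. \<phi> j (G i) = (if i = j then 1 else 0))"
proof -
  have "\<exists>g. linear (g :: 'a \<Rightarrow> real) \<and> (\<forall>i\<in>X. g (G i) = (if i = j then 1 else 0))" if "j \<in> X" for j
  proof -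
    obtain g :: "'a \<Rightarrow> real" where "linear g" "\<forall>x\<in>G ` X. g x = (if x = G j then 1 else 0)"
      using linear_independent_extend[OF assms(2), of "\<lambda>x. if x = G j then 1 else 0"] by blast
    then show ?thesis using inj_onD[OF assms(1)] that by (intro exI[of _ g]) auto
  qed
  then show ?thesis by metis
qed

context spherical_system
begin

text \<open>Lagrange multipliers are obtained as limits of the multipliers of a quadratic penalty problem.\<close>

theorem KKT:
  assumes disj: "EQ \<inter> IN = {}" and u: "u \<in> S" and min: "\<And>x. x \<in> S \<Longrightarrow> eval F u \<le> eval F x"
    and licq: "LICQC (\<lambda>j. eval (q j)) EQ IN u"
  shows "\<exists>lam. multipliers (eval F) (\<lambda>j. eval (q j)) EQ IN u lam"
proof -
  define g where "g j = eval (q j)" for j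
  define G where "G j = grad (g j)" for j
  define act where "act = active g EQ IN u"
  have act_sub: "act \<subseteq> EQ \<union> IN" by (auto simp: act_def active_def)
  have fin_act: "finite act" by (rule finite_subset[OF act_sub]) simp
  have act0: "g j u = 0" if "j \<in> act" for j using that by (auto simp: act_def active_def)
  have EQ_act: "EQ \<subseteq> act" using u by (auto simp: act_def active_def g_def feasible_set_def)
  have "inj_on (\<lambda>j. G j u) act" "independent ((\<lambda>j. G j u) ` act)"
    using licq unfolding LICQC_def act_def G_def g_def by blast+
  from dual_family[OF this] obtain \<phi> :: "'k \<Rightarrow> real ^ 'v \<Rightarrow> real" where \<phi>: "\<And>j. j \<in> act \<Longrightarrow> linear (\<phi> j)"
    "\<And>i j. j \<in> act \<Longrightarrow> i \<in> act \<Longrightarrow> \<phi> j (G i u) = (if i = j then 1 else 0)"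
    by blast
  \<comment> \<open>The term |x - u|^2 makes \<open>u\<close> the only possible limit of the penalty
    minimizers, even if \<open>u\<close> is not an isolated minimizer.\<close>
  define \<Phi> where "\<Phi> k x = eval F x + (norm (x - u)) ^ 2 + real k * violation x" for k x
  define C where "C = cball u 1"
  have feas: "x \<in> S" if "violation x = 0" for x using that by (simp add: violation_eq_0_iff)
  have violation_u: "violation u = 0" using u by (simp add: violation_eq_0_iff)
  have "\<exists>x\<in>C. \<forall>y\<in>C. \<Phi> k x \<le> \<Phi> k y" for k
    unfolding \<Phi>_def C_def
    by (rule continuous_attains_inf) (auto intro!: continuous_intros)
  then obtain x where x: "\<And>k. x k \<in> C" "\<And>k y. y \<in> C \<Longrightarrow> \<Phi> k (x k) \<le> \<Phi> k y" by metis
  have x_lim: "x \<longlonglongrightarrow> u"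
  proof (rule tendstoI)
    fix e :: real assume e: "0 < e"
    define X where "X = C \<inter> {y. e \<le> dist y u}"
    have X: "compact X" unfolding X_def C_def
      by (intro compact_Int_closed compact_cball closed_Collect_le continuous_intros)
    have "\<exists>K0\<ge>0. \<forall>K\<ge>K0. \<forall>y\<in>X. 0 < (eval F y + (norm (y - u)) ^ 2 - eval F u) + K * violation y"
    proof (rule compact_penalty[OF X])
      fix y assume y: "y \<in> X" "violation y = 0"
      have "0 < norm (y - u)" using y(1) e by (auto simp: X_def dist_norm)
      then have "0 < (norm (y - u)) ^ 2" by simp
      then show "0 < eval F y + (norm (y - u)) ^ 2 - eval F u" using min[OF feas[OF y(2)]] by linarith
    qed (auto intro!: continuous_intros violation_nonneg)
    then obtain K0 where K0: "\<And>K y. K0 \<le> K \<Longrightarrow> y \<in> X \<Longrightarrow>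
      0 < (eval F y + (norm (y - u)) ^ 2 - eval F u) + K * violation y" by blast
    have "\<forall>\<^sub>F k in sequentially. K0 \<le> real k"
      using filterlim_real_sequentially by (simp add: filterlim_at_top)
    then show "\<forall>\<^sub>F k in sequentially. dist (x k) u < e"
    proof eventually_elim
      case (elim k)
      have "\<Phi> k (x k) \<le> \<Phi> k u" by (rule x(2)) (simp add: C_def)
      then have "x k \<notin> X" using K0[OF elim, of "x k"] by (auto simp: \<Phi>_def violation_u)
      then show ?case using x(1)[of k] by (auto simp: X_def)
    qed
  qed
  define r where "r k = grad (eval F) (x k) + 2 *\<^sub>R (x k - u)" for k
  \<comment> \<open>The coefficients in the stationarity condition of \<open>\<Phi>\<close>. For
    inequalities they are nonnegative, which survives in the limit.\<close>
  define \<mu> where "\<mu> k j = (if j \<in> EQ then - (2 * real k * g j (x k)) else - (2 * real k * min 0 (g j (x k))))" for k j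
  have gx: "(\<lambda>k. g j (x k)) \<longlonglongrightarrow> g j u" for j
    using isCont_tendsto_compose[OF isCont_eval x_lim] by (simp add: g_def)
  have Gx: "(\<lambda>k. G j (x k)) \<longlonglongrightarrow> G j u" for j
    using isCont_tendsto_compose[OF _ x_lim] continuous_on_grad_eval[of UNIV "q j"]
    by (auto simp: G_def g_def continuous_on_eq_continuous_at)
  have r_lim: "r \<longlonglongrightarrow> grad (eval F) u"
  proof -
    have "(\<lambda>k. grad (eval F) (x k)) \<longlonglongrightarrow> grad (eval F) u"
      using isCont_tendsto_compose[OF _ x_lim] continuous_on_grad_eval[of UNIV F]
      by (auto simp: continuous_on_eq_continuous_at)
    moreover have "(\<lambda>k. 2 *\<^sub>R (x k - u)) \<longlonglongrightarrow> 2 *\<^sub>R (u - u)"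
      by (intro tendsto_intros x_lim)
    ultimately show ?thesis unfolding r_def using tendsto_add by fastforce
  qed
  have stat: "r k = (\<Sum>j\<in>EQ \<union> IN. \<mu> k j *\<^sub>R G j (x k))" if k: "dist (x k) u < 1" for k
  proof -
    let ?x = "x k"
    have g': "(g j has_derivative (\<lambda>v. v \<bullet> G j y)) (at y)" for j y
      unfolding g_def G_def by (rule eval_has_grad)
    have mg: "((\<lambda>y. (min 0 (g j y)) ^ 2) has_derivative (\<lambda>v. (v \<bullet> G j ?x) * (2 * min 0 (g j ?x)))) (at ?x)" for j
      using has_derivative_compose[OF g' min_0_square_DERIV[unfolded has_field_derivative_def]]
      by (simp add: mult.commute)
    have eg: "((\<lambda>y. (g j y) ^ 2) has_derivative (\<lambda>v. (v \<bullet> G j ?x) * (2 * g j ?x))) (at ?x)" for j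
      by (auto intro!: derivative_eq_intros g')
    have ng: "((\<lambda>y. (norm (y - u)) ^ 2) has_derivative (\<lambda>v. v \<bullet> (2 *\<^sub>R (?x - u)))) (at ?x)"
      unfolding power2_norm_eq_inner by (auto intro!: derivative_eq_intros simp: inner_commute)
    let ?D = "\<lambda>v. v \<bullet> grad (eval F) ?x + v \<bullet> (2 *\<^sub>R (?x - u))
        + real k * ((\<Sum>j\<in>EQ. (v \<bullet> G j ?x) * (2 * g j ?x)) + (\<Sum>j\<in>IN. (v \<bullet> G j ?x) * (2 * min 0 (g j ?x))))"
    have D: "(\<Phi> k has_derivative ?D) (at ?x)"
      unfolding \<Phi>_def violation_def g_def[symmetric]
      by (intro has_derivative_add has_derivative_mult_right has_derivative_sum mg eg ng eval_has_grad)
    have "?D = (\<lambda>v. 0)"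
      by (rule differential_zero_maxmin[OF _ open_ball D, of u 1])
        (use k x(2) in \<open>auto simp: C_def dist_commute\<close>)
    moreover have "?D v = v \<bullet> (r k - (\<Sum>j\<in>EQ \<union> IN. \<mu> k j *\<^sub>R G j ?x))" for v
    proof -
      have "(\<Sum>j\<in>EQ. \<mu> k j * (v \<bullet> G j ?x)) = - (real k * (\<Sum>j\<in>EQ. (v \<bullet> G j ?x) * (2 * g j ?x)))"
        unfolding sum_distrib_left sum_negf[symmetric] by (intro sum.cong) (auto simp: \<mu>_def)
      moreover have "(\<Sum>j\<in>IN. \<mu> k j * (v \<bullet> G j ?x)) = - (real k * (\<Sum>j\<in>IN. (v \<bullet> G j ?x) * (2 * min 0 (g j ?x))))"
        unfolding sum_distrib_left sum_negf[symmetric] using disj by (intro sum.cong) (auto simp: \<mu>_def)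
      ultimately show ?thesis
        using disj by (simp add: r_def inner_diff_right inner_add_right inner_sum_right sum.union_disjoint
            distrib_left)
    qed
    ultimately have "v \<bullet> (r k - (\<Sum>j\<in>EQ \<union> IN. \<mu> k j *\<^sub>R G j ?x)) = 0" for v by metis
    then show ?thesis by (metis inner_eq_zero_iff right_minus_eq)
  qed
  have ev1: "\<forall>\<^sub>F k in sequentially. dist (x k) u < 1"
    using tendstoD[OF x_lim zero_less_one] .
  have ev2: "\<forall>\<^sub>F k in sequentially. \<forall>j\<in>IN - act. \<mu> k j = 0"
  proof (rule eventually_ball_finite)
    show "\<forall>j\<in>IN - act. \<forall>\<^sub>F k in sequentially. \<mu> k j = 0"
    proof
      fix j assume j: "j \<in> IN - act"
      then have "0 < g j u" using u by (force simp: act_def active_def g_def feasible_set_def)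
      from order_tendstoD(1)[OF gx this]
      show "\<forall>\<^sub>F k in sequentially. \<mu> k j = 0"
        by eventually_elim (use j disj in \<open>auto simp: \<mu>_def\<close>)
    qed
  qed simp
  have ev: "\<forall>\<^sub>F k in sequentially. r k = (\<Sum>j\<in>act. \<mu> k j *\<^sub>R G j (x k))"
    using ev1 ev2
  proof eventually_elim
    case (elim k)
    have "(\<Sum>j\<in>EQ \<union> IN. \<mu> k j *\<^sub>R G j (x k)) = (\<Sum>j\<in>act. \<mu> k j *\<^sub>R G j (x k))"
      using act_sub EQ_act elim(2) by (intro sum.mono_neutral_right) auto
    then show ?case using stat[OF elim(1)] by simp
  qed
  \<comment> \<open>\<open>\<delta>\<close> measures how far \<open>\<phi>\<close> is from being
    dual to the gradients at \<open>x k\<close>. Once \<eta> \<le> 1/2, the bound s \<le> b + s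
    \<eta> keeps the multipliers bounded, and then \<eta> tending to zero forces their
    convergence.\<close>
  define \<delta> where "\<delta> i j k = (if i = j then 1 else 0) - \<phi> j (G i (x k))" for i j k
  define \<eta> where "\<eta> k = (\<Sum>j\<in>act. \<Sum>i\<in>act. \<bar>\<delta> i j k\<bar>)" for k
  define s where "s k = (\<Sum>i\<in>act. \<bar>\<mu> k i\<bar>)" for k
  define b where "b k = (\<Sum>j\<in>act. \<bar>\<phi> j (r k)\<bar>)" for k
  have \<phi>_lim: "(\<lambda>k. \<phi> j (y k)) \<longlonglongrightarrow> \<phi> j z" if "j \<in> act" "y \<longlonglongrightarrow> z" for j y z
    using linear_continuous_at[OF linear_conv_bounded_linear[THEN iffD1, OF \<phi>(1)[OF that(1)]]] that(2)
    by (rule isCont_tendsto_compose)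
  have \<eta>_lim: "\<eta> \<longlonglongrightarrow> 0"
  proof -
    have "(\<lambda>k. \<Sum>j\<in>act. \<Sum>i\<in>act. \<bar>\<delta> i j k\<bar>) \<longlonglongrightarrow> (\<Sum>j\<in>act. \<Sum>i\<in>act. \<bar>(if i = j then 1 else 0) - \<phi> j (G i u)\<bar>)"
      unfolding \<delta>_def by (intro tendsto_intros \<phi>_lim Gx)
    also have "(\<Sum>j\<in>act. \<Sum>i\<in>act. \<bar>(if i = j then 1 else 0) - \<phi> j (G i u)\<bar>) = 0"
      by (intro sum.neutral ballI) (simp add: \<phi>(2))
    finally show ?thesis unfolding \<eta>_def[abs_def] .
  qed
  have b_lim: "b \<longlonglongrightarrow> (\<Sum>j\<in>act. \<bar>\<phi> j (grad (eval F) u)\<bar>)"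
    unfolding b_def[abs_def] by (intro tendsto_intros \<phi>_lim r_lim)
  have \<eta>0: "0 \<le> \<eta> k" for k unfolding \<eta>_def by (intro sum_nonneg) auto
  have bound: "\<forall>\<^sub>F k in sequentially. \<forall>j\<in>act. \<bar>\<mu> k j - \<phi> j (r k)\<bar> \<le> 2 * b k * \<eta> k"
    using ev order_tendstoD(2)[OF \<eta>_lim, of "1 / 2", simplified]
  proof eventually_elim
    case (elim k)
    have diff: "\<mu> k j - \<phi> j (r k) = (\<Sum>i\<in>act. \<mu> k i * \<delta> i j k)" if j: "j \<in> act" for j
    proof -
      have "\<phi> j (r k) = (\<Sum>i\<in>act. \<mu> k i * \<phi> j (G i (x k)))"
        unfolding elim(1) using \<phi>(1)[OF j] by (simp add: linear_sum linear_scale)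
      moreover have "(\<Sum>i\<in>act. \<mu> k i * (if i = j then 1 else 0)) = \<mu> k j"
        using j fin_act by (simp add: if_distrib[of "\<lambda>r. _ * r"] cong: if_cong)
      ultimately show ?thesis by (simp add: \<delta>_def right_diff_distrib sum_subtractf)
    qed
    have \<delta>_le: "\<bar>\<mu> k j - \<phi> j (r k)\<bar> \<le> (\<Sum>i\<in>act. s k * \<bar>\<delta> i j k\<bar>)" if j: "j \<in> act" for j
    proof -
      have "\<bar>\<mu> k j - \<phi> j (r k)\<bar> \<le> (\<Sum>i\<in>act. \<bar>\<mu> k i * \<delta> i j k\<bar>)"
        unfolding diff[OF j] by (rule sum_abs)
      also have "\<dots> \<le> (\<Sum>i\<in>act. s k * \<bar>\<delta> i j k\<bar>)"
        unfolding abs_mult s_def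
        by (intro sum_mono mult_right_mono member_le_sum) (auto simp: fin_act)
      finally show ?thesis .
    qed
    have s0: "0 \<le> s k" unfolding s_def by (intro sum_nonneg) auto
    have "s k = (\<Sum>j\<in>act. \<bar>\<mu> k j\<bar>)" by (rule s_def)
    also have "\<dots> \<le> (\<Sum>j\<in>act. \<bar>\<phi> j (r k)\<bar> + (\<Sum>i\<in>act. s k * \<bar>\<delta> i j k\<bar>))"
    proof (rule sum_mono)
      fix j assume "j \<in> act"
      from \<delta>_le[OF this]
      show "\<bar>\<mu> k j\<bar> \<le> \<bar>\<phi> j (r k)\<bar> + (\<Sum>i\<in>act. s k * \<bar>\<delta> i j k\<bar>)" by linarith
    qed
    also have "\<dots> = b k + s k * \<eta> k"
      by (simp add: b_def \<eta>_def sum.distrib sum_distrib_left)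
    also have "\<dots> \<le> b k + s k * (1 / 2)"
      using elim(2) s0 by (intro add_left_mono mult_left_mono) auto
    finally have sb: "s k \<le> 2 * b k" by simp
    show ?case
    proof
      fix j assume j: "j \<in> act"
      have "\<bar>\<mu> k j - \<phi> j (r k)\<bar> \<le> s k * (\<Sum>i\<in>act. \<bar>\<delta> i j k\<bar>)"
        using \<delta>_le[OF j] by (simp add: sum_distrib_left)
      also have "\<dots> \<le> s k * \<eta> k"
        unfolding \<eta>_def using fin_act j s0
        by (intro mult_left_mono member_le_sum[of j _ "\<lambda>j. \<Sum>i\<in>act. \<bar>\<delta> i j k\<bar>"]) (auto intro: sum_nonneg)
      also have "\<dots> \<le> 2 * b k * \<eta> k" using sb \<eta>0 by (intro mult_right_mono)
      finally show "\<bar>\<mu> k j - \<phi> j (r k)\<bar> \<le> 2 * b k * \<eta> k" .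
    qed
  qed
  define lm where "lm j = \<phi> j (grad (eval F) u)" for j
  have \<mu>_lim: "(\<lambda>k. \<mu> k j) \<longlonglongrightarrow> lm j" if j: "j \<in> act" for j
  proof -
    have "(\<lambda>k. 2 * b k * \<eta> k) \<longlonglongrightarrow> 2 * (\<Sum>j\<in>act. \<bar>\<phi> j (grad (eval F) u)\<bar>) * 0"
      by (intro tendsto_intros b_lim \<eta>_lim)
    then have "(\<lambda>k. 2 * b k * \<eta> k) \<longlonglongrightarrow> 0" by simp
    then have "(\<lambda>k. \<mu> k j - \<phi> j (r k)) \<longlonglongrightarrow> 0"
      by (rule Lim_null_comparison[rotated]) (use bound j in \<open>auto elim: eventually_mono\<close>)
    from tendsto_add[OF this \<phi>_lim[OF j r_lim]] show ?thesis by (simp add: lm_def)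
  qed
  have "(\<lambda>k. \<Sum>j\<in>act. \<mu> k j *\<^sub>R G j (x k)) \<longlonglongrightarrow> (\<Sum>j\<in>act. lm j *\<^sub>R G j u)"
    by (intro tendsto_intros \<mu>_lim Gx)
  then have "r \<longlonglongrightarrow> (\<Sum>j\<in>act. lm j *\<^sub>R G j u)"
    by (rule Lim_transform_eventually) (use ev in eventually_elim, simp)
  then have gradF: "grad (eval F) u = (\<Sum>j\<in>act. lm j *\<^sub>R G j u)"
    using r_lim LIMSEQ_unique by blast
  define lam where "lam j = (if j \<in> act then lm j else 0)" for j
  have "grad (eval F) u = (\<Sum>j\<in>EQ \<union> IN. lam j *\<^sub>R grad (g j) u)"
  proof -
    have "(\<Sum>j\<in>EQ \<union> IN. lam j *\<^sub>R grad (g j) u) = (\<Sum>j\<in>act. lam j *\<^sub>R grad (g j) u)"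
      using act_sub by (intro sum.mono_neutral_right) (auto simp: lam_def)
    then show ?thesis by (simp add: gradF lam_def G_def)
  qed
  moreover have "0 \<le> lam j \<and> lam j * g j u = 0" if j: "j \<in> IN" for j
  proof (cases "j \<in> act")
    case True
    have "0 \<le> \<mu> k j" for k using j disj by (auto simp: \<mu>_def mult_nonneg_nonpos)
    then have "0 \<le> lm j" using LIMSEQ_le_const[OF \<mu>_lim[OF True]] by blast
    then show ?thesis using True act0 by (simp add: lam_def)
  qed (simp add: lam_def)
  ultimately show ?thesis unfolding multipliers_def g_def by blast
qed

end

lemma eval_2 [simp]: "eval 2 x = 2"
  using eval_Const[of 2 x] by simp

context spherical_system
begin

section \<open>Local models at nondegenerate minimizers\<close>

lemma M_nonneg: "p \<in> M \<Longrightarrow> x \<in> S \<Longrightarrow> 0 \<le> eval p x"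
proof -
  assume p: "p \<in> M" and x: "x \<in> S"
  obtain r s0 s where *: "s0 \<in> SOS" "\<And>j. j \<in> IN \<Longrightarrow> s j \<in> SOS"
    "p = (\<Sum>j\<in>EQ. q j * r j) + (s0 + (\<Sum>j\<in>IN. q j * s j))"
    using p by (rule qmodE) blast
  have "0 \<le> (\<Sum>j\<in>IN. eval (q j) x * eval (s j) x)"
    using x by (intro sum_nonneg mult_nonneg_nonneg SOS_nonneg[OF *(2)]) (auto simp: feasible_set_def)
  moreover have "(\<Sum>j\<in>EQ. eval (q j) x * eval (r j) x) = 0"
    using x by (auto simp: feasible_set_def)
  ultimately show ?thesis using SOS_nonneg[OF *(1)] by (simp add: *(3))
qed

text \<open>Subtracting \<open>h P\<close> with \<open>P = \<lambda>\<close> to first order removes the multiplier term, and the additional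
  terms with factor \<open>K\<close> make the Hessian of the remainder positive definite on the whole space.\<close>

lemma local_model:
  assumes disj: "EQ \<inter> IN = {}" and nonneg: "\<And>x. x \<in> S \<Longrightarrow> 0 \<le> eval F x"
    and Z: "finite Z" "Z \<noteq> {}" "Z \<subseteq> S" and FZ: "\<And>u. u \<in> Z \<Longrightarrow> eval F u = 0"
    and licq: "\<And>u. u \<in> Z \<Longrightarrow> LICQC (\<lambda>j. eval (q j)) EQ IN u"
    and scc: "\<And>u. u \<in> Z \<Longrightarrow> SCC (eval F) (\<lambda>j. eval (q j)) EQ IN u"
    and sosc: "\<And>u. u \<in> Z \<Longrightarrow> SOSC (eval F) (\<lambda>j. eval (q j)) EQ IN u"
  obtains m :: "'v \<Rightarrow> 'v mpoly" and H A where
    "\<And>p. (\<And>u. u \<in> Z \<Longrightarrow> eval p u = 0) \<Longrightarrow> p \<in> ideal_gen m"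
    "F - H \<in> M" "H = qform A m"
    "\<And>u (y :: real ^ 'v). u \<in> Z \<Longrightarrow> y \<noteq> 0 \<Longrightarrow>
      0 < qform (\<lambda>i j. eval (A i j) u) (($) y)"
proof -
  obtain m :: "'v \<Rightarrow> 'v mpoly" and L where
    m0: "\<And>u i. u \<in> Z \<Longrightarrow> eval (m i) u = 0" and
    sur: "\<And>u y. u \<in> Z \<Longrightarrow> \<exists>v. \<forall>i. jet1 (m i) u v = y i" and
    gen: "\<And>p. (\<And>u. u \<in> Z \<Longrightarrow> eval p u = 0) \<Longrightarrow> p \<in> ideal_gen m" and
    L: "\<And>u u'. u \<in> Z \<Longrightarrow> u' \<in> Z \<Longrightarrow> eval (L u) u' = (if u = u' then 1 else 0)"
    by (rule vanishing_ideal_generators[OF Z(1,2)]) blast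
  have "\<exists>lam. multipliers (eval F) (\<lambda>j. eval (q j)) EQ IN u lam" if u: "u \<in> Z" for u
    using Z(3) u FZ[OF u] nonneg by (intro KKT disj licq) auto
  then obtain lam where lam: "\<And>u. u \<in> Z \<Longrightarrow> multipliers (eval F) (\<lambda>j. eval (q j)) EQ IN u (lam u)"
    by metis
  have lam_nonneg: "0 \<le> lam u j" and compl: "lam u j = 0 \<or> eval (q j) u = 0" if "u \<in> Z" "j \<in> IN" for u j
    using lam[OF that(1)] that(2) by (auto simp: multipliers_def)
  have strict: "0 < lam u j + eval (q j) u" if "u \<in> Z" "j \<in> IN" for u j
    using scc[OF that(1)] lam[OF that(1)] that(2) by (auto simp: SCC_def)
  have q0: "eval (q j) u = 0" if "u \<in> Z" "j \<in> EQ" for u j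
    using that Z(3) by (auto simp: feasible_set_def)
  \<comment> \<open>The cubic 3 y^2 - 2 y^3 takes the values 0 and 1 at 0 and 1 with zero slope at
    both. Hence \<open>P\<close> and \<open>R\<close> below interpolate with vanishing differentials
    on \<open>Z\<close>.\<close>
  define E where "E u = L u * L u * (Const 3 - Const 2 * L u)" for u
  have E_eval: "eval (E u) u' = (if u = u' then 1 else 0)" and E_jet: "jet1 (E u) u' v = 0"
    if "u \<in> Z" "u' \<in> Z" for u u' v
    using L[OF that] by (auto simp: E_def simp del: Const_2)
  define P where "P j = (\<Sum>u\<in>Z. Const (lam u j) * E u)" for j
  define R where "R j = (\<Sum>u\<in>Z. Const (sqrt (lam u j)) * E u)" for j
  have comb: "eval (\<Sum>u\<in>Z. Const (a u) * E u) u' = a u'" "jet1 (\<Sum>u\<in>Z. Const (a u) * E u) u' v = 0"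
    if "u' \<in> Z" for a u' v
  proof -
    have "eval (\<Sum>u\<in>Z. Const (a u) * E u) u' = (\<Sum>u\<in>Z. if u = u' then a u else 0)"
      unfolding eval_sum by (intro sum.cong) (auto simp: E_eval that)
    then show "eval (\<Sum>u\<in>Z. Const (a u) * E u) u' = a u'" using that Z(1) by simp
  qed (simp add: E_jet that)
  have P_eval: "eval (P j) u = lam u j" and P_jet: "jet1 (P j) u v = 0"
    and R_eval: "eval (R j) u = sqrt (lam u j)" and R_jet: "jet1 (R j) u v = 0" if "u \<in> Z" for u j v
    by (simp_all add: P_def R_def comb that del: eval_sum jet_sum eval_mult jet_mult)
  \<comment> \<open>A penalty whose zeros are the critical directions of SOSC: by SCC every active
    inequality has a positive multiplier and so is detected here.\<close>
  define rem where "rem u v = (\<Sum>j\<in>EQ. (jet1 (q j) u v) ^ 2) + 2 * (\<Sum>j\<in>IN. lam u j * (jet1 (q j) u v) ^ 2)" for u v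
  define Lag where "Lag u = F - (\<Sum>j\<in>EQ \<union> IN. Const (lam u j) * q j)" for u
  have Lag_pos: "0 < jet2 (Lag u) u v"
    if u: "u \<in> Z" and v: "v \<noteq> 0" and ker: "rem u v = 0" for u v
  proof -
    have nn: "0 \<le> (\<Sum>j\<in>EQ. (jet1 (q j) u v) ^ 2)" "0 \<le> (\<Sum>j\<in>IN. lam u j * (jet1 (q j) u v) ^ 2)"
      using lam_nonneg[OF u] by (auto intro!: sum_nonneg)
    have z: "(\<Sum>j\<in>EQ. (jet1 (q j) u v) ^ 2) = 0" "(\<Sum>j\<in>IN. lam u j * (jet1 (q j) u v) ^ 2) = 0"
      using ker nn unfolding rem_def by linarith+
    have "v \<bullet> grad (eval (q j)) u = 0" if j: "j \<in> active (\<lambda>j. eval (q j)) EQ IN u" for j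
    proof (cases "j \<in> EQ")
      case True
      then show ?thesis using z(1) by (simp add: sum_nonneg_eq_0_iff jet1_grad)
    next
      case False
      then have j': "j \<in> IN" "eval (q j) u = 0" using j by (auto simp: active_def)
      have "\<forall>j\<in>IN. lam u j * (jet1 (q j) u v) ^ 2 = 0"
        using z(2) lam_nonneg[OF u] by (subst (asm) sum_nonneg_eq_0_iff) auto
      then show ?thesis using j' strict[OF u j'(1)] by (auto simp: jet1_grad)
    qed
    moreover have "(\<lambda>y. eval F y - (\<Sum>j\<in>EQ \<union> IN. lam u j * eval (q j) y)) = eval (Lag u)"
      by (rule ext) (simp add: Lag_def)
    ultimately have "0 < v \<bullet> (hessian (eval (Lag u)) u *v v)"
      using sosc[OF u] lam[OF u] v by (auto simp: SOSC_def)
    then show ?thesis by (simp add: jet2_hessian)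
  qed
  have rem_nonneg: "0 \<le> rem u v" if "u \<in> Z" for u v
    unfolding rem_def using lam_nonneg[OF that] by (intro add_nonneg_nonneg sum_nonneg mult_nonneg_nonneg) auto
  have "\<exists>K0\<ge>0. \<forall>K\<ge>K0. \<forall>v\<in>sphere 0 1. 0 < jet2 (Lag u) u v + K * rem u v" if u: "u \<in> Z" for u
  proof (rule compact_penalty)
    show "continuous_on (sphere 0 1) (rem u)"
      unfolding rem_def[abs_def] by (intro continuous_intros continuous_on_jet1)
    show "0 < jet2 (Lag u) u v" if "v \<in> sphere 0 1" "rem u v = 0" for v
      using that by (intro Lag_pos u) auto
  qed (simp_all add: continuous_on_jet2 rem_nonneg u)
  then obtain K0 where K0: "\<And>u. u \<in> Z \<Longrightarrow> 0 \<le> K0 u"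
    "\<And>u K v. u \<in> Z \<Longrightarrow> K0 u \<le> K \<Longrightarrow> norm v = 1 \<Longrightarrow> 0 < jet2 (Lag u) u v + K * rem u v"
    by (metis mem_sphere_0)
  define K where "K = sum K0 Z"
  have K: "K0 u \<le> K" if "u \<in> Z" for u
    unfolding K_def using that K0(1) Z(1) by (intro member_le_sum) auto
  \<comment> \<open>In \<open>H\<close>, the square of 1 - K q_j contributes 2 K \<lambda>_j times
    the squared differential of q_j to the second-order term, and K q_j^2 does the same for
    equalities with factor K; together they give K times \<open>rem\<close>. \<open>R\<close>
    interpolates the roots of the multipliers because multipliers of inequalities must be
    squares.\<close>
  define c where "c j = 1 - Const K * q j" for j
  define H where "H = F - (\<Sum>j\<in>EQ. q j * P j) + Const K * (\<Sum>j\<in>EQ. q j * q j)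
      - (\<Sum>j\<in>IN. q j * (R j * R j * (c j * c j)))"
  have "F - H = (\<Sum>j\<in>EQ. q j * (P j - Const K * q j)) + (\<Sum>j\<in>IN. q j * (R j * c j) ^ 2)"
    by (simp add: H_def right_diff_distrib sum_subtractf sum_distrib_left power2_eq_square mult_ac)
  moreover have "\<dots> \<in> M"
    by (intro qmod_add qmod_sum qmod_ideal qmod_ineq finite_EQ finite_IN SOS_square)
  ultimately have FH: "F - H \<in> M" by simp
  have IN_terms:
    "eval (q j * (R j * R j * (c j * c j))) u = 0"
    "jet1 (q j * (R j * R j * (c j * c j))) u v = lam u j * jet1 (q j) u v"
    "jet2 (q j * (R j * R j * (c j * c j))) u v = lam u j * jet2 (q j) u v - 2 * K * (lam u j * (jet1 (q j) u v) ^ 2)"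
    if u: "u \<in> Z" and j: "j \<in> IN" for u j v
  proof -
    have s: "sqrt (lam u j) * sqrt (lam u j) = lam u j" using lam_nonneg[OF u j] by simp
    have s': "sqrt (lam u j) * (sqrt (lam u j) * y) = lam u j * y" for y
      unfolding mult.assoc[symmetric] s ..
    consider "lam u j = 0" | "eval (q j) u = 0" using compl[OF u j] by blast
    note cases = this
    show "eval (q j * (R j * R j * (c j * c j))) u = 0"
      using cases by cases (auto simp: R_eval u)
    show "jet1 (q j * (R j * R j * (c j * c j))) u v = lam u j * jet1 (q j) u v"
      using cases by cases (simp_all add: R_eval R_jet u c_def lam_nonneg j algebra_simps)
    show "jet2 (q j * (R j * R j * (c j * c j))) u v
        = lam u j * jet2 (q j) u v - 2 * K * (lam u j * (jet1 (q j) u v) ^ 2)"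
      using cases by cases
        (simp_all add: R_eval R_jet u c_def s s' lam_nonneg j power2_eq_square algebra_simps)
  qed
  have H_eval: "eval H u = 0" if u: "u \<in> Z" for u
  proof -
    have "(\<Sum>j\<in>IN. eval (q j * (R j * R j * (c j * c j))) u) = 0"
      by (intro sum.neutral ballI IN_terms(1)[OF u])
    then show ?thesis unfolding H_def eval_diff eval_add eval_sum by (simp add: FZ u q0)
  qed
  have H_jet1: "jet1 H u v = 0" if u: "u \<in> Z" for u v
  proof -
    have "(\<Sum>j\<in>IN. jet1 (q j * (R j * R j * (c j * c j))) u v) = (\<Sum>j\<in>IN. lam u j * jet1 (q j) u v)"
      by (intro sum.cong refl IN_terms(2)[OF u])
    moreover have "jet1 F u v = (\<Sum>j\<in>EQ \<union> IN. lam u j * jet1 (q j) u v)"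
    proof -
      have "grad (eval F) u = (\<Sum>j\<in>EQ \<union> IN. lam u j *\<^sub>R grad (eval (q j)) u)"
        using lam[OF u] by (simp add: multipliers_def)
      then show ?thesis by (simp add: jet1_grad inner_sum_right)
    qed
    ultimately show ?thesis unfolding H_def jet_diff jet_add jet_sum
      using disj by (simp add: q0 u P_eval P_jet sum.union_disjoint mult.commute)
  qed
  have H_jet2: "jet2 H u v = jet2 (Lag u) u v + K * rem u v" if u: "u \<in> Z" for u v
  proof -
    have "(\<Sum>j\<in>IN. jet2 (q j * (R j * R j * (c j * c j))) u v)
        = (\<Sum>j\<in>IN. lam u j * jet2 (q j) u v) - 2 * K * (\<Sum>j\<in>IN. lam u j * (jet1 (q j) u v) ^ 2)"
      unfolding sum_distrib_left sum_subtractf[symmetric] by (intro sum.cong refl IN_terms(3)[OF u])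
    moreover have "jet2 (Lag u) u v = jet2 F u v - ((\<Sum>j\<in>EQ. lam u j * jet2 (q j) u v) + (\<Sum>j\<in>IN. lam u j * jet2 (q j) u v))"
      using disj by (simp add: Lag_def sum.union_disjoint)
    ultimately show ?thesis unfolding H_def jet_diff jet_add jet_sum
      by (simp add: q0 u P_eval P_jet rem_def power2_eq_square mult.commute distrib_left)
  qed
  have H_pos: "0 < jet2 H u v" if u: "u \<in> Z" and v: "v \<noteq> 0" for u v
  proof -
    define w where "w = (1 / norm v) *\<^sub>R v"
    have "norm w = 1" using v by (simp add: w_def)
    then have "0 < jet2 H u w" using K0(2)[OF u K[OF u]] H_jet2[OF u] by simp
    then show ?thesis using v by (simp add: w_def jet_scale zero_less_mult_iff)
  qed
  obtain A where "H = qform A m"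
    "\<And>u (y :: real ^ 'v). u \<in> Z \<Longrightarrow> y \<noteq> 0 \<Longrightarrow>
      0 < qform (\<lambda>i j. eval (A i j) u) (($) y)"
    by (rule second_order_representation[of Z m H, OF m0 sur gen H_eval H_jet1 H_pos]) blast+
  then show ?thesis using that[OF gen FH] by blast
qed

section \<open>Finiteness of the zero set and the certificate with margin\<close>

text \<open>The local model is used twice: at a single zero, where it shows that the zero is
  isolated, so that compactness makes the zeros finite in number; and then at all zeros
  simultaneously.\<close>

theorem nondegenerate_membership:
  assumes disj: "EQ \<inter> IN = {}" and nonneg: "\<And>x. x \<in> S \<Longrightarrow> 0 \<le> eval F x"
    and Z: "Z = {x\<in>S. eval F x = 0}" "Z \<noteq> {}"
    and licq: "\<And>u. u \<in> Z \<Longrightarrow> LICQC (\<lambda>j. eval (q j)) EQ IN u"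
    and scc: "\<And>u. u \<in> Z \<Longrightarrow> SCC (eval F) (\<lambda>j. eval (q j)) EQ IN u"
    and sosc: "\<And>u. u \<in> Z \<Longrightarrow> SOSC (eval F) (\<lambda>j. eval (q j)) EQ IN u"
  obtains m :: "'v \<Rightarrow> 'v mpoly" and e t where
    "finite Z" "\<forall>p. (\<forall>u\<in>Z. eval p u = 0) \<longrightarrow> p \<in> ideal_gen m"
    "0 < e" "F - Const e * ((\<Sum>i\<in>UNIV. (m i * (1 - F * t)) ^ 2) + F ^ 2) \<in> M"
proof -
  have ZS: "Z \<subseteq> S" and FZ: "\<And>u. u \<in> Z \<Longrightarrow> eval F u = 0" using Z by auto
  have isolated: "\<not> u islimpt Z" if u: "u \<in> Z" for u
  proof -
    obtain m :: "'v \<Rightarrow> 'v mpoly" and H A where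
      gen: "\<And>p. (\<And>u'. u' \<in> {u} \<Longrightarrow> eval p u' = 0) \<Longrightarrow> p \<in> ideal_gen m" and
      FH: "F - H \<in> M" and H: "H = qform A m" and
      pd: "\<And>u' (y :: real ^ 'v). u' \<in> {u} \<Longrightarrow> y \<noteq> 0 \<Longrightarrow>
        0 < qform (\<lambda>i j. eval (A i j) u') (($) y)"
      by (rule local_model[of F "{u}", OF disj nonneg]) (use u ZS FZ licq scc sosc in auto)
    define Q where "Q xw = (\<Sum>i\<in>UNIV. \<Sum>j\<in>UNIV. eval (A i j) (fst xw) * snd xw $ i * snd xw $ j)"
      for xw :: "(real ^ 'v) \<times> (real ^ 'v)"
    \<comment> \<open>The projection of \<open>X\<close> to \<open>S\<close> is the closed set of
      points at which \<open>A\<close> is not positive definite, and it misses \<open>u\<close>. Off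
      this set H > 0 wherever \<open>m\<close> does not vanish, that is, on \<open>S\<close> away
      from \<open>u\<close>, and F \<ge> H on \<open>S\<close>.\<close>
    define X where "X = S \<times> sphere 0 1 \<inter> {xw. Q xw \<le> 0}"
    have "compact X"
      unfolding X_def Q_def
      by (intro compact_Int_closed compact_Times compact_S compact_sphere closed_Collect_le continuous_intros)
    then have "compact (fst ` X)" by (intro compact_continuous_image continuous_intros)
    then have "open (- fst ` X)" by (simp add: compact_imp_closed open_Compl)
    moreover have "u \<in> - fst ` X"
    proof
      assume "u \<in> fst ` X"
      then obtain w where w: "norm w = 1" "Q (u, w) \<le> 0" by (auto simp: X_def)
      then have "w \<noteq> 0" by auto
      from pd[OF _ this, of u] w(2) show False by (simp add: Q_def)
    qed
    moreover have "x = u" if x: "x \<in> Z" "x \<in> - fst ` X" for x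
    proof (rule ccontr)
      assume "x \<noteq> u"
      define y where "y = (\<chi> i. eval (m i) x)"
      have "y \<noteq> 0"
      proof
        assume "y = 0"
        then have m0: "eval (m i) x = 0" for i by (simp add: y_def vec_eq_iff)
        have "x $ i = u $ i" for i
        proof -
          have "Var i - Const (u $ i) \<in> ideal_gen m" by (rule gen) simp
          then obtain b where b: "Var i - Const (u $ i) = (\<Sum>k\<in>UNIV. m k * b k)" by (auto simp: ideal_gen_def)
          show ?thesis using arg_cong[OF b, of "\<lambda>p. eval p x"] by (simp add: m0)
        qed
        then show False using \<open>x \<noteq> u\<close> by (simp add: vec_eq_iff)
      qed
      define \<eta> where "\<eta> = Q (x, (1 / norm y) *\<^sub>R y)"
      have \<eta>: "0 < \<eta>"
      proof (rule ccontr)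
        assume "\<not> 0 < \<eta>"
        then have "(x, (1 / norm y) *\<^sub>R y) \<in> X"
          using x ZS \<open>y \<noteq> 0\<close> by (auto simp: X_def \<eta>_def)
        then show False using x(2) by force
      qed
      have "eval H x = (norm y) ^ 2 * \<eta>"
        using \<open>y \<noteq> 0\<close> unfolding H \<eta>_def Q_def sum_distrib_left
        by (simp add: y_def sum_distrib_left power2_eq_square)
      then have "0 < eval H x" using \<eta> \<open>y \<noteq> 0\<close> by simp
      moreover have "0 \<le> eval F x - eval H x" using M_nonneg[OF FH, of x] x ZS by auto
      ultimately show False using FZ[OF x(1)] by simp
    qed
    ultimately show ?thesis unfolding islimpt_def by blast
  qed
  have "compact Z"
  proof -
    have "Z = S \<inter> {x. eval F x = 0}" by (auto simp: Z)
    then show ?thesis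
      by (auto intro!: compact_Int_closed compact_S closed_Collect_eq continuous_intros)
  qed
  then have fin: "finite Z"
    using isolated unfolding compact_eq_Bolzano_Weierstrass by blast
  obtain m :: "'v \<Rightarrow> 'v mpoly" and H A where
    gen: "\<And>p. (\<And>u. u \<in> Z \<Longrightarrow> eval p u = 0) \<Longrightarrow> p \<in> ideal_gen m" and
    FH: "F - H \<in> M" and H: "H = qform A m" and
    pd: "\<And>u (y :: real ^ 'v). u \<in> Z \<Longrightarrow> y \<noteq> 0 \<Longrightarrow>
      0 < qform (\<lambda>i j. eval (A i j) u) (($) y)"
    by (rule local_model[of F Z, OF disj nonneg fin Z(2) ZS FZ licq scc sosc]) blast+
  obtain b where b: "F = (\<Sum>i\<in>UNIV. m i * b i)"
    using gen[of F] FZ by (auto simp: ideal_gen_def)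
  obtain e t where "0 < e" "F - Const e * ((\<Sum>i\<in>UNIV. (m i * (1 - F * t)) ^ 2) + F ^ 2) \<in> M"
    using membership_from_local_representation[OF nonneg b FH H] pd Z(1) by blast
  moreover have "\<forall>p. (\<forall>u\<in>Z. eval p u = 0) \<longrightarrow> p \<in> ideal_gen m" using gen by blast
  ultimately show ?thesis by (intro that fin)
qed

end

section \<open>Pairings with truncated sequences\<close>

lemma tdeg_1 [simp]: "tdeg 1 = 0"
  using tdeg_monomial[of 0] by simp

lemma tdeg_mult_le: "tdeg (p * r) \<le> tdeg p + tdeg r"
  unfolding tdeg_le_iff
proof
  fix \<alpha> assume "\<alpha> \<in> Poly_Mapping.keys (p * r)"
  then obtain \<beta> \<gamma> where "\<alpha> = \<beta> + \<gamma>" "\<beta> \<in> Poly_Mapping.keys p" "\<gamma> \<in> Poly_Mapping.keys r"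
    using keys_mult[of p r] by auto
  then show "edeg \<alpha> \<le> tdeg p + tdeg r"
    using edeg_le_tdeg[of \<beta> p] edeg_le_tdeg[of \<gamma> r] by (simp add: edeg_add)
qed

lemma Var_power: "Var i ^ n = monomial (Poly_Mapping.single i n)"
  by (induction n) (simp_all add: Var_def monomial_add[symmetric] single_add[symmetric])

lemma pairing_0 [simp]: "pairing 0 w = 0"
  by (simp add: pairing_def)

lemma pairing_uminus: "pairing (- p) w = - pairing p w"
  using pairing_add[of p "- p" w] by simp

lemma pairing_diff: "pairing (p - r) w = pairing p w - pairing r w"
  using pairing_add[of p "- r" w] by (simp add: pairing_uminus)

lemma pairing_monomial [simp]: "pairing (monomial \<alpha>) w = w \<alpha>"
  by (simp add: pairing_def monomial_def)

lemma pairing_mult_expand: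
  "pairing (q * p) w = (\<Sum>\<alpha>\<in>Poly_Mapping.keys p. Poly_Mapping.lookup p \<alpha> * pairing (q * monomial \<alpha>) w)"
proof -
  have "q * p = (\<Sum>\<alpha>\<in>Poly_Mapping.keys p. Const (Poly_Mapping.lookup p \<alpha>) * (q * monomial \<alpha>))"
    using arg_cong[OF mpoly_as_sum[of p], of "\<lambda>p. q * p"] by (simp add: sum_distrib_left mult_ac)
  then show ?thesis by (simp add: pairing_sum pairing_Const_mult)
qed

lemma loc_vec_zero_pairing:
  assumes "loc_vec_zero k q w" "tdeg q + tdeg p \<le> 2 * k" shows "pairing (q * p) w = 0"
  by (subst pairing_mult_expand, intro sum.neutral ballI)
    (use assms edeg_le_tdeg[of _ p] in \<open>fastforce simp: loc_vec_zero_def\<close>)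

lemma loc_psd_pairing:
  assumes "loc_psd k q w" "2 * tdeg p + tdeg q \<le> 2 * k" shows "0 \<le> pairing (q * p ^ 2) w"
proof -
  have "pairing (q * p ^ 2) w = (\<Sum>\<alpha>\<in>loc_index q k. \<Sum>\<beta>\<in>loc_index q k.
      Poly_Mapping.lookup p \<alpha> * loc_matrix q w \<alpha> \<beta> * Poly_Mapping.lookup p \<beta>)"
    by (rule loc_matrix_quadratic[OF assms(2), symmetric])
  then show ?thesis using assms(1) by (simp add: loc_psd_def psd_on_def)
qed

text \<open>The threshold for \<open>k\<close> depends on the squares and on \<open>q\<close> but
  not on \<open>w\<close>; this uniformity is what the later statements about all feasible sequences
  rest on.\<close>

lemma SOS_pairing_eventually:
  assumes "s \<in> SOS"
  shows "\<forall>\<^sub>F k in sequentially. \<forall>w. loc_psd k q w \<longrightarrow> 0 \<le> pairing (q * s) w"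
proof -
  obtain m :: nat and r where s: "s = (\<Sum>i<m. r i ^ 2)" using assms by (auto simp: SOS_def)
  have "\<forall>\<^sub>F k in sequentially. \<forall>i\<in>{..<m}. 2 * tdeg (r i) + tdeg q \<le> 2 * k"
  proof (rule eventually_ball_finite)
    show "\<forall>i\<in>{..<m}. \<forall>\<^sub>F k in sequentially. 2 * tdeg (r i) + tdeg q \<le> 2 * k"
    proof
      fix i
      show "\<forall>\<^sub>F k in sequentially. 2 * tdeg (r i) + tdeg q \<le> 2 * k"
        using eventually_ge_at_top[of "2 * tdeg (r i) + tdeg q"] by eventually_elim simp
    qed
  qed simp
  then show ?thesis
    by eventually_elim (auto simp: s sum_distrib_left pairing_sum intro!: sum_nonneg loc_psd_pairing)
qed

text \<open>The moments of a point mass \<open>a\<close> at \<open>u\<close>; the mass is left free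
  so that the moment of x_0^d can be normalized.\<close>

definition point_moments :: "nat \<Rightarrow> real \<Rightarrow> real ^ 'v \<Rightarrow> 'v::finite exponent \<Rightarrow> real" where
  "point_moments k a u = (\<lambda>\<alpha>\<in>exponents_le (2 * k). a * eval (monomial \<alpha>) u)"

lemma pairing_point_moments:
  assumes "tdeg p \<le> 2 * k" shows "pairing p (point_moments k a u) = a * eval p u"
proof -
  have "pairing p (point_moments k a u)
      = (\<Sum>\<alpha>\<in>Poly_Mapping.keys p. a * (Poly_Mapping.lookup p \<alpha> * eval (monomial \<alpha>) u))"
    unfolding pairing_def
    by (intro sum.cong refl)
      (use assms in \<open>auto simp: point_moments_def exponents_le_def tdeg_le_iff\<close>)
  then show ?thesis by (simp add: sum_distrib_left eval_def[of p] eval_monomial)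
qed

lemma point_moments_loc_vec_zero:
  assumes "eval q u = 0" shows "loc_vec_zero k q (point_moments k a u)"
  unfolding loc_vec_zero_def
proof (intro allI impI)
  fix \<alpha> :: "'a exponent" assume "edeg \<alpha> + tdeg q \<le> 2 * k"
  then have "tdeg (q * monomial \<alpha>) \<le> 2 * k" using tdeg_mult_le[of q "monomial \<alpha>"] by simp
  then show "pairing (q * monomial \<alpha>) (point_moments k a u) = 0"
    by (simp add: pairing_point_moments assms)
qed

lemma point_moments_loc_psd:
  assumes "0 \<le> a" "0 \<le> eval q u" shows "loc_psd k q (point_moments k a u)"
  unfolding loc_psd_def psd_on_def
proof (intro conjI ballI allI)
  fix v :: "'a exponent \<Rightarrow> real"
  let ?e = "\<lambda>\<alpha>. eval (monomial \<alpha>) u"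
  have "loc_matrix q (point_moments k a u) \<alpha> \<beta> = a * eval q u * (?e \<alpha> * ?e \<beta>)"
    if "\<alpha> \<in> loc_index q k" "\<beta> \<in> loc_index q k" for \<alpha> \<beta>
  proof -
    have "tdeg (q * monomial \<alpha> * monomial \<beta>) \<le> tdeg q + edeg \<alpha> + edeg \<beta>"
      using tdeg_mult_le[of "q * monomial \<alpha>" "monomial \<beta>"] tdeg_mult_le[of q "monomial \<alpha>"] by simp
    also have "\<dots> \<le> 2 * k" using that by (simp add: loc_index_def)
    finally show ?thesis by (simp add: loc_matrix_def pairing_point_moments)
  qed
  then have "(\<Sum>\<alpha>\<in>loc_index q k. \<Sum>\<beta>\<in>loc_index q k. v \<alpha> * loc_matrix q (point_moments k a u) \<alpha> \<beta> * v \<beta>)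
      = a * eval q u * ((\<Sum>\<alpha>\<in>loc_index q k. v \<alpha> * ?e \<alpha>) * (\<Sum>\<alpha>\<in>loc_index q k. v \<alpha> * ?e \<alpha>))"
    unfolding sum_product by (simp add: sum_distrib_left mult_ac)
  also have "\<dots> \<ge> 0" using assms by simp
  finally show "0 \<le> (\<Sum>\<alpha>\<in>loc_index q k. \<Sum>\<beta>\<in>loc_index q k. v \<alpha> * loc_matrix q (point_moments k a u) \<alpha> \<beta> * v \<beta>)" .
qed (rule loc_matrix_sym)

section \<open>Flat truncation from recurrences\<close>

lemma loc_index_1: "loc_index 1 t = exponents_le t"
  by (auto simp: loc_index_def exponents_le_def)

lemma loc_matrix_1: "loc_matrix 1 w \<alpha> \<beta> = w (\<alpha> + \<beta>)"
  by (simp add: loc_matrix_def monomial_add[symmetric])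

lemma lookup_scaleR_mpoly: "Poly_Mapping.lookup (a *\<^sub>R p) x = a * Poly_Mapping.lookup p x"
  for p :: "'b \<Rightarrow>\<^sub>0 real"
  by (simp add: scaleR_poly_mapping_def Poly_Mapping.map.rep_eq when_def)

text \<open>An exponent of degree above \<open>s\<close> contains some variable to the power
  \<open>r\<close> and is therefore reducible by the recurrence. For columns this gives equal spans;
  for rows it makes the truncation of columns to degree at most \<open>s\<close> injective on that
  span.\<close>

lemma moment_rank_eq:
  fixes w :: "'v::finite exponent \<Rightarrow> real"
  assumes rec: "\<And>i \<alpha>. edeg \<alpha> + r \<le> 2 * t \<Longrightarrow>
      w (\<alpha> + Poly_Mapping.single i r) = (\<Sum>n<r. c i n * w (\<alpha> + Poly_Mapping.single i n))"
    and st: "CARD('v) * r \<le> s" "s \<le> t"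
  shows "moment_rank s (restrict w (exponents_le (2 * t))) = moment_rank t (restrict w (exponents_le (2 * t)))"
proof -
  define A where "A n = (exponents_le n :: 'v exponent set)" for n
  define col where "col n \<beta> = (\<Sum>\<alpha>\<in>A n. Poly_Mapping.single \<alpha> (w (\<alpha> + \<beta>)))" for n \<beta>
  have fin: "finite (A n)" for n unfolding A_def by (rule finite_exponents_le)
  have A: "\<alpha> \<in> A n \<longleftrightarrow> edeg \<alpha> \<le> n" for \<alpha> n by (simp add: A_def exponents_le_def)
  have lookup_col: "Poly_Mapping.lookup (col n \<beta>) \<alpha> = (if \<alpha> \<in> A n then w (\<alpha> + \<beta>) else 0)" for n \<beta> \<alpha>
    unfolding col_def lookup_sum lookup_single when_def using fin by (simp add: sum.delta)
  have rank: "moment_rank n (restrict w (exponents_le (2 * t))) = dim (col n ` A n)" if "n \<le> t" for n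
  proof -
    have "restrict w (exponents_le (2 * t)) (\<alpha> + \<beta>) = w (\<alpha> + \<beta>)" if "\<alpha> \<in> A n" "\<beta> \<in> A n" for \<alpha> \<beta>
      using that \<open>n \<le> t\<close> by (simp add: A exponents_le_def edeg_add)
    then have "(\<Sum>\<alpha>\<in>A n. Poly_Mapping.single \<alpha> (restrict w (exponents_le (2 * t)) (\<alpha> + \<beta>))) = col n \<beta>"
      if "\<beta> \<in> A n" for \<beta>
      using that unfolding col_def by (intro sum.cong) auto
    then show ?thesis
      unfolding moment_rank_def rank_on_def loc_index_1 loc_matrix_1 A_def[symmetric]
      by (intro arg_cong[of _ _ dim] image_cong) auto
  qed
  have split: "\<exists>i \<alpha>'. \<alpha> = \<alpha>' + Poly_Mapping.single i r" if "s < edeg \<alpha>" for \<alpha> :: "'v exponent"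
  proof -
    have "\<exists>i. r \<le> Poly_Mapping.lookup \<alpha> i"
    proof (rule ccontr)
      assume "\<nexists>i. r \<le> Poly_Mapping.lookup \<alpha> i"
      then have "edeg \<alpha> \<le> CARD('v) * r"
        unfolding edeg_def by (intro order_trans[OF sum_bounded_above[of UNIV _ r]]) (auto simp: not_le less_imp_le)
      then show False using st that by simp
    qed
    then obtain i where i: "r \<le> Poly_Mapping.lookup \<alpha> i" ..
    have "\<alpha> = (\<alpha> - Poly_Mapping.single i r) + Poly_Mapping.single i r"
      by (rule poly_mapping_eqI) (use i in \<open>auto simp: lookup_add lookup_minus lookup_single when_def\<close>)
    then show ?thesis by blast
  qed
  have col_span: "col t \<beta> \<in> span (col t ` A s)" if "\<beta> \<in> A t" for \<beta>
    using that
  proof (induction "edeg \<beta>" arbitrary: \<beta> rule: less_induct)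
    case less
    show ?case
    proof (cases "edeg \<beta> \<le> s")
      case True
      then show ?thesis by (intro span_base) (auto simp: A)
    next
      case False
      then obtain i \<beta>' where \<beta>: "\<beta> = \<beta>' + Poly_Mapping.single i r" using split by force
      have "col t \<beta> = (\<Sum>n<r. c i n *\<^sub>R col t (\<beta>' + Poly_Mapping.single i n))"
      proof (rule poly_mapping_eqI)
        fix \<alpha>
        have "w (\<alpha> + \<beta>) = (\<Sum>n<r. c i n * w (\<alpha> + (\<beta>' + Poly_Mapping.single i n)))" if "\<alpha> \<in> A t"
          using rec[of "\<alpha> + \<beta>'" i] that less.prems by (simp add: A \<beta> edeg_add add.assoc)
        then show "Poly_Mapping.lookup (col t \<beta>) \<alpha>
            = Poly_Mapping.lookup (\<Sum>n<r. c i n *\<^sub>R col t (\<beta>' + Poly_Mapping.single i n)) \<alpha>"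
          by (simp add: lookup_sum lookup_scaleR_mpoly lookup_col)
      qed
      also have "\<dots> \<in> span (col t ` A s)"
        using less.prems by (intro span_sum span_scale less.hyps) (auto simp: A \<beta> edeg_add)
      finally show ?thesis .
    qed
  qed
  define \<rho> where "\<rho> p = (\<Sum>\<alpha>\<in>A s. Poly_Mapping.single \<alpha> (Poly_Mapping.lookup p \<alpha>))"
    for p :: "'v exponent \<Rightarrow>\<^sub>0 real"
  have lookup_\<rho>: "Poly_Mapping.lookup (\<rho> p) \<alpha> = (if \<alpha> \<in> A s then Poly_Mapping.lookup p \<alpha> else 0)" for p \<alpha>
    unfolding \<rho>_def lookup_sum lookup_single when_def using fin by (simp add: sum.delta)
  have lin: "linear \<rho>"
    by (rule linearI; rule poly_mapping_eqI) (auto simp: lookup_\<rho> lookup_add lookup_scaleR_mpoly)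
  have \<rho>_col: "\<rho> (col t \<beta>) = col s \<beta>" for \<beta>
    by (rule poly_mapping_eqI) (use st(2) in \<open>auto simp: lookup_\<rho> lookup_col A\<close>)
  \<comment> \<open>Rows obey the same recurrence as columns because the entries depend on \<alpha>
    + \<beta> only. An element of \<open>V\<close> is determined by its entries of degree at most
    \<open>s\<close>.\<close>
  define V where "V = {p :: 'v exponent \<Rightarrow>\<^sub>0 real. Poly_Mapping.keys p \<subseteq> A t \<and>
    (\<forall>i \<alpha>. edeg \<alpha> + r \<le> t \<longrightarrow> Poly_Mapping.lookup p (\<alpha> + Poly_Mapping.single i r)
       = (\<Sum>n<r. c i n * Poly_Mapping.lookup p (\<alpha> + Poly_Mapping.single i n)))}"
  have "subspace V"
  proof (rule subspaceI)
    fix p p' :: "'v exponent \<Rightarrow>\<^sub>0 real" assume p: "p \<in> V"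
    show "a *\<^sub>R p \<in> V" for a
      using p by (auto simp: V_def in_keys_iff lookup_scaleR_mpoly sum_distrib_left mult_ac subset_iff)
    assume "p' \<in> V"
    then show "p + p' \<in> V"
      using p Poly_Mapping.keys_add[of p p'] by (auto simp: V_def lookup_add distrib_left sum.distrib)
  qed (simp add: V_def)
  moreover have "col t \<beta> \<in> V" if \<beta>: "\<beta> \<in> A t" for \<beta>
    unfolding V_def
  proof (intro CollectI conjI allI impI)
    show "Poly_Mapping.keys (col t \<beta>) \<subseteq> A t" by (auto simp: in_keys_iff lookup_col split: if_splits)
    fix i and \<alpha> :: "'v exponent" assume \<alpha>: "edeg \<alpha> + r \<le> t"
    have "w (\<alpha> + Poly_Mapping.single i r + \<beta>) = (\<Sum>n<r. c i n * w (\<alpha> + Poly_Mapping.single i n + \<beta>))"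
      using rec[of "\<alpha> + \<beta>" i] \<alpha> \<beta> by (simp add: A edeg_add add_ac)
    then show "Poly_Mapping.lookup (col t \<beta>) (\<alpha> + Poly_Mapping.single i r)
       = (\<Sum>n<r. c i n * Poly_Mapping.lookup (col t \<beta>) (\<alpha> + Poly_Mapping.single i n))"
      using \<alpha> by (simp add: lookup_col A edeg_add)
  qed
  ultimately have WV: "span (col t ` A t) \<subseteq> V"
    by (intro span_minimal) auto
  have V0: "p = 0" if p: "p \<in> V" "\<rho> p = 0" for p
  proof (rule poly_mapping_eqI)
    have s0: "Poly_Mapping.lookup p \<alpha> = 0" if "\<alpha> \<in> A s" for \<alpha>
      using arg_cong[OF p(2), of "\<lambda>p. Poly_Mapping.lookup p \<alpha>"] that by (simp add: lookup_\<rho>)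
    have "Poly_Mapping.lookup p \<alpha> = 0" if "\<alpha> \<in> A t" for \<alpha>
      using that
    proof (induction "edeg \<alpha>" arbitrary: \<alpha> rule: less_induct)
      case less
      show ?case
      proof (cases "edeg \<alpha> \<le> s")
        case True
        then show ?thesis by (intro s0) (simp add: A)
      next
        case False
        then obtain i \<alpha>' where \<alpha>: "\<alpha> = \<alpha>' + Poly_Mapping.single i r" using split by force
        have "Poly_Mapping.lookup p \<alpha> = (\<Sum>n<r. c i n * Poly_Mapping.lookup p (\<alpha>' + Poly_Mapping.single i n))"
          using p(1) less.prems by (simp add: V_def \<alpha> A edeg_add)
        also have "\<dots> = 0"
          using less.prems by (intro sum.neutral ballI) (simp add: less.hyps \<alpha> A edeg_add)
        finally show ?thesis .
      qed
    qed
    then show "Poly_Mapping.lookup p \<alpha> = Poly_Mapping.lookup 0 \<alpha>" for \<alpha>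
      using p(1) by (cases "\<alpha> \<in> A t") (auto simp: V_def in_keys_iff)
  qed
  have AsAt: "A s \<subseteq> A t" using st(2) by (auto simp: A)
  have span_eq: "span (col t ` A t) = span (col t ` A s)"
  proof
    show "span (col t ` A t) \<subseteq> span (col t ` A s)" by (rule span_minimal) (auto intro: col_span)
    show "span (col t ` A s) \<subseteq> span (col t ` A t)" by (intro span_mono image_mono AsAt)
  qed
  obtain B where B: "B \<subseteq> col t ` A s" "independent B" and "col t ` A s \<subseteq> span B"
    using maximal_independent_subset[of "col t ` A s"] by auto
  then have B_span: "span B = span (col t ` A s)"
    by (intro subset_antisym span_mono span_minimal subspace_span)
  have inj: "inj_on \<rho> (span B)"
    unfolding linear_inj_on_iff_eq_0[OF lin subspace_span]
    using V0 WV B_span span_eq by auto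
  have "independent (\<rho> ` B)"
    by (rule linear_independent_injective_image[OF lin B(2) inj])
  moreover have "span (\<rho> ` B) = span (col s ` A s)"
  proof -
    have "span (\<rho> ` B) = \<rho> ` span (col t ` A s)"
      by (simp add: linear_span_image[OF lin] B_span)
    also have "\<dots> = span (\<rho> ` col t ` A s)"
      by (rule linear_span_image[OF lin, symmetric])
    finally show ?thesis by (simp add: image_image \<rho>_col)
  qed
  ultimately have "dim (col s ` A s) = card (\<rho> ` B)" by (intro dim_eq_card)
  also have "\<dots> = card B"
    by (intro card_image inj_on_subset[OF inj] span_superset)
  also have "\<dots> = dim (col t ` A t)"
    using B B_span span_eq by (intro dim_eq_card[symmetric]) auto
  finally show ?thesis using rank[OF st(2)] rank[of t] by simp
qed

text \<open>The leading power is isolated so that annihilating the product reads as a recurrence of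
  order \<open>card X\<close>.\<close>

lemma monic_product_expansion:
  fixes l :: "'v::finite mpoly"
  assumes "finite X"
  shows "\<exists>c. (\<Prod>u\<in>X. l - Const (h u)) = l ^ card X - (\<Sum>n<card X. Const (c n) * l ^ n)"
  using assms
proof (induction X rule: finite_induct)
  case empty
  then show ?case by simp
next
  case (insert x X)
  then obtain c where c: "(\<Prod>u\<in>X. l - Const (h u)) = l ^ card X - (\<Sum>n<card X. Const (c n) * l ^ n)" by blast
  let ?r = "card X"
  define c' where "c' n = (if n = 0 then 0 else c (n - 1)) + (if n = ?r then h x else - h x * c n)" for n
  have "(\<Sum>n<Suc ?r. Const (c' n) * l ^ n)
      = (\<Sum>n<?r. Const (c n) * l ^ Suc n) + Const (h x) * l ^ ?r - Const (h x) * (\<Sum>n<?r. Const (c n) * l ^ n)"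
  proof -
    have "(\<Sum>n<Suc ?r. Const (c' n) * l ^ n)
      = (\<Sum>n<Suc ?r. Const (if n = 0 then 0 else c (n - 1)) * l ^ n)
        + (\<Sum>n<Suc ?r. Const (if n = ?r then h x else - h x * c n) * l ^ n)"
      by (simp only: c'_def Const_add distrib_right sum.distrib)
    also have "(\<Sum>n<Suc ?r. Const (if n = 0 then 0 else c (n - 1)) * l ^ n) = (\<Sum>n<?r. Const (c n) * l ^ Suc n)"
      by (subst sum.lessThan_Suc_shift) simp
    also have "(\<Sum>n<Suc ?r. Const (if n = ?r then h x else - h x * c n) * l ^ n)
        = Const (h x) * l ^ ?r - Const (h x) * (\<Sum>n<?r. Const (c n) * l ^ n)"
      by (simp add: Const_mult Const_uminus sum_distrib_left sum_negf mult.assoc)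
    finally show ?thesis by (simp add: algebra_simps)
  qed
  moreover have "(\<Prod>u\<in>insert x X. l - Const (h u))
      = l ^ Suc ?r - ((\<Sum>n<?r. Const (c n) * l ^ Suc n) + Const (h x) * l ^ ?r - Const (h x) * (\<Sum>n<?r. Const (c n) * l ^ n))"
  proof -
    have "(\<Sum>n<?r. Const (c n) * l ^ Suc n) = l * (\<Sum>n<?r. Const (c n) * l ^ n)"
      by (simp add: sum_distrib_left mult_ac)
    then show ?thesis using insert.hyps by (simp add: c algebra_simps)
  qed
  ultimately show ?case using insert.hyps by (intro exI[of _ c']) simp
qed

section \<open>Homogenized feasible points\<close>

lemma norm_option: "(norm (u :: real ^ 'n::finite option))\<^sup>2 = (u $ None)\<^sup>2 + (\<Sum>i\<in>UNIV. (u $ Some i)\<^sup>2)"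
  unfolding norm_vec_sq[symmetric] by (simp add: UNIV_option_conv sum.reindex)

lemma hom_set_iff:
  "u \<in> hom_set c E I \<longleftrightarrow> (\<forall>j\<in>E. eval (homogenize (c j)) u = 0) \<and> (\<forall>j\<in>I. 0 \<le> eval (homogenize (c j)) u)
     \<and> norm u = 1 \<and> 0 \<le> u $ None"
proof -
  have "(norm u)\<^sup>2 = 1 \<longleftrightarrow> norm u = 1" using power2_eq_iff_nonneg[of "norm u" 1] by simp
  then show ?thesis by (auto simp: hom_set_def feasible_set_def hom_eq_def hom_in_def)
qed

lemma hom_set_affine:
  assumes "u \<in> hom_set c E I" "0 < u $ None"
  shows "(\<chi> i. u $ Some i / u $ None) \<in> feasible_set (\<lambda>j. eval (c j)) E I"
proof -
  have "eval (homogenize p) u = u $ None ^ tdeg p * eval p (\<chi> i. u $ Some i / u $ None)" for p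
    using assms(2) by (intro eval_homogenize) simp
  then show ?thesis
    using assms by (auto simp: hom_set_iff feasible_set_def zero_le_mult_iff)
      (metis not_less zero_less_power)
qed

text \<open>Central projection of (1, x) to the unit sphere. The bound on the first coordinate
  serves to compare u_0^d (f(x) - fmin) with f(x) - fmin.\<close>

lemma affine_hom_set:
  assumes "x \<in> feasible_set (\<lambda>j. eval (c j)) E I"
  obtains u where "u \<in> hom_set c E I" "0 < u $ None" "u $ None \<le> 1" "(\<chi> i. u $ Some i / u $ None) = x"
proof -
  define s where "s = 1 / sqrt (1 + (norm x)\<^sup>2)"
  have pos: "0 < 1 + (norm x)\<^sup>2" by (simp add: add_pos_nonneg)
  have s: "0 < s" "s\<^sup>2 * (1 + (norm x)\<^sup>2) = 1"
    using pos by (simp_all add: s_def power_divide)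
  define u :: "real ^ 'a option" where "u = (\<chi> k. case k of None \<Rightarrow> s | Some i \<Rightarrow> s * x $ i)"
  have u: "u $ None = s" "u $ Some i = s * x $ i" for i by (simp_all add: u_def)
  have x: "(\<chi> i. u $ Some i / u $ None) = x" using s(1) by (simp add: u vec_eq_iff)
  have "(norm u)\<^sup>2 = s\<^sup>2 * (1 + (norm x)\<^sup>2)"
    unfolding norm_option norm_vec_sq[of x, symmetric] u
    by (simp add: power_mult_distrib sum_distrib_left distrib_left)
  then have n: "norm u = 1" using s(2) power2_eq_iff_nonneg[of "norm u" 1] by simp
  have "eval (homogenize p) u = s ^ tdeg p * eval p x" for p
    using eval_homogenize[of u p] s(1) unfolding x u by simp
  then have "u \<in> hom_set c E I"
    using assms s(1) by (auto simp: hom_set_iff n u feasible_set_def)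
  moreover have "u $ None \<le> 1" using component_le_norm_cart[of u None] n by simp
  ultimately show ?thesis using that x s(1) by (simp add: u)
qed

text \<open>Serves the case d = 0, in which perturbing \<open>f\<close> by a multiple of x_i^d says
  nothing about points at infinity.\<close>

lemma homogenize_tdeg_0:
  assumes "tdeg f = 0" shows "\<exists>b. homogenize f = Const b"
proof -
  have "hom_exponent 0 \<alpha> = 0" if "\<alpha> \<in> Poly_Mapping.keys f" for \<alpha>
  proof (rule poly_mapping_eqI)
    fix k
    have "edeg \<alpha> = 0" using edeg_le_tdeg[OF that] assms by simp
    then have "Poly_Mapping.lookup \<alpha> i = 0" for i by (simp add: edeg_def)
    then show "Poly_Mapping.lookup (hom_exponent 0 \<alpha>) k = Poly_Mapping.lookup 0 k"
      by (cases k) (simp_all add: lookup_hom_exponent)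
  qed
  then have "homogenize f = (\<Sum>\<alpha>\<in>Poly_Mapping.keys f. Const (Poly_Mapping.lookup f \<alpha>))"
    unfolding homogenize_def assms Const_def by (intro sum.cong) auto
  then show ?thesis by (metis Const_sum)
qed

section \<open>Perturbations, truncation and weak duality\<close>

text \<open>The form in which the interior hypothesis is applied: with q = 0 it bounds
  \<open>f\<close> from below on K, and with signed powers x_i^d it excludes zeros at
  infinity.\<close>

lemma interior_direction:
  assumes "f - Const a \<in> int_nonneg_polys d K" "tdeg q \<le> d"
  shows "\<exists>\<delta>>0. \<forall>x\<in>K. 0 \<le> eval f x - a + \<delta> * eval q x"
proof -
  obtain U where U: "openin (top_of_set (polys_le d)) U" "f - Const a \<in> U" "U \<subseteq> nonneg_polys d K"
    using assms(1) by (auto simp: int_nonneg_polys_def interior_of_def)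
  then obtain e where e: "0 < e" "\<And>p. p \<in> polys_le d \<Longrightarrow> dist p (f - Const a) < e \<Longrightarrow> p \<in> U"
    by (auto simp: openin_euclidean_subtopology_iff)
  \<comment> \<open>The summand 1 makes \<delta> * norm q < e strict and covers q = 0.\<close>
  define \<delta> where "\<delta> = e / (norm q + 1)"
  have \<delta>: "0 < \<delta>" using e(1) by (simp add: \<delta>_def add_nonneg_pos)
  have "0 < norm q + 1" by (simp add: add_nonneg_pos)
  then have "\<delta> * norm q + \<delta> = e" by (simp add: \<delta>_def distrib_left[symmetric] add_divide_distrib[symmetric] field_simps)
  then have "\<delta> * norm q < e" using \<delta> by linarith
  have sc: "\<delta> *\<^sub>R q = Const \<delta> * q"
    by (rule poly_mapping_eqI) (simp add: lookup_scaleR_mpoly lookup_Const_mult)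
  have "f - Const a \<in> polys_le d" using U by (auto simp: nonneg_polys_def)
  then have "f - Const a + \<delta> *\<^sub>R q \<in> polys_le d"
    using assms(2) unfolding sc by (auto simp: polys_le_def intro!: tdeg_add_le tdeg_Const_mult_le)
  moreover have "dist (f - Const a + \<delta> *\<^sub>R q) (f - Const a) < e"
    using \<open>\<delta> * norm q < e\<close> \<delta> by (simp add: dist_norm)
  ultimately have "f - Const a + \<delta> *\<^sub>R q \<in> nonneg_polys d K" using e(2) U(3) by blast
  then show ?thesis using \<delta> unfolding sc by (intro exI[of _ \<delta>]) (auto simp: nonneg_polys_def)
qed

text \<open>One representation has some finite degree, so it is admissible in all relaxations of
  sufficiently high order.\<close>

lemma qmod_truncation:
  assumes "finite J" "finite L" "p \<in> qmod q J L"
  shows "\<forall>\<^sub>F k in sequentially. \<exists>a\<in>trunc_ideal q J (2 * k). \<exists>b\<in>trunc_qmodule q L (2 * k). p = a + b"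
proof -
  obtain r s0 s where *: "s0 \<in> SOS" "\<And>j. j \<in> L \<Longrightarrow> s j \<in> SOS"
    "p = (\<Sum>j\<in>J. q j * r j) + (s0 + (\<Sum>j\<in>L. q j * s j))"
    using assms(3) by (rule qmodE) blast
  define N where "N = (\<Sum>j\<in>J. tdeg (q j) + tdeg (r j)) + tdeg s0 + (\<Sum>j\<in>L. tdeg (q j) + tdeg (s j))"
  have "tdeg (q j) + tdeg (r j) \<le> N" if "j \<in> J" for j
    using member_le_sum[of j J "\<lambda>j. tdeg (q j) + tdeg (r j)"] assms that by (simp add: N_def)
  moreover have "tdeg (q j) + tdeg (s j) \<le> N" if "j \<in> L" for j
    using member_le_sum[of j L "\<lambda>j. tdeg (q j) + tdeg (s j)"] assms that by (simp add: N_def)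
  moreover have "tdeg s0 \<le> N" by (simp add: N_def)
  ultimately have trunc: "(\<Sum>j\<in>J. q j * r j) \<in> trunc_ideal q J (2 * k) \<and>
      s0 + (\<Sum>j\<in>L. q j * s j) \<in> trunc_qmodule q L (2 * k)" if "N \<le> k" for k
    using that * unfolding trunc_ideal_def trunc_qmodule_def by (fastforce intro!: exI)
  show ?thesis
    using eventually_ge_at_top[of N] unfolding *(3) by eventually_elim (use trunc in blast)
qed

lemma trunc_subset_qmod:
  assumes "a \<in> trunc_ideal q J k" "b \<in> trunc_qmodule q L k" shows "a + b \<in> qmod q J L"
  using assms unfolding trunc_ideal_def trunc_qmodule_def qmod_def by blast

text \<open>Weak duality for one fixed certificate: its finitely many terms are covered by the
  localizing conditions as soon as \<open>k\<close> exceeds their degrees, for all feasible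
  \<open>w\<close> at once.\<close>

lemma qmod_pairing_nonneg:
  fixes c :: "'j \<Rightarrow> 'n::finite mpoly"
  assumes "finite E" "finite I" "p \<in> qmod (hom_con c) (hom_eq E) (hom_in I)"
  shows "\<forall>\<^sub>F k in sequentially. \<forall>w\<in>moment_feasible f c E I k. 0 \<le> pairing p w"
proof -
  obtain r s0 s where *: "s0 \<in> SOS" "\<And>j. j \<in> hom_in I \<Longrightarrow> s j \<in> SOS"
    "p = (\<Sum>j\<in>hom_eq E. hom_con c j * r j) + (s0 + (\<Sum>j\<in>hom_in I. hom_con c j * s j))"
    using assms(3) by (rule qmodE) blast
  have fin: "finite (hom_eq E)" "finite (hom_in I)" using assms by (simp_all add: hom_eq_def hom_in_def)
  have lz: "\<forall>\<^sub>F k in sequentially. \<forall>w. loc_vec_zero k q w \<longrightarrow> pairing (q * p) w = 0" for q p :: "'n option mpoly"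
    using eventually_ge_at_top[of "tdeg q + tdeg p"]
    by eventually_elim (auto intro!: loc_vec_zero_pairing)
  have 1: "\<forall>\<^sub>F k in sequentially. \<forall>j\<in>hom_eq E. \<forall>w\<in>moment_feasible f c E I k. pairing (hom_con c j * r j) w = 0"
  proof (rule eventually_ball_finite[OF fin(1)], rule ballI)
    fix j assume "j \<in> hom_eq E"
    then consider i where "j = Orig i" "i \<in> E" | "j = Sphere" by (auto simp: hom_eq_def)
    then show "\<forall>\<^sub>F k in sequentially. \<forall>w\<in>moment_feasible f c E I k. pairing (hom_con c j * r j) w = 0"
    proof cases
      case 1
      from lz[of "homogenize (c i)" "r j"] show ?thesis
        by eventually_elim (use 1 in \<open>auto simp: moment_feasible_def\<close>)
    next
      case 2
      \<comment> \<open>The moment relaxation states the sphere equation with the opposite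
        sign.\<close>
      have e: "hom_con c j * r j = (1 - norm_sq_poly) * (- r j)" by (simp add: 2 algebra_simps)
      from lz[of "1 - norm_sq_poly" "- r j"] show ?thesis
        unfolding e by eventually_elim (auto simp: moment_feasible_def)
    qed
  qed
  have 2: "\<forall>\<^sub>F k in sequentially. \<forall>j\<in>hom_in I. \<forall>w\<in>moment_feasible f c E I k. 0 \<le> pairing (hom_con c j * s j) w"
  proof (rule eventually_ball_finite[OF fin(2)], rule ballI)
    fix j assume j: "j \<in> hom_in I"
    from SOS_pairing_eventually[OF *(2)[OF j], of "hom_con c j"]
    show "\<forall>\<^sub>F k in sequentially. \<forall>w\<in>moment_feasible f c E I k. 0 \<le> pairing (hom_con c j * s j) w"
      by eventually_elim (use j in \<open>auto simp: hom_in_def moment_feasible_def\<close>)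
  qed
  have 3: "\<forall>\<^sub>F k in sequentially. \<forall>w\<in>moment_feasible f c E I k. 0 \<le> pairing s0 w"
    using SOS_pairing_eventually[OF *(1), of 1]
    by eventually_elim (auto simp: moment_feasible_def)
  show ?thesis
    using 1 2 3
    by eventually_elim (auto simp: *(3) pairing_add pairing_sum intro!: add_nonneg_nonneg sum_nonneg)
qed

text \<open>The discriminant argument; t = -x / (1 + y) makes the quadratic negative unless x = 0
  and is defined also for y = 0.\<close>

lemma zero_if_quadratic_nonneg:
  fixes x y :: real
  assumes "\<And>t. 0 \<le> 2 * t * x + t\<^sup>2 * y" "0 \<le> y"
  shows "x = 0"
proof -
  have y: "0 < 1 + y" using assms(2) by simp
  have "0 \<le> (2 * (- x / (1 + y)) * x + (- x / (1 + y))\<^sup>2 * y) * (1 + y)\<^sup>2"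
    using assms(1)[of "- x / (1 + y)"] by (intro mult_nonneg_nonneg) auto
  also have "\<dots> = - (x\<^sup>2 * (2 + y))"
    using y by (simp add: power_divide power2_eq_square divide_simps) (simp add: algebra_simps)
  finally have "x\<^sup>2 * (2 + y) \<le> 0" by simp
  then show ?thesis using assms(2) by (simp add: mult_le_0_iff)
qed

section \<open>Polynomials annihilated by moment minimizers\<close>

text \<open>The threshold for \<open>k\<close> may depend on \<open>p\<close>. Finitely many
  polynomials share a threshold, and flat truncation at a fixed order involves only finitely
  many.\<close>

definition eventually_null ::
    "'n::finite mpoly \<Rightarrow> ('j \<Rightarrow> 'n mpoly) \<Rightarrow> 'j set \<Rightarrow> 'j set \<Rightarrow> 'n option mpoly set" where
  "eventually_null f c E I =
     {p. \<forall>\<^sub>F k in sequentially. \<forall>w. moment_minimizer f c E I k w \<longrightarrow> pairing p w = 0}"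

lemma eventually_null_add:
  "p \<in> eventually_null f c E I \<Longrightarrow> r \<in> eventually_null f c E I \<Longrightarrow> p + r \<in> eventually_null f c E I"
  unfolding eventually_null_def mem_Collect_eq
  by (erule (1) eventually_elim2) (simp add: pairing_add)

lemma eventually_null_sum:
  "(\<And>a. a \<in> A \<Longrightarrow> h a \<in> eventually_null f c E I) \<Longrightarrow> sum h A \<in> eventually_null f c E I"
  by (induction A rule: infinite_finite_induct)
    (auto simp: eventually_null_add, auto simp: eventually_null_def)

lemma minimizer_feasible: "moment_minimizer f c E I k w \<Longrightarrow> w \<in> moment_feasible f c E I k"
  by (simp add: moment_minimizer_def is_arg_min_def)

lemma moment_square_nonneg:
  assumes "w \<in> moment_feasible f c E I k" "tdeg p \<le> k" shows "0 \<le> pairing (p\<^sup>2) w"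
  using loc_psd_pairing[of k 1 w p] assms by (simp add: moment_feasible_def)

text \<open>Cauchy-Schwarz for the positive semidefinite moment form: if \<open>r\<^sup>2\<close>
  has moment zero, \<open>r\<close> is orthogonal to every polynomial of degree at most
  \<open>k\<close>.\<close>

lemma eventually_null_mult:
  assumes "r\<^sup>2 \<in> eventually_null f c E I"
  shows "r * p \<in> eventually_null f c E I"
proof -
  have "\<forall>\<^sub>F k in sequentially. \<forall>w. moment_minimizer f c E I k w \<longrightarrow> pairing (r\<^sup>2) w = 0"
    using assms by (simp add: eventually_null_def)
  then have "\<forall>\<^sub>F k in sequentially. \<forall>w. moment_minimizer f c E I k w \<longrightarrow> pairing (r * p) w = 0"
    using eventually_ge_at_top[of "max (tdeg r) (tdeg p)"]
  proof eventually_elim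
    case (elim k)
    show ?case
    proof (intro allI impI)
      fix w assume w: "moment_minimizer f c E I k w"
      note feas = minimizer_feasible[OF w]
      show "pairing (r * p) w = 0"
      proof (rule zero_if_quadratic_nonneg)
        show "0 \<le> pairing (p\<^sup>2) w" using moment_square_nonneg[OF feas] elim by simp
        fix t
        have "tdeg (r + Const t * p) \<le> k"
          using elim by (intro tdeg_add_le tdeg_Const_mult_le) auto
        from moment_square_nonneg[OF feas this]
        have "0 \<le> pairing ((r + Const t * p)\<^sup>2) w" .
        also have "(r + Const t * p)\<^sup>2 = r\<^sup>2 + (Const (2 * t) * (r * p) + Const (t\<^sup>2) * p\<^sup>2)"
          by (simp add: Const_mult Const_power power2_eq_square algebra_simps)
        finally show "0 \<le> 2 * t * pairing (r * p) w + t\<^sup>2 * pairing (p\<^sup>2) w"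
          using elim(1) w by (simp add: pairing_add pairing_Const_mult)
      qed
    qed
  qed
  then show ?thesis by (simp add: eventually_null_def)
qed

theorem theorem4p5:
  fixes f :: "'n::finite mpoly"
    and c :: "'j \<Rightarrow> 'n mpoly"
    and E I :: "'j set"
    and d :: nat
    and K :: "(real ^ 'n) set"
    and fmin :: real
    and F :: "real ^ 'n option \<Rightarrow> real"
    and g :: "'j hindex \<Rightarrow> real ^ 'n option \<Rightarrow> real"
  assumes d: "d = tdeg f"
    and index_sets: "finite E" "finite I" "E \<inter> I = {}"
    and K: "K = feasible_set (\<lambda>j. eval (c j)) E I" "K \<noteq> {}"
    and fmin: "fmin = (INF x\<in>K. eval f x)"
    and infinity: "closed_at_infinity c E I"
    and interior: "\<exists>a. f - Const a \<in> int_nonneg_polys d K"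
    and F: "F = eval (homogenize f - Const fmin * Var None ^ d)"
    and g: "g = (\<lambda>j. eval (hom_con c j))"
    and optimality: "\<And>u. is_arg_min F (\<lambda>u. u \<in> feasible_set g (hom_eq E) (hom_in I)) u \<Longrightarrow>
      LICQC g (hom_eq E) (hom_in I) u
      \<and> SCC F g (hom_eq E) (hom_in I) u
      \<and> SOSC F g (hom_eq E) (hom_in I) u"
  shows "(\<forall>\<^sub>F k in sequentially.
            sos_value f c E I k = ereal fmin \<and> moment_value f c E I k = ereal fmin)
       \<and> (\<forall>\<^sub>F k in sequentially.
            \<forall>w. moment_minimizer f c E I k w \<longrightarrow> flat_truncation d c E I k w)"
proof -

  \<comment> \<open>Zeros of \<open>P\<close> on the homogenized feasible set\<close>
  define P where "P = homogenize f - Const fmin * Var None ^ d"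
  define S where "S = hom_set c E I"
  have S_eq: "S = feasible_set g (hom_eq E) (hom_in I)" by (simp add: S_def hom_set_def g)
  have F_eval: "F = eval P" by (simp add: F P_def)
  interpret spherical_system "hom_con c" "hom_eq E" "hom_in I" Sphere
    by unfold_locales (simp_all add: hom_eq_def hom_in_def index_sets)
  have S_loc: "S = feasible_set (\<lambda>j. eval (hom_con c j)) (hom_eq E) (hom_in I)" by (simp add: S_eq g)
  have disj: "hom_eq E \<inter> hom_in I = {}" using index_sets(3) by (auto simp: hom_eq_def hom_in_def)
  obtain a where a: "f - Const a \<in> int_nonneg_polys d K" using interior by blast
  have low: "a \<le> eval f x" if "x \<in> K" for x
    using interior_direction[OF a, of 0] that by (auto simp: tdeg_def)
  have fmin_le: "fmin \<le> eval f x" if "x \<in> K" for x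
    unfolding fmin by (rule cINF_lower[OF _ that]) (use low in \<open>auto simp: bdd_below_def\<close>)
  have aff: "(\<chi> i. u $ Some i / u $ None) \<in> K" if "u \<in> S" "0 < u $ None" for u
    using hom_set_affine[of u c E I] that by (simp add: S_def K(1))
  have hom_f: "eval (homogenize f) u = u $ None ^ d * eval f (\<chi> i. u $ Some i / u $ None)"
    if "0 < u $ None" for u
    unfolding d using that by (intro eval_homogenize) simp
  \<comment> \<open>Closedness at infinity enters here: polynomial inequalities on \<open>S\<close>
    need to be checked only where x_0 > 0, and such points come from \<open>K\<close>.\<close>
  have closure_nonneg: "0 \<le> eval p u" if u: "u \<in> S" and p: "\<And>y. y \<in> S \<Longrightarrow> 0 < y $ None \<Longrightarrow> 0 \<le> eval p y" for p u
  proof -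
    have "closure (S \<inter> {u. 0 < u $ None}) \<subseteq> {x. 0 \<le> eval p x}"
      by (rule closure_minimal) (auto intro!: p closed_Collect_le continuous_intros)
    moreover have "u \<in> closure (S \<inter> {u. 0 < u $ None})"
      using u infinity by (simp add: S_def closed_at_infinity_def)
    ultimately show ?thesis by blast
  qed
  have P_eval: "eval P u = u $ None ^ d * (eval f (\<chi> i. u $ Some i / u $ None) - fmin)"
    if "0 < u $ None" for u
    by (simp add: P_def hom_f that algebra_simps)
  have P_nonneg: "0 \<le> eval P u" if "u \<in> S" for u
    using that
  proof (rule closure_nonneg)
    fix y assume "y \<in> S" "0 < y $ None"
    then show "0 \<le> eval P y" using fmin_le[OF aff] by (simp add: P_eval)
  qed
  define Z where "Z = {u\<in>S. eval P u = 0}"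
  have Z_min: "is_arg_min F (\<lambda>u. u \<in> feasible_set g (hom_eq E) (hom_in I)) u" if "u \<in> Z" for u
    using that P_nonneg unfolding is_arg_min_def S_eq[symmetric] F_eval Z_def by force
  have Z_ne: "Z \<noteq> {}"
  proof -
    obtain x where "x \<in> K" using K(2) by blast
    then obtain y where "y \<in> S" using affine_hom_set[of x c E I] by (auto simp: S_def K(1))
    then have ne: "S \<noteq> {}" by blast
    have cont: "continuous_on S (eval P)" by (intro continuous_on_eval continuous_on_id)
    have "compact S" using compact_S by (simp add: S_loc)
    from continuous_attains_inf[OF this ne cont]
    obtain u where u: "u \<in> S" "\<And>y. y \<in> S \<Longrightarrow> eval P u \<le> eval P y" by blast
    \<comment> \<open>If the minimum of \<open>P\<close> were positive, f(x) - fmin \<ge> y_0^d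
      (f(x) - fmin) would exceed it on all of \<open>K\<close>, as y_0 \<le> 1, and
      \<open>fmin\<close> would not be the infimum.\<close>
    have "eval P u \<le> 0"
    proof (rule ccontr)
      assume "\<not> eval P u \<le> 0"
      then have pos: "0 < eval P u" by simp
      have "fmin + eval P u \<le> eval f x" if x: "x \<in> K" for x
      proof -
        obtain y where y: "y \<in> S" "0 < y $ None" "y $ None \<le> 1" "(\<chi> i. y $ Some i / y $ None) = x"
          using affine_hom_set[of x c E I] x by (auto simp: S_def K(1))
        have "eval P u \<le> y $ None ^ d * (eval f x - fmin)"
          using u(2)[OF y(1)] by (simp add: P_eval y)
        also have "\<dots> \<le> 1 * (eval f x - fmin)"
          using fmin_le[OF x] y by (intro mult_right_mono power_le_one) auto
        finally show ?thesis by simp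
      qed
      then have "fmin + eval P u \<le> fmin"
        unfolding fmin by (intro cINF_greatest K(2))
      then show False using pos by simp
    qed
    then have "u \<in> Z" using u(1) P_nonneg[OF u(1)] by (simp add: Z_def)
    then show ?thesis by blast
  qed
  have Z_pos: "0 < u $ None" if u: "u \<in> Z" for u
  proof (rule ccontr)
    assume "\<not> 0 < u $ None"
    then have u0: "u $ None = 0" using u by (simp add: Z_def S_def hom_set_iff)
    have uS: "u \<in> S" and uP: "eval P u = 0" using u by (auto simp: Z_def)
    show False
    proof (cases "d = 0")
      case True
      \<comment> \<open>For d = 0 the objective is constant, so zero multipliers are admissible, and
        SCC contradicts the constraint x_0 \<ge> 0 being active.\<close>
      then obtain b where b: "homogenize f = Const b" using homogenize_tdeg_0[of f] d by auto
      have "F = (\<lambda>_. b - fmin)" by (rule ext) (simp add: F_eval P_def True b)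
      then have "grad F u = 0" by (auto intro: grad_eqI GDERIV_const)
      then have "multipliers F g (hom_eq E) (hom_in I) u (\<lambda>_. 0)" by (simp add: multipliers_def)
      then have "\<forall>j\<in>hom_in I. 0 < 0 + g j u"
        using optimality[OF Z_min[OF u]] unfolding SCC_def by blast
      then show False by (simp add: hom_in_def g u0)
    next
      case False
      have "norm u = 1" using uS by (simp add: S_def hom_set_iff)
      then obtain i where i: "u $ Some i \<noteq> 0"
        using u0 by (metis norm_zero not_None_eq vec_eq_iff zero_index zero_neq_one)
      \<comment> \<open>With this sign the perturbation is negative at \<open>u\<close>, where the
        homogenization of \<open>f\<close> vanishes because x_0 = 0 and d > 0; yet the perturbed
        form is nonnegative on \<open>S\<close>.\<close>
      define \<sigma> where "\<sigma> = - sgn (u $ Some i ^ d)"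
      have "tdeg (Var i ^ d :: 'n mpoly) \<le> d" by (simp add: Var_power)
      then have "tdeg (Const \<sigma> * Var i ^ d :: 'n mpoly) \<le> d" by (rule tdeg_Const_mult_le)
      then obtain \<delta> where \<delta>: "0 < \<delta>" "\<And>x. x \<in> K \<Longrightarrow> 0 \<le> eval f x - a + \<delta> * (\<sigma> * x $ i ^ d)"
        using interior_direction[OF a, of "Const \<sigma> * Var i ^ d"] by auto
      let ?q = "homogenize f - Const a * Var None ^ d + Const (\<delta> * \<sigma>) * Var (Some i) ^ d"
      have "0 \<le> eval ?q u"
        using uS
      proof (rule closure_nonneg)
        fix y assume y: "y \<in> S" "0 < y $ None"
        have "eval ?q y = y $ None ^ d * (eval f (\<chi> i. y $ Some i / y $ None) - a
            + \<delta> * (\<sigma> * (\<chi> i. y $ Some i / y $ None) $ i ^ d))"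
          using y(2) by (simp add: hom_f power_divide field_simps)
        also have "\<dots> \<ge> 0" using \<delta>(2)[OF aff[OF y]] y(2) by (intro mult_nonneg_nonneg) auto
        finally show "0 \<le> eval ?q y" .
      qed
      also have "eval ?q u = - (\<delta> * \<bar>u $ Some i ^ d\<bar>)"
        using uP False by (simp add: P_def u0 \<sigma>_def abs_sgn mult.commute)
      finally have "\<delta> * \<bar>u $ Some i ^ d\<bar> \<le> 0" by simp
      then show False using \<delta>(1) i by (simp add: mult_le_0_iff)
    qed
  qed
  have P_nonneg': "0 \<le> eval P x"
    if "x \<in> feasible_set (\<lambda>j. eval (hom_con c j)) (hom_eq E) (hom_in I)" for x
    using that P_nonneg by (simp add: S_loc)
  have Z_eq: "Z = {x \<in> feasible_set (\<lambda>j. eval (hom_con c j)) (hom_eq E) (hom_in I). eval P x = 0}"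
    by (simp add: Z_def S_loc)
  have licq: "LICQC (\<lambda>j. eval (hom_con c j)) (hom_eq E) (hom_in I) x"
    and scc: "SCC (eval P) (\<lambda>j. eval (hom_con c j)) (hom_eq E) (hom_in I) x"
    and sosc: "SOSC (eval P) (\<lambda>j. eval (hom_con c j)) (hom_eq E) (hom_in I) x" if "x \<in> Z" for x
    using optimality[OF Z_min[OF that]] by (simp_all add: F_eval g)
  obtain m :: "'n option \<Rightarrow> 'n option mpoly" and e t where
    finZ: "finite Z" and gen: "\<forall>p. (\<forall>u\<in>Z. eval p u = 0) \<longrightarrow> p \<in> ideal_gen m"
    and e: "0 < e" and mem: "P - Const e * ((\<Sum>i\<in>UNIV. (m i * (1 - P * t)) ^ 2) + P ^ 2) \<in> M"
    by (rule nondegenerate_membership[OF disj P_nonneg' Z_eq Z_ne licq scc sosc])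
  have SOS_part: "Const e * ((\<Sum>i\<in>UNIV. (m i * (1 - P * t)) ^ 2) + P ^ 2) \<in> M"
    using e by (intro qmod_SOS SOS_mult[OF SOS_Const] SOS_add SOS_sum SOS_square) auto
  have P_M: "P \<in> M" using qmod_add[OF mem SOS_part] by simp
  obtain u where u: "u \<in> Z" using Z_ne by blast
  have u0: "0 < u $ None" and uS: "u \<in> S" and uP: "eval P u = 0" using Z_pos[OF u] u by (auto simp: Z_def)
  have hom_f_u: "eval (homogenize f) u = fmin * u $ None ^ d" using uP by (simp add: P_def)

  \<comment> \<open>Values of the relaxations\<close>
  \<comment> \<open>The point mass at \<open>u\<close> divided by u_0^d, which is possible because
    u_0 > 0, is a feasible sequence of value \<open>fmin\<close>.\<close>
  have point: "\<forall>\<^sub>F k in sequentially. \<exists>w\<in>moment_feasible f c E I k. pairing (homogenize f) w = fmin"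
    using eventually_ge_at_top[of "max d (tdeg (homogenize f))"]
  proof eventually_elim
    case (elim k)
    define w where "w = point_moments k (1 / u $ None ^ d) u"
    have td: "tdeg (Var None ^ tdeg f :: 'n option mpoly) \<le> 2 * k" using elim by (simp add: Var_power d)
    have "pairing (Var None ^ tdeg f) w = 1"
      unfolding w_def pairing_point_moments[OF td] using u0 by (simp add: d)
    moreover have "pairing (homogenize f) w = fmin"
      unfolding w_def using u0 elim by (subst pairing_point_moments) (auto simp: hom_f_u)
    moreover have "w \<in> exponents_le (2 * k) \<rightarrow>\<^sub>E UNIV" by (simp add: w_def point_moments_def)
    moreover have "loc_vec_zero k (1 - norm_sq_poly) w" "\<forall>j\<in>E. loc_vec_zero k (homogenize (c j)) w"
      "loc_psd k (Var None) w" "\<forall>j\<in>I. loc_psd k (homogenize (c j)) w" "loc_psd k 1 w"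
      unfolding w_def using uS u0
      by (auto intro!: point_moments_loc_vec_zero point_moments_loc_psd simp: S_def hom_set_iff)
    ultimately show ?case by (auto simp: moment_feasible_def)
  qed
  have lower: "\<forall>\<^sub>F k in sequentially. \<forall>w\<in>moment_feasible f c E I k. 0 \<le> pairing P w"
    by (rule qmod_pairing_nonneg[OF index_sets(1,2) P_M])
  have pairing_P: "pairing P w = pairing (homogenize f) w - fmin" if "w \<in> moment_feasible f c E I k" for w k
    using that by (simp add: P_def pairing_diff pairing_Const_mult moment_feasible_def d)
  have sos: "\<forall>\<^sub>F k in sequentially. sos_value f c E I k = ereal fmin"
    using qmod_truncation[OF finite_EQ finite_IN P_M]
  proof eventually_elim
    case (elim k)
    have "fmin \<in> sos_feasible f c E I k" using elim by (simp add: sos_feasible_def P_def d)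
    \<comment> \<open>A certificate for \<gamma> is nonnegative at the zero \<open>u\<close> of
      \<open>P\<close>, where the certified polynomial equals (fmin - \<gamma>) u_0^d.\<close>
    moreover have "\<gamma> \<le> fmin" if feas: "\<gamma> \<in> sos_feasible f c E I k" for \<gamma>
    proof -
      obtain p r where "p \<in> trunc_ideal (hom_con c) (hom_eq E) (2 * k)"
        "r \<in> trunc_qmodule (hom_con c) (hom_in I) (2 * k)"
        and pr: "homogenize f - Const \<gamma> * Var None ^ tdeg f = p + r"
        using feas unfolding sos_feasible_def by blast
      then have "0 \<le> eval (p + r) u" using uS by (intro M_nonneg trunc_subset_qmod) (simp_all add: S_loc)
      then have "0 \<le> (fmin - \<gamma>) * u $ None ^ d"
        unfolding pr[symmetric] by (simp add: hom_f_u d algebra_simps)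
      then show ?thesis using zero_less_power[OF u0, of d] by (simp add: zero_le_mult_iff)
    qed
    ultimately show ?case
      unfolding sos_value_def by (intro antisym SUP_least SUP_upper) auto
  qed
  have mom: "\<forall>\<^sub>F k in sequentially. moment_value f c E I k = ereal fmin"
    using point lower
  proof eventually_elim
    case (elim k)
    obtain w where "w \<in> moment_feasible f c E I k" "pairing (homogenize f) w = fmin" using elim(1) by blast
    then have "moment_value f c E I k \<le> ereal fmin"
      unfolding moment_value_def by (metis INF_lower)
    moreover have "ereal fmin \<le> moment_value f c E I k"
      unfolding moment_value_def using elim(2) pairing_P by (intro INF_greatest) auto
    ultimately show ?case by simp
  qed

  \<comment> \<open>Flat truncation of moment minimizers\<close>
  define N where "N = eventually_null f c E I"
  have null_P: "\<forall>\<^sub>F k in sequentially. \<forall>w. moment_minimizer f c E I k w \<longrightarrow> pairing P w = 0"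
    using point lower
  proof eventually_elim
    case (elim k)
    show ?case
    proof (intro allI impI)
      fix w assume w: "moment_minimizer f c E I k w"
      then have "pairing (homogenize f) w \<le> fmin"
        using elim(1) by (auto simp: moment_minimizer_def is_arg_min_def not_less)
      moreover note pairing_P[OF minimizer_feasible[OF w]]
      ultimately show "pairing P w = 0" using elim(2) minimizer_feasible[OF w] by force
    qed
  qed
  define \<rho> where "\<rho> = 1 - P * t"
  \<comment> \<open>In the certificate \<open>mem\<close>, \<open>P\<close> pairs to zero with a
    minimizer while the subtracted squares pair nonnegatively; so each of them has moment
    zero.\<close>
  have squares: "(m i * \<rho>)\<^sup>2 \<in> N" "P\<^sup>2 \<in> N" for i
  proof -
    let ?s = "\<Sum>i\<in>UNIV. (m i * \<rho>)\<^sup>2"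
    have "\<forall>\<^sub>F k in sequentially. \<forall>i. tdeg (m i * \<rho>) \<le> k"
      using eventually_ge_at_top[of "\<Sum>i\<in>UNIV. tdeg (m i * \<rho>)"]
    proof eventually_elim
      case (elim k)
      show ?case
      proof
        fix i
        have "tdeg (m i * \<rho>) \<le> (\<Sum>i\<in>UNIV. tdeg (m i * \<rho>))"
          by (rule member_le_sum) auto
        then show "tdeg (m i * \<rho>) \<le> k" using elim by simp
      qed
    qed
    with null_P qmod_pairing_nonneg[OF index_sets(1,2) mem, of f] eventually_ge_at_top[of "tdeg P"]
    have "\<forall>\<^sub>F k in sequentially. \<forall>w. moment_minimizer f c E I k w \<longrightarrow>
        (\<forall>i. pairing ((m i * \<rho>)\<^sup>2) w = 0) \<and> pairing (P\<^sup>2) w = 0"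
    proof eventually_elim
      case (elim k)
      show ?case
      proof (intro allI impI)
        fix w assume w: "moment_minimizer f c E I k w"
        note feas = minimizer_feasible[OF w]
        have sq: "0 \<le> pairing ((m i * \<rho>)\<^sup>2) w" "0 \<le> pairing (P\<^sup>2) w" for i
          using moment_square_nonneg[OF feas] elim by auto
        have "0 \<le> pairing (P - Const e * (?s + P\<^sup>2)) w" using elim(2) feas unfolding \<rho>_def by blast
        then have "e * ((\<Sum>i\<in>UNIV. pairing ((m i * \<rho>)\<^sup>2) w) + pairing (P\<^sup>2) w) \<le> 0"
          using elim(1) w by (simp add: pairing_diff pairing_Const_mult pairing_add pairing_sum)
        then have "(\<Sum>i\<in>UNIV. pairing ((m i * \<rho>)\<^sup>2) w) + pairing (P\<^sup>2) w \<le> 0"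
          using e by (simp add: mult_le_0_iff)
        moreover have "0 \<le> (\<Sum>i\<in>UNIV. pairing ((m i * \<rho>)\<^sup>2) w)" by (intro sum_nonneg sq)
        ultimately have "(\<Sum>i\<in>UNIV. pairing ((m i * \<rho>)\<^sup>2) w) = 0" "pairing (P\<^sup>2) w = 0"
          using sq(2) by linarith+
        then show "(\<forall>i. pairing ((m i * \<rho>)\<^sup>2) w = 0) \<and> pairing (P\<^sup>2) w = 0"
          using sq(1) by (simp add: sum_nonneg_eq_0_iff)
      qed
    qed
    then show "(m i * \<rho>)\<^sup>2 \<in> N" "P\<^sup>2 \<in> N"
      unfolding N_def eventually_null_def mem_Collect_eq by (auto elim!: eventually_mono)
  qed
  \<comment> \<open>Since 1 = \<rho> + P t, each multiple of m_i is a multiple of m_i \<rho> plus a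
    multiple of \<open>P\<close>, and both kinds are annihilated. This undoes the factor \<rho> that
    the removal of N P^2 introduced.\<close>
  have ideal_null: "p \<in> N" if p: "p \<in> ideal_gen m" for p
  proof -
    obtain b where b: "p = (\<Sum>i\<in>UNIV. m i * b i)" using p by (auto simp: ideal_gen_def)
    have "m i * b i \<in> N" for i
    proof -
      have "m i * b i = (m i * \<rho>) * b i + P * (t * m i * b i)" by (simp add: \<rho>_def algebra_simps)
      then show ?thesis
        using eventually_null_mult[OF squares(1)[of i, unfolded N_def], of "b i"]
          eventually_null_mult[OF squares(2)[unfolded N_def], of "t * m i * b i"]
        by (simp add: N_def eventually_null_add)
    qed
    then show ?thesis unfolding b N_def by (intro eventually_null_sum)
  qed
  define r where "r = card Z"
  have "\<forall>i. \<exists>c. (\<Prod>u\<in>Z. Var i - Const (u $ i)) = Var i ^ r - (\<Sum>n<r. Const (c n) * Var i ^ n)"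
    unfolding r_def by (intro allI monic_product_expansion finZ)
  from choice[OF this] obtain \<gamma> where \<gamma>: "\<And>i. (\<Prod>u\<in>Z. Var i - Const (u $ i)) = Var i ^ r - (\<Sum>n<r. Const (\<gamma> i n) * Var i ^ n)"
    by blast
  \<comment> \<open>The first summand is the degree from which the recurrences reduce exponents; the
    second makes T0 an admissible truncation order. Both \<open>s\<close> and \<open>T0\<close> are
    independent of \<open>k\<close>, so only finitely many recurrences are needed.\<close>
  define s where "s = CARD('n option) * r + order_0 d c E I"
  define T0 where "T0 = s + order_K c E I"
  have null: "(Var i ^ r - (\<Sum>n<r. Const (\<gamma> i n) * Var i ^ n)) * monomial \<alpha> \<in> N" for i \<alpha>
    unfolding \<gamma>[symmetric] using finZ by (intro ideal_null gen[rule_format]) auto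
  have "\<forall>\<^sub>F k in sequentially. \<forall>i\<in>UNIV. \<forall>\<alpha>\<in>exponents_le (2 * T0). \<forall>w. moment_minimizer f c E I k w \<longrightarrow>
      pairing ((Var i ^ r - (\<Sum>n<r. Const (\<gamma> i n) * Var i ^ n)) * monomial \<alpha>) w = 0"
    using null by (intro eventually_ball_finite ballI finite_exponents_le) (auto simp: N_def eventually_null_def)
  then have flat: "\<forall>\<^sub>F k in sequentially. \<forall>w. moment_minimizer f c E I k w \<longrightarrow> flat_truncation d c E I k w"
    using eventually_ge_at_top[of T0]
  proof eventually_elim
    case (elim k)
    show ?case
    proof (intro allI impI)
      fix w assume w: "moment_minimizer f c E I k w"
      have rec: "w (\<alpha> + Poly_Mapping.single i r) = (\<Sum>n<r. \<gamma> i n * w (\<alpha> + Poly_Mapping.single i n))"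
        if "edeg \<alpha> + r \<le> 2 * T0" for i \<alpha>
      proof -
        have "\<alpha> \<in> exponents_le (2 * T0)" using that by (simp add: exponents_le_def)
        then have "pairing ((Var i ^ r - (\<Sum>n<r. Const (\<gamma> i n) * Var i ^ n)) * monomial \<alpha>) w = 0"
          using elim(1) w by blast
        moreover have "(Var i ^ r - (\<Sum>n<r. Const (\<gamma> i n) * Var i ^ n)) * monomial \<alpha>
            = monomial (\<alpha> + Poly_Mapping.single i r) - (\<Sum>n<r. Const (\<gamma> i n) * monomial (\<alpha> + Poly_Mapping.single i n))"
          by (simp add: Var_power right_diff_distrib sum_distrib_left monomial_add mult_ac)
        ultimately show ?thesis by (simp add: pairing_diff pairing_sum pairing_Const_mult)
      qed
      have "moment_rank s (restrict w (exponents_le (2 * T0))) = moment_rank T0 (restrict w (exponents_le (2 * T0)))"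
        by (rule moment_rank_eq[OF rec]) (simp_all add: s_def T0_def)
      moreover have "s = T0 - order_K c E I" by (simp add: T0_def)
      moreover have "T0 \<in> {order_0 d c E I..k}" using elim(2) by (simp add: T0_def s_def)
      ultimately show "flat_truncation d c E I k w" unfolding flat_truncation_def by metis
    qed
  qed
  show ?thesis using sos mom flat by (simp add: eventually_conj)
qed

end
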